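(* Let $T\subset S^4$ be an ideal CCT of width $k\ge 3$ which is in convex position, and let $T'$ be an elementary extension of $T$. Then $T'$ is in convex position as well.
   Context: Spheres are unit spheres; $S^4\subset\mathbb{R}^5$, $S^3_{\mathrm{eq}}=\{x\in S^4:x_5=0\}$. Polytopal complexes consist of spherical polytopes (convex hulls of finitely many points in an open hemisphere). CCTs: $\mathfrak{C}$ is the unit cube tiling of $\mathbb{R}^3$ on $\mathbb{Z}^3$, $\mathfrak{C}[k]$ its subcomplex induced by vertices $v$ with $0\le v_1+v_2+v_3\le k$, $\Lambda$ the lattice generated by $(3,-3,0)$, $(-2,-2,4)$, $\mathfrak{T}[k]=\mathfrak{C}[k]/\Lambda$. A $k$-CCT is a geometric cubical complex $T$ with combinatorial isomorphism $\varphi_T:\mathfrak{T}[k]\to T$; layer $\ell$ = images of vertex classes with coordinate sum $\ell$; $R(T,I)$ = subcomplex induced by layers in $I$. An elementary extension of a $k$-CCT $T$ is a $(k+1)$-CCT $T'$ with $R(T',\{0,\dots,k\})=T$. Symmetric: with $r_{1,2}$ the rotation of the $(x_1,x_2)$-plane of $\mathbb{R}^5$ by $\pi/2$, $r_{3,4}$ the rotation of the $(x_3,x_4)$-plane by $\pi/3$, $s:x_4\mapsto -x_4$, the maps $s,r_{3,4}^2,r_{3,4}r_{1,2}$ preserve $T$ and correspond to the automorphisms of $\mathfrak{T}[k]$ induced by swapping the first two coordinates, translation by $(-1,1,0)$, and translation by $(0,-1,1)$ respectively. $\mathcal{C}_\lambda=\{x\in S^3_{\mathrm{eq}}:x_1^2+x_2^2=1-\lambda/2,\,x_3^2+x_4^2=\lambda/2\}$;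 $\pi_1(y)=\frac{(y_1,y_2,0,0,0)}{\sqrt2\|(y_1,y_2)\|}+\frac{(0,0,y_3,y_4,0)}{\sqrt2\|(y_3,y_4)\|}$; $\pi_0(y)=\frac{(y_1,y_2,0,0,0)}{\|(y_1,y_2)\|}$. A symmetric 2-CCT in $S^3_{\mathrm{eq}}$ is transversal if $\pi_1$ is defined and injective on it; a symmetric $k$-CCT is transversal if all $R(T,\{i-1,i,i+1\})$, $1\le i\le k-1$, are. Slope of a transversal symmetric 2-CCT: for a layer-2 vertex $s$, $t=r_{3,4}^2s$, $u$ the middle vertex of the unique length-2 edge path from $s$ to $t$, $m$ the midpoint of $[s,t]$, $\alpha(T)$ = angle at $m$ between $[m,\pi_0(m)]$ and $[m,u]$. A transversal symmetric $k$-CCT in $S^3_{\mathrm{eq}}$, $k\ge2$, is ideal if $\alpha(R(T,\{k-2,k-1,k\}))>\pi/2$ and the closure of the component of $S^3_{\mathrm{eq}}\setminus T$ containing $\mathcal{C}_0$ meets layer $k$. A symmetric CCT in $S^4$ is ideal if the orthogonal projection $p:S^4\setminus\{\pm e_5\}\to S^3_{\mathrm{eq}}$ is injective on it and $p(T)$ is ideal. A pure polytopal complex $C$ in $S^d$ is in convex position if for every facet $\sigma$ there is a closed hemisphere containing $C$ whose boundary contains the vertices of $\sigma$ but no other vertex of $C$ (equivalently, $C$ is a subcomplex of the boundary complex of a convex polytope). *)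

theory Defs
  imports "HOL-Analysis.Analysis"
begin

section \<open>Polytopal complexes in a unit sphere\<close>

text \<open>\<open>sgn x = x /\<^sub>R norm x\<close> is the central projection to the unit sphere. The spherical convex
  hull of a set that lies in an open hemisphere is the central projection of its Euclidean hull.\<close>

definition sph_hull :: "'a::euclidean_space set \<Rightarrow> 'a set" where
  "sph_hull V = sgn ` (convex hull V)"

definition spherical_polytope :: "'a::euclidean_space set \<Rightarrow> bool" where
  "spherical_polytope P \<longleftrightarrow>
     (\<exists>V a. finite V \<and> V \<subseteq> sphere 0 1 \<and> (\<forall>v\<in>V. a \<bullet> v > 0) \<and> P = sph_hull V)"

text \<open>The choice \<open>a = 0\<close> makes a polytope a face of itself; the empty set is always a face.\<close>

definition sph_face :: "'a::euclidean_space set \<Rightarrow> 'a set \<Rightarrow> bool" where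
  "sph_face F P \<longleftrightarrow> (\<exists>a. (\<forall>x\<in>P. a \<bullet> x \<le> 0) \<and> F = {x \<in> P. a \<bullet> x = 0})"

definition sph_vertices :: "'a::euclidean_space set \<Rightarrow> 'a set" where
  "sph_vertices P = {p. sph_face {p} P}"

definition polytopal_complex :: "'a::euclidean_space set set \<Rightarrow> bool" where
  "polytopal_complex C \<longleftrightarrow>
     finite C \<and>
     (\<forall>P\<in>C. spherical_polytope P) \<and>
     (\<forall>P\<in>C. \<forall>F. sph_face F P \<longrightarrow> F \<in> C) \<and>
     (\<forall>P\<in>C. \<forall>Q\<in>C. sph_face (P \<inter> Q) P \<and> sph_face (P \<inter> Q) Q)"

definition complex_vertices :: "'a::euclidean_space set set \<Rightarrow> 'a set" where
  "complex_vertices C = (\<Union>P\<in>C. sph_vertices P)"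

definition complex_facets :: "'a set set \<Rightarrow> 'a set set" where
  "complex_facets C = {P \<in> C. \<forall>Q\<in>C. P \<subseteq> Q \<longrightarrow> P = Q}"

text \<open>\<open>dim P\<close> is the dimension of the linear span, one more than the spherical dimension.\<close>

definition pure_complex :: "'a::euclidean_space set set \<Rightarrow> bool" where
  "pure_complex C \<longleftrightarrow> (\<forall>P\<in>complex_facets C. \<forall>Q\<in>complex_facets C. dim P = dim Q)"

definition in_convex_position :: "'a::euclidean_space set set \<Rightarrow> bool" where
  "in_convex_position C \<longleftrightarrow>
     polytopal_complex C \<and> pure_complex C \<and>
     (\<forall>\<sigma>\<in>complex_facets C. \<exists>a. a \<noteq> 0 \<and>
        (\<forall>x\<in>\<Union>C. a \<bullet> x \<le> 0) \<and>
        (\<forall>v\<in>sph_vertices \<sigma>. a \<bullet> v = 0) \<and>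
        (\<forall>v\<in>complex_vertices C - sph_vertices \<sigma>. a \<bullet> v \<noteq> 0))"


section \<open>The abstract complexes\<close>

definition coord_sum :: "int^3 \<Rightarrow> int" where
  "coord_sum v = v$1 + v$2 + v$3"

text \<open>Faces of the unit cube tiling are represented by their vertex sets: \<open>v\<close> is the minimal vertex
  of \<open>cube_face v J\<close> and \<open>J\<close> its set of directions. The empty face is included.\<close>

definition cube_face :: "int^3 \<Rightarrow> 3 set \<Rightarrow> (int^3) set" where
  "cube_face v J = {w. \<forall>i. w$i = v$i \<or> (i \<in> J \<and> w$i = v$i + 1)}"

definition cube_tiling :: "(int^3) set set" where
  "cube_tiling = insert {} {cube_face v J |v J. True}"

definition cube_strip :: "nat \<Rightarrow> (int^3) set set" where
  "cube_strip k = {F \<in> cube_tiling. \<forall>v\<in>F. 0 \<le> coord_sum v \<and> coord_sum v \<le> int k}"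

definition Lambda :: "(int^3) set" where
  "Lambda = {m *s vector [3, -3, 0] + n *s vector [-2, -2, 4] |m n. True}"

definition vclass :: "int^3 \<Rightarrow> (int^3) set" where
  "vclass v = (\<lambda>l. v + l) ` Lambda"

text \<open>Nonzero elements of \<open>Lambda\<close> have an entry of absolute value at least 3, and \<open>Lambda\<close> preserves
  coordinate sums. Hence a face of the quotient complex is determined by its set of vertex classes,
  and the face order of the quotient is inclusion of these sets.\<close>

definition torus_strip :: "nat \<Rightarrow> (int^3) set set set" where
  "torus_strip k = (\<lambda>F. vclass ` F) ` cube_strip k"


section \<open>CCTs\<close>

text \<open>A CCT is a complex \<open>T\<close> together with a labelling \<open>\<phi>\<close> of its faces. Since \<open>\<phi>\<close> is an isomorphism
  of face posets, every face of \<open>T\<close> is a combinatorial cube.\<close>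

definition is_cct :: "nat \<Rightarrow> (real^5) set set \<Rightarrow> ((int^3) set set \<Rightarrow> (real^5) set) \<Rightarrow> bool" where
  "is_cct k T \<phi> \<longleftrightarrow>
     polytopal_complex T \<and>
     bij_betw \<phi> (torus_strip k) T \<and>
     (\<forall>F\<in>torus_strip k. \<forall>G\<in>torus_strip k. F \<subseteq> G \<longleftrightarrow> \<phi> F \<subseteq> \<phi> G)"

definition layer :: "((int^3) set set \<Rightarrow> (real^5) set) \<Rightarrow> int \<Rightarrow> (real^5) set" where
  "layer \<phi> l = {p. \<exists>v. coord_sum v = l \<and> \<phi> {vclass v} = {p}}"

definition layer_restr ::
  "(real^5) set set \<Rightarrow> ((int^3) set set \<Rightarrow> (real^5) set) \<Rightarrow> int set \<Rightarrow> (real^5) set set" where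
  "layer_restr T \<phi> I = {P \<in> T. sph_vertices P \<subseteq> (\<Union>l\<in>I. layer \<phi> l)}"

text \<open>The equality of \<open>T\<close> with the restriction of \<open>T'\<close> is one of CCTs, so the labellings agree.\<close>

definition elementary_extension ::
  "nat \<Rightarrow> (real^5) set set \<Rightarrow> ((int^3) set set \<Rightarrow> (real^5) set) \<Rightarrow>
   (real^5) set set \<Rightarrow> ((int^3) set set \<Rightarrow> (real^5) set) \<Rightarrow> bool" where
  "elementary_extension k T \<phi> T' \<phi>' \<longleftrightarrow>
     is_cct k T \<phi> \<and> is_cct (k + 1) T' \<phi>' \<and>
     layer_restr T' \<phi>' {0..int k} = T \<and>
     (\<forall>F\<in>torus_strip k. \<phi>' F = \<phi> F)"


section \<open>Symmetry\<close>

definition plane_rot :: "5 \<Rightarrow> 5 \<Rightarrow> real \<Rightarrow> real^5 \<Rightarrow> real^5" where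
  "plane_rot i j \<theta> x =
     (\<chi> l. if l = i then cos \<theta> * x$i - sin \<theta> * x$j
           else if l = j then sin \<theta> * x$i + cos \<theta> * x$j else x$l)"

definition r12 :: "real^5 \<Rightarrow> real^5" where
  "r12 = plane_rot 1 2 (pi/2)"

definition r34 :: "real^5 \<Rightarrow> real^5" where
  "r34 = plane_rot 3 4 (pi/3)"

definition refl4 :: "real^5 \<Rightarrow> real^5" where
  "refl4 x = (\<chi> l. if l = 4 then - x$4 else x$l)"

definition swap12 :: "int^3 \<Rightarrow> int^3" where
  "swap12 v = vector [v$2, v$1, v$3]"

text \<open>The map \<open>f\<close> preserves \<open>T\<close> and acts on it as the automorphism induced by \<open>g\<close>.\<close>

definition induces ::
  "nat \<Rightarrow> (real^5) set set \<Rightarrow> ((int^3) set set \<Rightarrow> (real^5) set) \<Rightarrow>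
   (real^5 \<Rightarrow> real^5) \<Rightarrow> (int^3 \<Rightarrow> int^3) \<Rightarrow> bool" where
  "induces k T \<phi> f g \<longleftrightarrow>
     (\<lambda>P. f ` P) ` T = T \<and>
     (\<forall>F\<in>torus_strip k. f ` \<phi> F = \<phi> ((\<lambda>c. g ` c) ` F))"

text \<open>The sign \<open>\<epsilon>\<close> leaves open the sense in which \<open>r34 \<circ> r34\<close> moves along \<open>(-1,1,0)\<close>. Only
  \<open>\<epsilon> = -1\<close> can occur: conjugating with \<open>refl4\<close> turns \<open>r34 \<circ> r12\<close> into \<open>r34\<inverse> \<circ> r12\<close>, and conjugating with
  \<open>swap12\<close> turns the translation by \<open>(0,-1,1)\<close> into that by \<open>(0,-1,1) + (-1,1,0)\<close>; so \<open>(-1,1,0)\<close>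
  must act as the inverse of \<open>r34 \<circ> r34\<close>. Fixing \<open>\<epsilon> = 1\<close> would leave no symmetric CCT at all.\<close>

definition symmetric_cct ::
  "nat \<Rightarrow> (real^5) set set \<Rightarrow> ((int^3) set set \<Rightarrow> (real^5) set) \<Rightarrow> bool" where
  "symmetric_cct k T \<phi> \<longleftrightarrow>
     is_cct k T \<phi> \<and>
     induces k T \<phi> refl4 swap12 \<and>
     (\<exists>\<epsilon>\<in>{1, -1}. induces k T \<phi> (r34 \<circ> r34) (\<lambda>v. v + \<epsilon> *s vector [-1, 1, 0])) \<and>
     induces k T \<phi> (r34 \<circ> r12) (\<lambda>v. v + vector [0, -1, 1])"


section \<open>Transversal and ideal CCTs\<close>

definition S3eq :: "(real^5) set" where
  "S3eq = {x \<in> sphere 0 1. x$5 = 0}"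

definition clifford :: "real \<Rightarrow> (real^5) set" where
  "clifford c = {x \<in> S3eq. (x$1)\<^sup>2 + (x$2)\<^sup>2 = 1 - c/2 \<and> (x$3)\<^sup>2 + (x$4)\<^sup>2 = c/2}"

definition part12 :: "real^5 \<Rightarrow> real^5" where
  "part12 y = (\<chi> l. if l = 1 \<or> l = 2 then y$l else 0)"

definition part34 :: "real^5 \<Rightarrow> real^5" where
  "part34 y = (\<chi> l. if l = 3 \<or> l = 4 then y$l else 0)"

definition proj1 :: "real^5 \<Rightarrow> real^5" where
  "proj1 y = part12 y /\<^sub>R (sqrt 2 * norm (part12 y)) + part34 y /\<^sub>R (sqrt 2 * norm (part34 y))"

definition proj0 :: "real^5 \<Rightarrow> real^5" where
  "proj0 y = part12 y /\<^sub>R norm (part12 y)"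

definition transversal2 :: "(real^5) set set \<Rightarrow> bool" where
  "transversal2 R \<longleftrightarrow>
     (\<forall>y\<in>\<Union>R. part12 y \<noteq> 0 \<and> part34 y \<noteq> 0) \<and> inj_on proj1 (\<Union>R)"

definition transversal_cct ::
  "nat \<Rightarrow> (real^5) set set \<Rightarrow> ((int^3) set set \<Rightarrow> (real^5) set) \<Rightarrow> bool" where
  "transversal_cct k T \<phi> \<longleftrightarrow>
     symmetric_cct k T \<phi> \<and> \<Union>T \<subseteq> S3eq \<and>
     (\<forall>i\<in>{1..int k - 1}. transversal2 (layer_restr T \<phi> {i - 1, i, i + 1}))"

text \<open>The angle at \<open>m\<close> between the geodesics from \<open>m\<close> to \<open>a\<close> and to \<open>b\<close>: their initial directions are
  the components of \<open>a\<close> and \<open>b\<close> orthogonal to \<open>m\<close>.\<close>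

definition sph_angle :: "'a::euclidean_space \<Rightarrow> 'a \<Rightarrow> 'a \<Rightarrow> real" where
  "sph_angle m a b =
     (let a' = a - (a \<bullet> m) *\<^sub>R m; b' = b - (b \<bullet> m) *\<^sub>R m
      in arccos ((a' \<bullet> b') / (norm a' * norm b')))"

text \<open>\<open>R\<close> is the complex of a 2-CCT and \<open>L\<close> its layer 2; by symmetry the choice of \<open>s\<close> is immaterial.\<close>

definition slope :: "(real^5) set set \<Rightarrow> (real^5) set \<Rightarrow> real" where
  "slope R L =
     (let s = (SOME s. s \<in> L);
          t = r34 (r34 s);
          u = (THE u. u \<in> complex_vertices R \<and> u \<noteq> s \<and> u \<noteq> t \<and>
                      sph_hull {s, u} \<in> R \<and> sph_hull {u, t} \<in> R);
          m = sgn (s + t)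
      in sph_angle m (proj0 m) u)"

definition ideal_cct_S3 ::
  "nat \<Rightarrow> (real^5) set set \<Rightarrow> ((int^3) set set \<Rightarrow> (real^5) set) \<Rightarrow> bool" where
  "ideal_cct_S3 k T \<phi> \<longleftrightarrow>
     2 \<le> k \<and> transversal_cct k T \<phi> \<and>
     slope (layer_restr T \<phi> {int k - 2, int k - 1, int k}) (layer \<phi> (int k)) > pi/2 \<and>
     (\<exists>K\<in>components (S3eq - \<Union>T). clifford 0 \<subseteq> K \<and> closure K \<inter> layer \<phi> (int k) \<noteq> {})"

definition eq_proj :: "real^5 \<Rightarrow> real^5" where
  "eq_proj x = sgn (\<chi> l. if l = 5 then 0 else x$l)"

definition ideal_cct ::
  "nat \<Rightarrow> (real^5) set set \<Rightarrow> ((int^3) set set \<Rightarrow> (real^5) set) \<Rightarrow> bool" where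
  "ideal_cct k T \<phi> \<longleftrightarrow>
     symmetric_cct k T \<phi> \<and>
     axis 5 1 \<notin> \<Union>T \<and> - axis 5 1 \<notin> \<Union>T \<and>
     inj_on eq_proj (\<Union>T) \<and>
     ideal_cct_S3 k ((\<lambda>P. eq_proj ` P) ` T) (\<lambda>F. eq_proj ` \<phi> F)"

end

theory Submission
  imports Defs
begin

text \<open>
  Write \<open>\<real>\<^sup>5 = \<complex> \<times> \<complex> \<times> \<real>\<close> and \<open>\<omega> = exp (i \<pi> / 3)\<close>. The symmetries put the vertex with label \<open>v\<close> in layer
  \<open>l\<close> on the ray of \<open>(i^{v\<^sub>3} \<zeta>\<^sub>l, \<plusminus> \<omega>^{v\<^sub>1 - v\<^sub>2}, d\<^sub>l)\<close>. That the squares in directions \<open>{1,3}\<close> are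
  planar means that the points \<open>i^l \<zeta>\<^sub>l\<close> form a rectangular spiral, so \<open>\<zeta>\<^sub>l = e (A\<^sub>l\<^sub>+\<^sub>1 - i A\<^sub>l)\<close> with real
  \<open>A\<close>, and that \<open>d\<close> grows proportionally to its arc length. Planarity in directions \<open>{1,2}\<close> is a linear
  recurrence \<open>\<theta> A\<^sub>i\<^sub>+\<^sub>2 + (1 - \<theta>) A\<^sub>i = 2 A\<^sub>i\<^sub>+\<^sub>1\<close>, whose \<open>\<theta>\<close> is the same for all layers and which also
  determines the new layer. Convexity of \<open>T\<close> at a single facet makes a quadratic invariant of the
  recurrence negative. This sign and the positivity of the steps \<open>A\<^sub>i\<^sub>+\<^sub>2 + A\<^sub>i\<close> already imply that the
  hyperplane of every cube, old or new, supports all layers: on half of the vertices the supporting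
  functional is a cosh-like solution of the recurrence, on the other half it increases with the cube.
\<close>

text \<open>By symmetry the value of a supporting functional at a vertex depends on four data: the
  bottom layer \<open>b\<close> of the cube, the layer \<open>l\<close> of the vertex, the
  difference of third coordinates modulo 4, and the real part \<open>c\<close> of a sixth root of
  unity. The four residues give four inequalities about one sequence. Reading the layers from the
  top exchanges \<open>\<theta>\<close> with \<open>1 - \<theta>\<close> and pairs residue 0 with 1
  and residue 2 with 3. One facet suffices because, under the recurrence, \<open>seq_disc\<close> is
  the Casorati determinant \<open>A (b + 1) * A (b + 3) - (A (b + 2))\<^sup>2\<close>: raising
  \<open>b\<close> by one multiplies it by the product of the roots of
  \<open>\<theta> x\<^sup>2 - 2 x + 1 - \<theta>\<close>, which is positive. An elementary extension
  comes without symmetry, so the shape of the new layer has to be derived: each new vertex is the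
  top corner of three squares whose other corners are old. Transversality keeps both complex parts
  of the old vertices away from 0, which allows rescaling to a second part of modulus one.\<close>

section \<open>Recurrent sequences\<close>

text \<open>The recurrence rewrites as \<open>\<theta> * (f (i + 2) - f (i + 1)) = f (i + 1) + (1 -
  \<theta>) * (f (i + 1) - f i)\<close>, so a positive increasing step forces the next one. Below
  the valley \<open>2 g, g, 2 g\<close> the same holds with \<open>\<theta>\<close> and
  \<open>1 - \<theta>\<close> exchanged.\<close>

lemma cosh_like_sequence:
  fixes f :: "nat \<Rightarrow> real"
  assumes th: "0 < \<theta>" "\<theta> < 1" and g: "0 < g"
    and rec: "\<And>i. i + 2 \<le> n \<Longrightarrow> \<theta> * f (i + 2) + (1 - \<theta>) * f i = 2 * f (i + 1)"
    and c: "c + 2 \<le> n" "f c = 2 * g" "f (c + 1) = g" "f (c + 2) = 2 * g"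
    and j: "j \<le> n" "j \<notin> {c, c + 1, c + 2}"
  shows "2 * g < f j"
proof -
  have up: "2 * g \<le> f (c + 2 + i) \<and> f (c + 2 + i) < f (c + 3 + i)" if "c + 3 + i \<le> n" for i
    using that
  proof (induction i)
    case 0
    have "\<theta> * f (c + 3) + (1 - \<theta>) * g = 4 * g"
      using rec[of "c + 1"] 0 c by (simp add: eval_nat_numeral)
    then have "\<theta> * (f (c + 3) - f (c + 2)) = (3 - \<theta>) * g" using c by (simp add: algebra_simps)
    moreover have "0 < (3 - \<theta>) * g" using th g by simp
    ultimately have "0 < f (c + 3) - f (c + 2)" using th by (metis less_asym zero_less_mult_iff)
    then show ?case using c by simp
  next
    case (Suc i)
    have IH: "2 * g \<le> f (c + 2 + i)" "f (c + 2 + i) < f (c + 3 + i)" using Suc by auto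
    have "\<theta> * f (c + 4 + i) + (1 - \<theta>) * f (c + 2 + i) = 2 * f (c + 3 + i)"
      using rec[of "c + 2 + i"] Suc.prems by (simp add: eval_nat_numeral)
    then have "\<theta> * (f (c + 4 + i) - f (c + 3 + i))
        = f (c + 3 + i) + (1 - \<theta>) * (f (c + 3 + i) - f (c + 2 + i))" by (simp add: algebra_simps)
    moreover have "0 < f (c + 3 + i) + (1 - \<theta>) * (f (c + 3 + i) - f (c + 2 + i))"
      using th g IH by (intro add_pos_nonneg) auto
    ultimately have "0 < f (c + 4 + i) - f (c + 3 + i)" using th by (metis less_asym zero_less_mult_iff)
    then show ?case using IH by (simp add: eval_nat_numeral)
  qed
  have down: "2 * g \<le> f (c - i) \<and> f (c - i) < f (c - Suc i)" if "Suc i \<le> c" for i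
    using that
  proof (induction i)
    case 0
    then obtain c' where c': "c = Suc c'" by (cases c) auto
    have "\<theta> * g + (1 - \<theta>) * f c' = 4 * g" using rec[of c'] c c' by (simp add: eval_nat_numeral)
    then have "(1 - \<theta>) * (f c' - f c) = (2 + \<theta>) * g" using c by (simp add: algebra_simps)
    moreover have "0 < (2 + \<theta>) * g" using th g by simp
    ultimately have "0 < f c' - f c" using th by (metis diff_gt_0_iff_gt less_asym zero_less_mult_iff)
    then show ?case using c c' by simp
  next
    case (Suc i)
    then obtain c' where c': "c = c' + i + 2" by (metis Suc_eq_plus1 add.commute add_2_eq_Suc' add_Suc_right le_Suc_ex)
    have IH: "2 * g \<le> f (c' + 2)" "f (c' + 2) < f (c' + 1)" using Suc c' by auto
    have "\<theta> * f (c' + 2) + (1 - \<theta>) * f c' = 2 * f (c' + 1)" using rec[of c'] c c' by simp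
    then have "(1 - \<theta>) * (f c' - f (c' + 1)) = f (c' + 1) + \<theta> * (f (c' + 1) - f (c' + 2))"
      by (simp add: algebra_simps)
    moreover have "0 < f (c' + 1) + \<theta> * (f (c' + 1) - f (c' + 2))"
      using th g IH by (intro add_pos_nonneg) auto
    ultimately have "0 < f c' - f (c' + 1)" using th by (metis diff_gt_0_iff_gt less_asym zero_less_mult_iff)
    then show ?case using IH c' by simp
  qed
  consider "j < c" | "c + 2 < j" using j by fastforce
  then show ?thesis
  proof cases
    case 1
    then have "j = c - Suc (c - j - 1)" by simp
    then show ?thesis using down[of "c - j - 1"] 1 by fastforce
  next
    case 2
    then have "j = c + 3 + (j - c - 3)" by simp
    then show ?thesis using up[of "j - c - 3"] j by fastforce
  qed
qed

text \<open>The points of layer \<open>l\<close> are \<open>(i^n (A (l + 1) - i A l), \<omega>^h, C seq_height l)\<close> up to scaling, where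
  \<open>n + h + l\<close> is even. The hyperplane of the cube with bottom layer \<open>b\<close> is
  \<open>Re ((- seq_mass + i seq_gap) z) + 4 seq_disc Re y + seq_gap x\<^sub>5 / C = 0\<close>.
  Under the recurrence \<open>seq_disc\<close> is multiplied by \<open>(1 - \<theta>) / \<theta>\<close> from one cube to the next.\<close>

definition seq_gap :: "(nat \<Rightarrow> real) \<Rightarrow> nat \<Rightarrow> real" where
  "seq_gap A b = A (b + 3) - A (b + 1)"

definition seq_mass :: "(nat \<Rightarrow> real) \<Rightarrow> nat \<Rightarrow> real" where
  "seq_mass A b = A (b + 3) + 2 * A (b + 2) + A (b + 1)"

definition seq_disc :: "real \<Rightarrow> (nat \<Rightarrow> real) \<Rightarrow> nat \<Rightarrow> real" where
  "seq_disc \<theta> A b = 3 * (A (b + 2))\<^sup>2 + 2 * (1 - 2 * \<theta>) * A (b + 2) * seq_gap A b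
     - \<theta> * (1 - \<theta>) * (seq_gap A b)\<^sup>2"

text \<open>The recurrence makes its increments \<open>A (l + 2) + A l\<close>, the step lengths of
  the spiral. As a combination of shifts of \<open>A\<close> it also solves the recurrence, which
  has no nonzero constant solution; this fixes the constant of summation.\<close>

definition seq_height :: "real \<Rightarrow> (nat \<Rightarrow> real) \<Rightarrow> nat \<Rightarrow> real" where
  "seq_height \<theta> A l = (1 + 2 * \<theta>) * A (l + 1) - (3 - 2 * \<theta>) * A l"

section \<open>Signs carried along the recurrence\<close>

locale layer_seq =
  fixes \<theta> :: real and A :: "nat \<Rightarrow> real" and N :: nat
  assumes th: "0 < \<theta>" "\<theta> < 1"
    and rec: "\<And>i. i + 2 \<le> N \<Longrightarrow> \<theta> * A (i + 2) + (1 - \<theta>) * A i = 2 * A (i + 1)"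
    and step_pos: "\<And>i. i + 2 \<le> N \<Longrightarrow> 0 < A (i + 2) + A i"
begin

text \<open>\<open>A (b + 2)\<close> and the gap serve as the two free parameters of the sequence
  near cube \<open>b\<close>; in them the later identities become polynomial. The factor
  \<open>1 - \<theta>\<close> on \<open>A b\<close> avoids a division.\<close>

lemma via_gap:
  assumes "b + 3 \<le> N"
  shows "A (b + 3) = 2 * A (b + 2) + (1 - \<theta>) * seq_gap A b"
    and "A (b + 1) = 2 * A (b + 2) - \<theta> * seq_gap A b"
    and "(1 - \<theta>) * A b = (4 - \<theta>) * A (b + 2) - 2 * \<theta> * seq_gap A b"
    and "seq_mass A b = 6 * A (b + 2) + (1 - 2 * \<theta>) * seq_gap A b"
proof -
  have r: "\<theta> * A (b + 3) + (1 - \<theta>) * A (b + 1) = 2 * A (b + 2)"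
    using rec[of "b + 1"] assms by (simp add: eval_nat_numeral)
  show 1: "A (b + 3) = 2 * A (b + 2) + (1 - \<theta>) * seq_gap A b"
    and 2: "A (b + 1) = 2 * A (b + 2) - \<theta> * seq_gap A b"
    using r unfolding seq_gap_def by (auto simp: algebra_simps)
  show "(1 - \<theta>) * A b = (4 - \<theta>) * A (b + 2) - 2 * \<theta> * seq_gap A b"
    using rec[of b] assms 2 by (simp add: algebra_simps)
  show "seq_mass A b = 6 * A (b + 2) + (1 - 2 * \<theta>) * seq_gap A b"
    unfolding seq_mass_def using 1 2 by (simp add: algebra_simps)
qed

lemma gap_step: "b + 4 \<le> N \<Longrightarrow> \<theta> * seq_gap A (b + 1) = 3 * A (b + 2) + 2 * (1 - \<theta>) * seq_gap A b"
  using rec[of "b + 2"] via_gap(1)[of b] by (simp add: seq_gap_def eval_nat_numeral algebra_simps)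

text \<open>A Casorati determinant picks up the product of the characteristic roots. In the
  parameters of \<open>via_gap\<close> only \<open>\<theta> * seq_gap A (b + 1)\<close> is
  polynomial, hence the second factor \<open>\<theta>\<close> in the computation.\<close>

lemma disc_step:
  assumes "b + 4 \<le> N"
  shows "\<theta> * seq_disc \<theta> A (b + 1) = (1 - \<theta>) * seq_disc \<theta> A b"
proof -
  define g D g' D' where "g = A (b + 2)" and "D = seq_gap A b"
    and "g' = A (b + 3)" and "D' = seq_gap A (b + 1)"
  have g': "g' = 2 * g + (1 - \<theta>) * D" and D': "\<theta> * D' = 3 * g + 2 * (1 - \<theta>) * D"
    using via_gap(1)[of b] gap_step[of b] assms by (auto simp: g_def D_def g'_def D'_def)
  have "\<theta> * (\<theta> * seq_disc \<theta> A (b + 1))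
      = 3 * \<theta>\<^sup>2 * g'\<^sup>2 + 2 * (1 - 2 * \<theta>) * \<theta> * g' * (\<theta> * D') - \<theta> * (1 - \<theta>) * (\<theta> * D')\<^sup>2"
    unfolding seq_disc_def g'_def D'_def by (simp add: eval_nat_numeral algebra_simps)
  also have "\<dots> = \<theta> * ((1 - \<theta>) * seq_disc \<theta> A b)"
    unfolding D' g' seq_disc_def g_def[symmetric] D_def[symmetric] by algebra
  finally show ?thesis using th by simp
qed

lemma disc_sign: "b + 3 \<le> N \<Longrightarrow> c + 3 \<le> N \<Longrightarrow> seq_disc \<theta> A b < 0 \<Longrightarrow> seq_disc \<theta> A c < 0"
proof -
  have *: "seq_disc \<theta> A b < 0 \<longleftrightarrow> seq_disc \<theta> A 0 < 0" if "b + 3 \<le> N" for b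
    using that
  proof (induction b)
    case (Suc b)
    have "\<theta> * seq_disc \<theta> A (Suc b) < 0 \<longleftrightarrow> (1 - \<theta>) * seq_disc \<theta> A b < 0"
      using disc_step[of b] Suc.prems by simp
    then show ?case using th Suc by (simp add: mult_less_0_iff)
  qed simp
  show "b + 3 \<le> N \<Longrightarrow> c + 3 \<le> N \<Longrightarrow> seq_disc \<theta> A b < 0 \<Longrightarrow> seq_disc \<theta> A c < 0"
    using * by blast
qed

lemma gap_nonzero: "seq_disc \<theta> A b < 0 \<Longrightarrow> seq_gap A b \<noteq> 0"
  unfolding seq_disc_def by (auto simp: not_less)

text \<open>The gaps solve the recurrence too: \<open>x\<close> is \<open>\<theta>\<close> times the
  next gap and \<open>y\<close> is \<open>1 - \<theta>\<close> times the previous one, written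
  without the index \<open>b - 1\<close>. Their sum is \<open>2 * D\<close>, and a negative
  determinant makes their product positive, so both have the sign of \<open>D\<close>.\<close>

lemma gap_sign_step:
  assumes "b + 4 \<le> N" "seq_disc \<theta> A b < 0"
  shows "0 < seq_gap A (b + 1) \<longleftrightarrow> 0 < seq_gap A b"
proof -
  define g D where "g = A (b + 2)" and "D = seq_gap A b"
  define x y where "x = 3 * g + 2 * (1 - \<theta>) * D" and "y = 2 * \<theta> * D - 3 * g"
  have D: "D \<noteq> 0" using gap_nonzero[OF assms(2)] by (simp add: D_def)
  have "3 * seq_disc \<theta> A b = - (x * y) + \<theta> * (1 - \<theta>) * D\<^sup>2"
    unfolding seq_disc_def x_def y_def g_def[symmetric] D_def[symmetric] by algebra
  moreover have "0 \<le> \<theta> * (1 - \<theta>) * D\<^sup>2" using th by simp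
  ultimately have "0 < x * y" using assms(2) by linarith
  moreover have "x + y = 2 * D" by (simp add: x_def y_def algebra_simps)
  ultimately have "0 < x \<longleftrightarrow> 0 < D" by (auto simp: zero_less_mult_iff)
  moreover have "\<theta> * seq_gap A (b + 1) = x"
    using gap_step[OF assms(1)] by (simp add: x_def g_def D_def)
  ultimately show ?thesis using th by (metis D_def zero_less_mult_iff not_less_iff_gr_or_eq)
qed

lemma gap_sign:
  assumes "b + 3 \<le> N" "seq_disc \<theta> A b < 0" "c + 3 \<le> N"
  shows "0 < seq_gap A b \<longleftrightarrow> 0 < seq_gap A c"
proof -
  have *: "0 < seq_gap A b \<longleftrightarrow> 0 < seq_gap A 0" if "b + 3 \<le> N" for b
    using that
  proof (induction b)
    case (Suc b)
    then show ?case using gap_sign_step[of b] disc_sign[OF assms(1) _ assms(2), of b] by simp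
  qed simp
  show ?thesis using *[OF assms(1)] *[OF assms(3)] by simp
qed

text \<open>The lemmas \<open>value_0\<close>, \<open>value_1\<close>, \<open>value_23\<close> evaluate the functional of cube \<open>b\<close> at layer \<open>l\<close>, for
  \<open>n \<equiv> 0\<close>, \<open>n \<equiv> 1\<close> and \<open>n \<equiv> 2, 3\<close> modulo 4, with \<open>c = Re (\<omega>^h)\<close>; the bound on \<open>c\<close> expresses the parity of \<open>h\<close>.\<close>

lemma value_0:
  assumes b: "b + 3 \<le> N" and l: "l + 1 \<le> N" and M: "seq_disc \<theta> A b < 0"
    and c: "c \<le> (if even (l + b) then 1 else 1/2)"
  defines "X \<equiv> seq_gap A b * seq_height \<theta> A l + 4 * seq_disc \<theta> A b * c
      - seq_mass A b * A (l + 1) + seq_gap A b * A l"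
  shows "0 \<le> X" and "X = 0 \<longleftrightarrow> (l = b \<and> c = 1) \<or> (l = b + 1 \<and> c = 1/2) \<or> (l = b + 2 \<and> c = 1)"
proof -
  \<comment> \<open>\<open>f\<close> omits the term with the root of unity. As a combination of
    \<open>A (l + 1)\<close> and \<open>A l\<close> it solves the recurrence, and at
    \<open>b, b + 1, b + 2\<close> it takes the values \<open>-4 M, -2 M, -4 M\<close> with
    \<open>M = seq_disc \<theta> A b\<close>: the valley of
    \<open>cosh_like_sequence\<close>.\<close>
  define f where "f l = seq_gap A b * seq_height \<theta> A l
      - seq_mass A b * A (l + 1) + seq_gap A b * A l" for l
  define g D where "g = A (b + 2)" and "D = seq_gap A b"
  note vg = via_gap[OF b, folded g_def D_def]
  have dM: "seq_disc \<theta> A b = 3 * g\<^sup>2 + 2 * (1 - 2 * \<theta>) * g * D - \<theta> * (1 - \<theta>) * D\<^sup>2"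
    by (simp add: seq_disc_def g_def D_def)
  have f: "f i = D * ((1 + 2 * \<theta>) * A (i + 1) - (2 - 2 * \<theta>) * A i)
      - (6 * g + (1 - 2 * \<theta>) * D) * A (i + 1)" for i
    by (simp add: f_def seq_height_def vg D_def[symmetric] algebra_simps)
  \<comment> \<open>The bound is \<open>N - 1\<close> because \<open>f i\<close> involves
    \<open>A (i + 1)\<close>.\<close>
  have rf: "\<theta> * f (i + 2) + (1 - \<theta>) * f i = 2 * f (i + 1)" if "i + 2 \<le> N - 1" for i
  proof -
    have r: "\<theta> * A (i + 2) + (1 - \<theta>) * A i = 2 * A (i + 1)"
      "\<theta> * A (i + 3) + (1 - \<theta>) * A (i + 1) = 2 * A (i + 2)"
      using rec[of i] rec[of "i + 1"] that by (auto simp: eval_nat_numeral)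
    have e: "i + 2 + 1 = i + 3" "i + 1 + 1 = i + 2" by auto
    show ?thesis unfolding f e using r by algebra
  qed
  have fb: "f b = 2 * (-2 * seq_disc \<theta> A b)"
  proof -
    have "f b = D * ((1 + 2 * \<theta>) * A (b + 1) - 2 * ((1 - \<theta>) * A b))
      - (6 * g + (1 - 2 * \<theta>) * D) * A (b + 1)" by (simp add: f algebra_simps)
    then show ?thesis unfolding vg(2,3) dM by algebra
  qed
  have fb1: "f (b + 1) = -2 * seq_disc \<theta> A b"
  proof -
    have "f (b + 1) = D * ((1 + 2 * \<theta>) * g - (2 - 2 * \<theta>) * A (b + 1))
      - (6 * g + (1 - 2 * \<theta>) * D) * g" by (simp add: f g_def algebra_simps)
    then show ?thesis unfolding vg(2) dM by algebra
  qed
  have fb2: "f (b + 2) = 2 * (-2 * seq_disc \<theta> A b)"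
  proof -
    have "f (b + 2) = D * ((1 + 2 * \<theta>) * A (b + 3) - (2 - 2 * \<theta>) * g)
      - (6 * g + (1 - 2 * \<theta>) * D) * A (b + 3)" by (simp add: f g_def eval_nat_numeral)
    then show ?thesis unfolding vg(1) dM by algebra
  qed
  have X: "X = f l + 4 * seq_disc \<theta> A b * c" by (simp add: X_def f_def)
  consider "l = b \<or> l = b + 2" | "l = b + 1" | "l \<notin> {b, b + 1, b + 2}" by auto
  then have "0 \<le> X \<and> (X = 0 \<longleftrightarrow> (l = b \<and> c = 1) \<or> (l = b + 1 \<and> c = 1/2) \<or> (l = b + 2 \<and> c = 1))"
  proof cases
    case 1
    then have "X = 4 * seq_disc \<theta> A b * (c - 1)" "c \<le> 1"
      using X fb fb2 c by (auto simp: algebra_simps)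
    then show ?thesis using 1 M by (auto simp: zero_le_mult_iff)
  next
    case 2
    then have "X = 4 * seq_disc \<theta> A b * (c - 1/2)" "c \<le> 1/2"
      using X fb1 c by (auto simp: algebra_simps)
    then show ?thesis using 2 M by (auto simp: zero_le_mult_iff)
  next
    case 3
    have "2 * (-2 * seq_disc \<theta> A b) < f l"
      using cosh_like_sequence[of \<theta> "-2 * seq_disc \<theta> A b" "N - 1" f b l] th M rf fb fb1 fb2 b l 3 by simp
    moreover have "seq_disc \<theta> A b * 1 \<le> seq_disc \<theta> A b * c"
      using M c by (intro mult_left_mono_neg) (auto split: if_splits)
    ultimately show ?thesis using X 3 by auto
  qed
  then show "0 \<le> X" and "X = 0 \<longleftrightarrow> (l = b \<and> c = 1) \<or> (l = b + 1 \<and> c = 1/2) \<or> (l = b + 2 \<and> c = 1)"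
    by auto
qed

text \<open>Turning the sequence upside down swaps the two coefficients of the recurrence. This
  yields \<open>value_1\<close> from \<open>value_0\<close>, and negative gaps from positive
  ones.\<close>

lemma reversed: "layer_seq (1 - \<theta>) (\<lambda>i. A (N - i)) N"
proof
  fix i assume i: "i + 2 \<le> N"
  then obtain j where j: "N = i + 2 + j" using le_Suc_ex by blast
  then have e: "N - (i + 2) = j" "N - i = j + 2" "N - (i + 1) = j + 1" by auto
  show "(1 - \<theta>) * A (N - (i + 2)) + (1 - (1 - \<theta>)) * A (N - i) = 2 * A (N - (i + 1))"
    unfolding e using rec[of j] j by (simp add: algebra_simps)
  show "0 < A (N - (i + 2)) + A (N - i)" unfolding e using step_pos[of j] j by (simp add: algebra_simps)
qed (use th in auto)

text \<open>Layer \<open>l\<close> involves the terms \<open>l\<close> and \<open>l + 1\<close>, so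
  it becomes layer \<open>N - 1 - l\<close>; the cube on the layers \<open>b\<close> to
  \<open>b + 3\<close> gets the bottom layer \<open>N - 1 - (b + 3)\<close>. The new indices add up
  to \<open>2 N - 5 - (l + b)\<close>, which flips the parity.\<close>

lemma reversed_terms:
  assumes b: "b + 4 \<le> N" and l: "l + 1 \<le> N"
  defines "B \<equiv> \<lambda>i. A (N - i)" and "b' \<equiv> N - 4 - b" and "l' \<equiv> N - 1 - l"
  shows "seq_gap B b' = - seq_gap A b" "seq_mass B b' = seq_mass A b"
    "seq_disc (1 - \<theta>) B b' = seq_disc \<theta> A b" "seq_height (1 - \<theta>) B l' = - seq_height \<theta> A l"
    "B l' = A (l + 1)" "B (l' + 1) = A l" "even (l' + b') \<longleftrightarrow> odd (l + b)"
    "b' + 4 \<le> N" "l' + 1 \<le> N"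
    "l' = b' \<longleftrightarrow> l = b + 3" "l' = b' + 1 \<longleftrightarrow> l = b + 2" "l' = b' + 2 \<longleftrightarrow> l = b + 1"
proof -
  obtain c where c: "N = b + 4 + c" using b le_Suc_ex by blast
  have b': "b' = c" by (simp add: b'_def c)
  have B: "B (c + 1) = A (b + 3)" "B (c + 2) = A (b + 2)" "B (c + 3) = A (b + 1)"
    by (auto simp: B_def c intro!: arg_cong[of _ _ A])
  show g: "seq_gap B b' = - seq_gap A b" and "seq_mass B b' = seq_mass A b"
    unfolding seq_gap_def seq_mass_def b' B by simp_all
  show "seq_disc (1 - \<theta>) B b' = seq_disc \<theta> A b"
    unfolding seq_disc_def g unfolding b' B by algebra
  show Bl: "B l' = A (l + 1)" "B (l' + 1) = A l" using l by (auto simp: B_def l'_def intro!: arg_cong[of _ _ A])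
  show "seq_height (1 - \<theta>) B l' = - seq_height \<theta> A l"
    unfolding seq_height_def Bl by (simp add: algebra_simps)
  have "l' + l + 1 = b + 4 + c" using l c by (simp add: l'_def)
  then show "even (l' + b') \<longleftrightarrow> odd (l + b)" unfolding b' by presburger
  show "b' + 4 \<le> N" "l' + 1 \<le> N" "l' = b' \<longleftrightarrow> l = b + 3" "l' = b' + 1 \<longleftrightarrow> l = b + 2"
    "l' = b' + 2 \<longleftrightarrow> l = b + 1" using c b' l by (auto simp: l'_def)
qed

lemma value_1:
  assumes b: "b + 4 \<le> N" and l: "l + 1 \<le> N" and M: "seq_disc \<theta> A b < 0"
    and c: "c \<le> (if even (l + b) then 1/2 else 1)"
  defines "X \<equiv> seq_gap A b * seq_height \<theta> A l + 4 * seq_disc \<theta> A b * c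
      - seq_mass A b * A l - seq_gap A b * A (l + 1)"
  shows "0 \<le> X" and "X = 0 \<longleftrightarrow> (l = b + 1 \<and> c = 1) \<or> (l = b + 2 \<and> c = 1/2) \<or> (l = b + 3 \<and> c = 1)"
proof -
  \<comment> \<open>Reversal swaps \<open>A l\<close> with \<open>A (l + 1)\<close> and changes the
    signs of gap and height, which turns this value into that of \<open>value_0\<close>.\<close>
  interpret rv: layer_seq "1 - \<theta>" "\<lambda>i. A (N - i)" N by (rule reversed)
  note t = reversed_terms[OF b l]
  note v = rv.value_0[of "N - 4 - b" "N - 1 - l" c, unfolded t]
  have c': "c \<le> (if odd (l + b) then 1 else 1/2)" using c by (auto split: if_splits)
  show "0 \<le> X" using v(1)[OF _ _ M c'] t(8,9) unfolding X_def by (auto simp: algebra_simps)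
  show "X = 0 \<longleftrightarrow> (l = b + 1 \<and> c = 1) \<or> (l = b + 2 \<and> c = 1/2) \<or> (l = b + 3 \<and> c = 1)"
    using v(2)[OF _ _ M c'] t(8,9) unfolding X_def by (auto simp: algebra_simps)
qed

text \<open>Both values, divided by the gap, increase with \<open>b\<close>: this is \<open>p2\<close>, \<open>p3\<close> below. At \<open>b = 0\<close> they factor
  into terms that are positive because the first steps are.\<close>

lemma value_23_pos:
  assumes b4: "b + 4 \<le> N" and l: "l + 1 \<le> N" and M: "seq_disc \<theta> A b < 0"
    and D: "0 < seq_gap A b"
  shows "c \<le> (if even (l + b) then 1 else 1/2) \<Longrightarrow>
      0 < seq_gap A b * seq_height \<theta> A l + 4 * seq_disc \<theta> A b * c
      + seq_mass A b * A (l + 1) - seq_gap A b * A l" (is "_ \<Longrightarrow> ?P2")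
    and "c \<le> (if even (l + b) then 1/2 else 1) \<Longrightarrow>
      0 < seq_gap A b * seq_height \<theta> A l + 4 * seq_disc \<theta> A b * c
      + seq_mass A b * A l + seq_gap A b * A (l + 1)" (is "_ \<Longrightarrow> ?P3")
proof -
  have b: "b + 3 \<le> N" using b4 by simp
  have Ms: "seq_disc \<theta> A b' < 0" if "b' + 3 \<le> N" for b' using disc_sign[OF b that M] .
  have Ds: "0 < seq_gap A b'" if "b' + 3 \<le> N" for b' using gap_sign[OF b M that] D by simp
  define g D where "g = A 2" and "D = seq_gap A 0"
  have N3: "3 \<le> N" using b by simp
  note vg = via_gap[of 0, unfolded add_0, OF N3, folded g_def D_def]
  have D0: "0 < D" using Ds[of 0] N3 by (simp add: D_def)
  have dM: "seq_disc \<theta> A 0 = 3 * g\<^sup>2 + 2 * (1 - 2 * \<theta>) * g * D - \<theta> * (1 - \<theta>) * D\<^sup>2"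
    by (simp add: seq_disc_def g_def D_def numeral_2_eq_2)
  have M0: "seq_disc \<theta> A 0 < 0" using Ms[of 0] N3 by simp
  \<comment> \<open>The first step \<open>A 2 + A 0\<close>, multiplied by
    \<open>1 - \<theta>\<close> and written in \<open>g\<close> and \<open>D\<close>.\<close>
  have L0: "0 < (5 - 2 * \<theta>) * g - 2 * \<theta> * D"
  proof -
    have "0 < (1 - \<theta>) * (g + A 0)" using step_pos[of 0] N3 th by (simp add: g_def numeral_2_eq_2)
    also have "\<dots> = (5 - 2 * \<theta>) * g - 2 * \<theta> * D" using vg(3) by (simp add: algebra_simps)
    finally show ?thesis .
  qed
  have g0: "0 < g"
  proof -
    have "0 < (5 - 2 * \<theta>) * g" using L0 D0 th by (smt (verit) mult_pos_pos)
    then show ?thesis using th by (simp add: zero_less_mult_iff)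
  qed
  have gD: "\<theta> * D < 3 * g"
  proof -
    have "2 * \<theta> * D < (5 - 2 * \<theta>) * g" using L0 by simp
    also have "\<dots> \<le> 6 * g" using g0 th by (intro mult_right_mono) auto
    finally show ?thesis by (simp add: mult.commute)
  qed
  have inc: "0 < A (i + 2) \<and> A (i + 1) < A (i + 2)" if "i + 2 \<le> N" for i
    using that
  proof (induction i)
    case 0
    \<comment> \<open>\<open>\<theta> * D \<le> g\<close> means \<open>A 2 \<le> A 1\<close>; the
      determinant would then be a sum of nonnegative terms.\<close>
    have "\<not> \<theta> * D \<le> g"
    proof
      assume "\<theta> * D \<le> g"
      then have "0 \<le> (g - \<theta> * D) * (3 * g + (2 - \<theta>) * D) + \<theta> * D\<^sup>2"
        using g0 D0 th by (intro add_nonneg_nonneg mult_nonneg_nonneg) auto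
      also have "\<dots> = seq_disc \<theta> A 0" unfolding dM by algebra
      finally show False using M0 by simp
    qed
    then show ?case using g0 vg(2) by (simp add: g_def numeral_2_eq_2)
  next
    case (Suc i)
    then have "0 < A (i + 2)" by simp
    moreover have "0 < (1 - \<theta>) * seq_gap A i" using Ds[of i] Suc.prems th by simp
    ultimately show ?case using via_gap(1)[of i] Suc.prems by (simp add: eval_nat_numeral)
  qed
  \<comment> \<open>Division by the gap makes the coefficient of the height 1, so that
    \<open>p2\<close> and \<open>p3\<close> depend on \<open>b\<close> only through
    \<open>w\<close>, \<open>\<beta>\<close> and a parity. \<open>\<kappa>\<close> is the largest
    real part that the parity admits.\<close>
  define w \<beta> where "w b = seq_mass A b / seq_gap A b" and "\<beta> b = -4 * seq_disc \<theta> A b / seq_gap A b" for b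
  define \<kappa> :: "bool \<Rightarrow> real" where "\<kappa> e = (if e then 1 else 1/2)" for e
  define p2 p3 where
    "p2 b = w b * A (l + 1) - A l + seq_height \<theta> A l - \<beta> b * \<kappa> (even (l + b))" and
    "p3 b = w b * A l + A (l + 1) + seq_height \<theta> A l - \<beta> b * \<kappa> (odd (l + b))" for b
  have mono2: "A 2 \<le> A (b + 2)" if "b + 2 \<le> N" for b
    using that
  proof (induction b)
    case (Suc b)
    then show ?case using inc[of "Suc b"] by simp
  qed (simp add: numeral_2_eq_2)
  have A1A2: "0 < A 1 + A 2" using vg(2) gD by (simp add: g_def)
  \<comment> \<open>\<open>A12\<close> and \<open>A02\<close> contain the factors of the increments
    of \<open>p2\<close> and \<open>p3\<close>. \<open>A 0\<close> and \<open>A 1\<close> may be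
    negative, but \<open>A 0 + A 2\<close> is the first step and
    \<open>A 1 + A 2 = 3 * g - \<theta> * D\<close>.\<close>
  have A12: "0 < A (l + 1) + A (b + 2)" if "b + 2 \<le> N" for b
  proof (cases l)
    case 0
    then show ?thesis using mono2[OF that] A1A2 by simp
  next
    case (Suc m)
    then show ?thesis using inc[of m] inc[OF that] l by simp
  qed
  have A02: "0 < A l + A (b + 2)" if "b + 2 \<le> N" for b
  proof (cases l)
    case 0
    then show ?thesis using mono2[OF that] step_pos[of 0] N3 by (simp add: numeral_2_eq_2)
  next
    case (Suc m)
    show ?thesis
    proof (cases m)
      case 0
      then show ?thesis using mono2[OF that] A1A2 Suc by simp
    next
      case (Suc m')
      then show ?thesis using inc[of m'] inc[OF that] l \<open>l = Suc m\<close> by simp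
    qed
  qed
  have w0: "1 < w 0"
    using D0 vg(4) gD by (simp add: w_def D_def[symmetric] less_divide_eq algebra_simps)
  have \<beta>pos: "0 < \<beta> b" if "b + 3 \<le> N" for b
    using Ms[OF that] Ds[OF that] by (simp add: \<beta>_def divide_less_0_iff)
  have SD: "D < seq_mass A 0" using w0 D0 by (simp add: w_def D_def[symmetric] less_divide_eq)
  have Dp2: "D * p2 0 = D * seq_height \<theta> A l + 4 * seq_disc \<theta> A 0 * \<kappa> (even l)
      + seq_mass A 0 * A (l + 1) - D * A l"
    using D0 by (simp add: p2_def w_def \<beta>_def D_def[symmetric] field_simps)
  have Dp3: "D * p3 0 = D * seq_height \<theta> A l + 4 * seq_disc \<theta> A 0 * \<kappa> (odd l)
      + seq_mass A 0 * A l + D * A (l + 1)"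
    using D0 by (simp add: p3_def w_def \<beta>_def D_def[symmetric] field_simps)
  have base: "0 < p2 0 \<and> 0 < p3 0"
  proof -
    have l0: "0 < p2 0 \<and> 0 < p3 0" if "l = 0"
    proof
      have A1: "A 1 = 2 * g - \<theta> * D" using vg(2) .
      have "0 < (1 - \<theta>) * (seq_mass A 0 * A 1 - D * A 0)"
      proof (cases "0 \<le> A 1")
        case True
        have "\<not> A 1 \<le> A 0"
        proof
          \<comment> \<open>\<open>y\<close> is \<open>(1 - \<theta>) * (A 0 - A 1)\<close>;
            eliminating \<open>g\<close> in its favour gives the determinant nonnegative
            coefficients.\<close>
          define y where "y = (2 + \<theta>) * g - \<theta> * (1 + \<theta>) * D"
          assume "A 1 \<le> A 0"
          then have "0 \<le> (1 - \<theta>) * A 0 - (1 - \<theta>) * A 1" using th by simp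
          then have "0 \<le> y" unfolding vg(3) A1 y_def by (simp add: algebra_simps)
          then have "0 \<le> 3 * y\<^sup>2 + (4 + 2 * \<theta>\<^sup>2) * y * D + \<theta>\<^sup>2 * (1 - \<theta>) * D\<^sup>2"
            using D0 th by (intro add_nonneg_nonneg mult_nonneg_nonneg) auto
          also have "\<dots> = (2 + \<theta>)\<^sup>2 * seq_disc \<theta> A 0" unfolding dM y_def by algebra
          finally show False using M0 th by (simp add: zero_le_mult_iff)
        qed
        then have "D * A 0 < D * A 1" using D0 by simp
        also have "\<dots> \<le> seq_mass A 0 * A 1" using SD True by (intro mult_right_mono) auto
        finally show ?thesis using th by simp
      next
        case False
        \<comment> \<open>A negative \<open>A 1\<close> enters as \<open>- s\<close>; after the
          substitution only positive terms remain.\<close>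
        define s where "s = - A 1"
        have s: "0 < s" "2 * g = \<theta> * D - s" using False A1 by (auto simp: s_def)
        have "(1 - \<theta>) * (seq_mass A 0 * A 1 - D * A 0) = (1 - \<theta>) * seq_mass A 0 * A 1 - D * ((1 - \<theta>) * A 0)"
          by (simp add: algebra_simps)
        also have "\<dots> = (1 + \<theta>\<^sup>2) * s * D + 3 * (1 - \<theta>) * s\<^sup>2 + \<theta> * g * D"
          unfolding vg(3,4) A1 using s(2) by algebra
        also have "0 < \<dots>" using s g0 D0 th by (intro add_pos_pos mult_pos_pos) (auto simp: add_pos_nonneg)
        finally show ?thesis .
      qed
      then have "0 < seq_mass A 0 * A 1 - D * A 0" using th by (simp add: zero_less_mult_iff)
      \<comment> \<open>By \<open>value_0\<close> the functional vanishes at the bottom vertex of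
        cube 0. Residue 2 differs from residue 0 only by the sign of the part coming from the first
        complex coordinate, so twice that part remains.\<close>
      moreover have "D * p2 0 = 2 * (seq_mass A 0 * A 1 - D * A 0)"
      proof -
        have "D * seq_height \<theta> A 0 + 4 * seq_disc \<theta> A 0 * 1 - seq_mass A 0 * A (0 + 1) + D * A 0 = 0"
          using value_0(2)[of 0 0 1] N3 M0 by (simp add: D_def)
        then show ?thesis using Dp2 that by (simp add: \<kappa>_def mult.commute)
      qed
      ultimately show "0 < p2 0" using D0 by (metis mult_pos_pos zero_less_mult_pos zero_less_numeral)
      \<comment> \<open>The value factors into twice the product of
        \<open>(1 - \<theta>) * (A 2 + A 0)\<close> and \<open>A 1 + A 2\<close>.\<close>
      have "(1 - \<theta>) * (D * p3 0) = D * ((1 - \<theta>) * (2 + 2 * \<theta>) * A 1)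
          + (seq_mass A 0 - (3 - 2 * \<theta>) * D) * ((1 - \<theta>) * A 0) + 2 * (1 - \<theta>) * seq_disc \<theta> A 0"
        unfolding Dp3 seq_height_def by (simp add: that \<kappa>_def algebra_simps)
      also have "\<dots> = 2 * ((5 - 2 * \<theta>) * g - 2 * \<theta> * D) * (3 * g - \<theta> * D)"
        unfolding vg(3,4) A1 dM by algebra
      also have "0 < \<dots>" using L0 gD by (intro mult_pos_pos) auto
      finally show "0 < p3 0" using th D0 by (simp add: zero_less_mult_iff)
    qed
    have l1: "0 < p2 0 \<and> 0 < p3 0" if "1 \<le> l"
    proof
      \<comment> \<open>Residue 2 differs from residue 0, and residue 3 from residue 1, only by the
        sign of the part coming from the first complex coordinate. Once this part is positive,
        \<open>value_0\<close> and \<open>value_1\<close> settle the rest.\<close>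
      have i: "0 < A (l + 1)" "A l < A (l + 1)" using inc[of "l - 1"] that l by auto
      have "D * A l < D * A (l + 1)" using D0 i by simp
      also have "\<dots> \<le> seq_mass A 0 * A (l + 1)" using SD i by (intro mult_right_mono) auto
      finally have "0 < D * p2 0"
        using value_0(1)[of 0 l "\<kappa> (even l)"] N3 l M0 unfolding Dp2 by (simp add: \<kappa>_def D_def split: if_splits)
      then show "0 < p2 0" using D0 by (simp add: zero_less_mult_iff)
      have "0 < seq_mass A 0 * A l + D * A (l + 1)"
      proof (cases "l = 1")
        case True
        \<comment> \<open>\<open>A 1\<close> may be negative; the factors found here are
          \<open>A 1 + A 2\<close> and a step.\<close>
        have "seq_mass A 0 * A l + D * A (l + 1) = (3 * g - \<theta> * D) * (A 3 + A 1)"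
          unfolding True vg(1,2,4) one_add_one g_def[symmetric] by algebra
        also have "0 < \<dots>" using gD step_pos[of 1] N3 by (simp add: eval_nat_numeral)
        finally show ?thesis .
      next
        case False
        then have "l - 2 + 2 = l" using that by simp
        then have "0 < A l" using inc[of "l - 2"] l by simp
        then show ?thesis using i SD D0 by (intro add_pos_pos mult_pos_pos) auto
      qed
      then have "0 < D * p3 0"
        using value_1(1)[of 0 l "\<kappa> (odd l)"] b4 l M0 unfolding Dp3
        by (cases "even l") (simp_all add: \<kappa>_def D_def)
      then show "0 < p3 0" using D0 by (simp add: zero_less_mult_iff)
    qed
    show ?thesis using l0 l1 by linarith
  qed
  have step: "p2 b \<le> p2 (b + 1) \<and> p3 b \<le> p3 (b + 1)" if b: "b + 4 \<le> N" for b
  proof -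
    define g D D' M where "g = A (b + 2)" and "D = seq_gap A b" and "D' = seq_gap A (b + 1)"
      and "M = seq_disc \<theta> A b"
    have pos: "0 < D" "0 < D'" "M < 0"
      using Ds[of b] Ds[of "b + 1"] Ms[of b] b by (auto simp: D_def D'_def M_def)
    have tD': "\<theta> * D' = 3 * g + 2 * (1 - \<theta>) * D" using gap_step[OF b] by (simp add: g_def D_def D'_def)
    have g': "A (b + 3) = 2 * g + (1 - \<theta>) * D" using via_gap(1)[of b] b by (simp add: g_def D_def)
    have M: "M = 3 * g\<^sup>2 + 2 * (1 - 2 * \<theta>) * g * D - \<theta> * (1 - \<theta>) * D\<^sup>2"
      by (simp add: M_def seq_disc_def g_def D_def)
    have wb: "w b = 6 * g / D + (1 - 2 * \<theta>)" "w (b + 1) = 6 * A (b + 3) / D' + (1 - 2 * \<theta>)"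
      using via_gap(4)[of b] via_gap(4)[of "b + 1"] b pos
      by (auto simp: w_def D_def D'_def g_def field_simps eval_nat_numeral)
    have M': "seq_disc \<theta> A (b + 1) = (1 - \<theta>) * M / \<theta>"
      using disc_step[OF b] th by (simp add: M_def field_simps)
    \<comment> \<open>\<open>c\<close> is the increase of \<open>w\<close> from \<open>b\<close> to
      \<open>b + 1\<close>, as \<open>dw\<close> shows; \<open>db\<close> expresses the change of
      \<open>\<beta>\<close> by the same quantity.\<close>
    define c where "c = -6 * M / (\<theta> * D * D')"
    have c0: "0 < c" using pos th by (simp add: c_def divide_neg_pos)
    have dw: "w (b + 1) = w b + c"
    proof -
      have "\<theta> * (A (b + 3) * D) - g * (\<theta> * D') = - M" unfolding tD' g' M by algebra
      then have "c = 6 * (\<theta> * (A (b + 3) * D) - g * (\<theta> * D')) / (\<theta> * D * D')" by (simp add: c_def)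
      also have "\<dots> = 6 * A (b + 3) / D' - 6 * g / D" using pos th by (simp add: field_simps)
      finally show ?thesis using wb by simp
    qed
    have db: "\<beta> b / 2 - \<beta> (b + 1) = c * g"
    proof -
      have "c * g = (-2 * M) * (\<theta> * D' - 2 * (1 - \<theta>) * D) / (\<theta> * D * D')"
        unfolding tD' by (simp add: c_def)
      also have "\<dots> = -2 * M / D + 4 * ((1 - \<theta>) * M / \<theta>) / D'" using pos th by (simp add: field_simps)
      finally show ?thesis unfolding \<beta>_def M' M_def[symmetric] D_def[symmetric] D'_def[symmetric] by simp
    qed
    have bpos: "0 < \<beta> b" "0 < \<beta> (b + 1)" using \<beta>pos[of b] \<beta>pos[of "b + 1"] b by auto
    \<comment> \<open>Passing to \<open>b + 1\<close> flips the parity and so exchanges the values 1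
      and 1/2 of \<open>\<kappa>\<close>. For false \<open>e\<close> the claim is \<open>db\<close>;
      for true \<open>e\<close> the right side is larger by half of
      \<open>\<beta> b + \<beta> (b + 1)\<close>.\<close>
    have k: "c * g \<le> \<beta> b * \<kappa> e - \<beta> (b + 1) * \<kappa> (\<not> e)" for e
      using db bpos by (simp add: \<kappa>_def)
    have "0 \<le> c * (A (l + 1) + g)" "0 \<le> c * (A l + g)"
      using A12[of b] A02[of b] b c0 by (auto simp: g_def)
    then show ?thesis using k[of "even (l + b)"] k[of "odd (l + b)"]
      unfolding p2_def p3_def dw by (simp add: algebra_simps)
  qed
  have "0 < p2 b \<and> 0 < p3 b" using b4
  proof (induction b)
    case (Suc b)
    then show ?case using step[of b] by fastforce
  qed (use base in simp)
  then have p: "0 < seq_gap A b * p2 b" "0 < seq_gap A b * p3 b" using D by (simp_all add: Ds[OF b])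
  have e2: "seq_gap A b * p2 b = seq_gap A b * seq_height \<theta> A l + 4 * seq_disc \<theta> A b * \<kappa> (even (l + b))
      + seq_mass A b * A (l + 1) - seq_gap A b * A l"
    using Ds[OF b] by (simp add: p2_def w_def \<beta>_def field_simps)
  have e3: "seq_gap A b * p3 b = seq_gap A b * seq_height \<theta> A l + 4 * seq_disc \<theta> A b * \<kappa> (odd (l + b))
      + seq_mass A b * A l + seq_gap A b * A (l + 1)"
    using Ds[OF b] by (simp add: p3_def w_def \<beta>_def field_simps)
  show ?P2 if "c \<le> (if even (l + b) then 1 else 1/2)"
  proof -
    have "seq_disc \<theta> A b * \<kappa> (even (l + b)) \<le> seq_disc \<theta> A b * c"
      using that M by (intro mult_left_mono_neg) (auto simp: \<kappa>_def)
    then show ?thesis using p(1) e2 by linarith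
  qed
  show ?P3 if "c \<le> (if even (l + b) then 1/2 else 1)"
  proof -
    have "seq_disc \<theta> A b * \<kappa> (odd (l + b)) \<le> seq_disc \<theta> A b * c"
      using that M by (intro mult_left_mono_neg) (auto simp: \<kappa>_def)
    then show ?thesis using p(2) e3 by linarith
  qed
qed

lemma value_23:
  assumes b: "b + 4 \<le> N" and l: "l + 1 \<le> N" and M: "seq_disc \<theta> A b < 0"
  shows "c \<le> (if even (l + b) then 1 else 1/2) \<Longrightarrow>
      0 < seq_gap A b * seq_height \<theta> A l + 4 * seq_disc \<theta> A b * c
      + seq_mass A b * A (l + 1) - seq_gap A b * A l"
    and "c \<le> (if even (l + b) then 1/2 else 1) \<Longrightarrow>
      0 < seq_gap A b * seq_height \<theta> A l + 4 * seq_disc \<theta> A b * c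
      + seq_mass A b * A l + seq_gap A b * A (l + 1)"
proof -
  \<comment> \<open>If the gap is negative, the reversed sequence has a positive one, and reversal
    exchanges the two claims.\<close>
  interpret rv: layer_seq "1 - \<theta>" "\<lambda>i. A (N - i)" N by (rule reversed)
  note t = reversed_terms[OF b l]
  note v = rv.value_23_pos[of "N - 4 - b" "N - 1 - l" c, unfolded t, OF _ _ M]
  have bl: "N - 4 - b + 4 \<le> N" "N - 1 - l + 1 \<le> N" using t by auto
  consider "0 < seq_gap A b" | "0 < - seq_gap A b" using gap_nonzero[OF M] by fastforce
  note cs = this
  show "0 < seq_gap A b * seq_height \<theta> A l + 4 * seq_disc \<theta> A b * c
      + seq_mass A b * A (l + 1) - seq_gap A b * A l"
    if c: "c \<le> (if even (l + b) then 1 else 1/2)"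
  proof (cases rule: cs)
    case 1
    then show ?thesis using value_23_pos(1)[OF b l M _ c] by simp
  next
    case 2
    have "c \<le> (if odd (l + b) then 1/2 else 1)" using c by (auto split: if_splits)
    then show ?thesis using v(2)[OF bl 2] by simp
  qed
  show "0 < seq_gap A b * seq_height \<theta> A l + 4 * seq_disc \<theta> A b * c
      + seq_mass A b * A l + seq_gap A b * A (l + 1)"
    if c: "c \<le> (if even (l + b) then 1/2 else 1)"
  proof (cases rule: cs)
    case 1
    then show ?thesis using value_23_pos(2)[OF b l M _ c] by simp
  next
    case 2
    have "c \<le> (if odd (l + b) then 1 else 1/2)" using c by (auto split: if_splits)
    then show ?thesis using v(1)[OF bl 2] by simp
  qed
qed

end

section \<open>Spherical polytopes\<close>

lemma convex_pos_multiples: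
  assumes "convex S"
  shows "convex {s *\<^sub>R q |s q. 0 < s \<and> q \<in> S}"
proof (rule convexI)
  fix x y and u v :: real
  assume xy: "x \<in> {s *\<^sub>R q |s q. 0 < s \<and> q \<in> S}" "y \<in> {s *\<^sub>R q |s q. 0 < s \<and> q \<in> S}"
    and uv: "0 \<le> u" "0 \<le> v" "u + v = 1"
  then obtain s q t r where *: "x = s *\<^sub>R q" "0 < s" "q \<in> S" "y = t *\<^sub>R r" "0 < t" "r \<in> S" by blast
  define z where "z = u * s + v * t"
  have z: "0 < z"
  proof (cases "u = 0")
    case False
    then have "0 < u * s" "0 \<le> v * t" using uv * by auto
    then show ?thesis by (simp add: z_def)
  qed (use uv * in \<open>simp add: z_def\<close>)
  have "u *\<^sub>R x + v *\<^sub>R y = z *\<^sub>R ((u * s / z) *\<^sub>R q + (v * t / z) *\<^sub>R r)"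
    using z * by (simp add: scaleR_add_right)
  moreover have "(u * s / z) *\<^sub>R q + (v * t / z) *\<^sub>R r \<in> S"
    using z * uv by (intro convexD[OF assms]) (auto simp: add_divide_distrib[symmetric] z_def)
  ultimately show "u *\<^sub>R x + v *\<^sub>R y \<in> {s *\<^sub>R q |s q. 0 < s \<and> q \<in> S}" using z by blast
qed

text \<open>The positive multiples of a convex set form a convex set, so generators may be rescaled
  freely. This lets them be moved into an affine hyperplane.\<close>

lemma sph_hull_rescale:
  assumes "\<And>v. v \<in> V \<Longrightarrow> \<exists>s>0. \<exists>w\<in>W. v = s *\<^sub>R w"
  shows "sph_hull V \<subseteq> sph_hull W"
proof -
  have "convex hull V \<subseteq> {s *\<^sub>R q |s q. 0 < s \<and> q \<in> convex hull W}"
  proof (rule hull_minimal)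
    show "V \<subseteq> {s *\<^sub>R q |s q. 0 < s \<and> q \<in> convex hull W}" using assms hull_inc by fast
  qed (simp add: convex_pos_multiples)
  then show ?thesis unfolding sph_hull_def by (fastforce simp: sgn_scaleR)
qed

lemma spherical_polytope_pos:
  assumes "spherical_polytope P"
  obtains a where "\<And>x. x \<in> P \<Longrightarrow> 0 < a \<bullet> x"
proof -
  obtain V a where V: "\<forall>v\<in>V. a \<bullet> v > 0" "P = sph_hull V"
    using assms unfolding spherical_polytope_def by blast
  have "convex hull V \<subseteq> {x. a \<bullet> x > 0}"
    by (rule hull_minimal) (use V convex_halfspace_gt[of 0 a] in auto)
  then have "0 < a \<bullet> sgn x" if "x \<in> convex hull V" for x
    using that by (auto simp: sgn_div_norm intro!: mult_pos_pos)
  then show ?thesis using that V by (auto simp: sph_hull_def)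
qed

text \<open>Scaling the generators into the hyperplane \<open>a \<bullet> x = 1\<close> makes
  \<open>P\<close> the projection of a Euclidean polytope \<open>Q\<close>. Extreme points of
  \<open>Q\<close> are exposed and project to spherical vertices, so the Krein-Milman theorem for
  \<open>Q\<close> carries the bound from the vertices to \<open>P\<close>.\<close>

lemma spherical_polytope_le:
  assumes P: "spherical_polytope P" and f: "\<And>v. v \<in> sph_vertices P \<Longrightarrow> f \<bullet> v \<le> 0" and x: "x \<in> P"
  shows "f \<bullet> x \<le> 0"
proof -
  obtain V a where V: "finite V" "\<forall>v\<in>V. a \<bullet> v > 0" "P = sph_hull V"
    using P unfolding spherical_polytope_def by blast
  define W where "W = (\<lambda>v. v /\<^sub>R (a \<bullet> v)) ` V"
  define Q where "Q = convex hull W"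
  have PQ: "P = sgn ` Q"
  proof -
    have "sph_hull V \<subseteq> sph_hull W"
    proof (rule sph_hull_rescale)
      fix v assume "v \<in> V"
      then show "\<exists>s>0. \<exists>w\<in>W. v = s *\<^sub>R w" using V
        by (intro exI[of _ "a \<bullet> v"]) (auto simp: W_def intro!: bexI[of _ v])
    qed
    moreover have "sph_hull W \<subseteq> sph_hull V"
    proof (rule sph_hull_rescale)
      fix w assume "w \<in> W"
      then obtain v where "v \<in> V" "w = v /\<^sub>R (a \<bullet> v)" by (auto simp: W_def)
      then show "\<exists>s>0. \<exists>v\<in>V. w = s *\<^sub>R v" using V
        by (intro exI[of _ "inverse (a \<bullet> v)"]) auto
    qed
    ultimately show ?thesis using V by (auto simp: sph_hull_def Q_def)
  qed
  have "Q \<subseteq> {x. a \<bullet> x = 1}" unfolding Q_def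
    by (rule hull_minimal) (use V convex_hyperplane[of a 1] in \<open>auto simp: W_def\<close>)
  then have Q1: "a \<bullet> q = 1" "q \<noteq> 0" if "q \<in> Q" for q using that by auto
  have "f \<bullet> e \<le> 0" if "e extreme_point_of Q" for e
  proof -
    have "{e} exposed_face_of Q"
      using that V exposed_face_of_polyhedron[of Q "{e}"] polyhedron_convex_hull[of W]
      by (simp add: Q_def W_def face_of_singleton)
    then obtain b \<beta> where b: "Q \<subseteq> {x. b \<bullet> x \<le> \<beta>}" "{e} = Q \<inter> {x. b \<bullet> x = \<beta>}"
      unfolding exposed_face_of_def by blast
    \<comment> \<open>On \<open>Q\<close> the affine inequality
      \<open>b \<bullet> x \<le> \<beta>\<close> agrees with the homogeneous one
      \<open>n \<bullet> x \<le> 0\<close>, which is the kind that \<open>sph_face\<close> asks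
      for.\<close>
    define n where "n = b - \<beta> *\<^sub>R a"
    have n: "n \<bullet> q = b \<bullet> q - \<beta>" if "q \<in> Q" for q using Q1[OF that] by (simp add: n_def inner_diff_left)
    have sg: "n \<bullet> sgn q = (n \<bullet> q) / norm q" for q by (simp add: sgn_div_norm field_simps)
    have "e \<in> Q" using b by blast
    have "\<forall>x\<in>P. n \<bullet> x \<le> 0" using b n Q1 unfolding PQ by (auto simp: sg divide_nonpos_pos)
    moreover have "{sgn e} = {x \<in> P. n \<bullet> x = 0}"
    proof -
      have "n \<bullet> sgn q = 0 \<longleftrightarrow> q = e" if "q \<in> Q" for q
        using b(2) that n Q1 by (auto simp: sg)
      then show ?thesis using \<open>e \<in> Q\<close> unfolding PQ by blast
    qed
    ultimately have "sgn e \<in> sph_vertices P" unfolding sph_vertices_def sph_face_def by blast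
    then have "f \<bullet> sgn e \<le> 0" by (rule f)
    then show ?thesis using Q1[OF \<open>e \<in> Q\<close>]
      by (simp add: sgn_div_norm mult_le_0_iff)
  qed
  then have "convex hull {e. e extreme_point_of Q} \<subseteq> {x. f \<bullet> x \<le> 0}"
    by (intro hull_minimal) (auto simp: convex_halfspace_le)
  moreover have "Q = convex hull {e. e extreme_point_of Q}"
    unfolding Q_def by (rule Krein_Milman_polytope) (use V in \<open>simp add: W_def\<close>)
  ultimately have "\<forall>q\<in>Q. f \<bullet> q \<le> 0" by blast
  then show ?thesis using x unfolding PQ by (auto simp: sgn_div_norm mult_le_0_iff)
qed

text \<open>Without vertices, \<open>spherical_polytope_le\<close> would bound every functional
  vacuously, even one that is positive on \<open>P\<close>.\<close>

lemma spherical_polytope_vertex_exists: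
  assumes "spherical_polytope P" "P \<noteq> {}"
  shows "sph_vertices P \<noteq> {}"
proof
  assume "sph_vertices P = {}"
  moreover obtain x where x: "x \<in> P" using assms by blast
  ultimately have "f \<bullet> x \<le> 0" for f using spherical_polytope_le[OF assms(1), of f x] by simp
  then show False using spherical_polytope_pos[OF assms(1)] x by (metis not_le)
qed

lemma functional_of_independent:
  fixes h :: "'a::euclidean_space \<Rightarrow> real"
  assumes "independent B"
  obtains f where "\<And>x. x \<in> B \<Longrightarrow> f \<bullet> x = h x"
proof -
  obtain g where g: "linear g" "\<forall>x\<in>B. g x = h x" using linear_independent_extend[OF assms, of h] by blast
  have "adjoint g 1 \<bullet> x = g x" for x using adjoint_works[OF g(1), of x 1] by (simp add: inner_commute)
  then show ?thesis using that g by metis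
qed

text \<open>A dependency of the four corners exists because otherwise the diagonal \<open>pw\<close> would be
  exposed; the edges \<open>pa\<close>, \<open>pb\<close> and the vertex \<open>w\<close> force its signs.\<close>

lemma quadrilateral_relation:
  fixes p a b w :: "'a::euclidean_space"
  assumes dist: "distinct [p, a, b, w]" and p0: "p \<noteq> 0"
    and edge_a: "f \<bullet> p = 0" "f \<bullet> a = 0" "f \<bullet> b < 0" "f \<bullet> w < 0"
    and edge_b: "h \<bullet> p = 0" "h \<bullet> b = 0" "h \<bullet> a < 0" "h \<bullet> w < 0"
    and vert_w: "n \<bullet> w = 0" "n \<bullet> p < 0" "n \<bullet> a < 0" "n \<bullet> b < 0"
    and diag: "\<And>g. g \<bullet> p = 0 \<Longrightarrow> g \<bullet> w = 0 \<Longrightarrow> g \<bullet> a < 0 \<Longrightarrow> g \<bullet> b < 0 \<Longrightarrow> False"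
  obtains x y s t where "0 < x" "0 < y" "0 < s" "0 < t"
    "x *\<^sub>R p + y *\<^sub>R w = s *\<^sub>R a + t *\<^sub>R b"
proof -
  have "dependent {p, a, b, w}"
  proof (rule ccontr)
    assume "independent {p, a, b, w}"
    then obtain g where "\<And>x. x \<in> {p, a, b, w} \<Longrightarrow> g \<bullet> x = (if x \<in> {a, b} then -1 else 0)"
      by (rule functional_of_independent[where h = "\<lambda>x. if x \<in> {a, b} then -1 else 0"]) blast
    then show False using diag[of g] dist by auto
  qed
  then obtain u where u: "\<exists>v\<in>{p, a, b, w}. u v \<noteq> 0" "(\<Sum>v\<in>{p, a, b, w}. u v *\<^sub>R v) = 0"
    by (auto simp: dependent_finite)
  then have eq: "u p *\<^sub>R p + u a *\<^sub>R a + u b *\<^sub>R b + u w *\<^sub>R w = 0"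
    using dist by (simp add: add.assoc)
  have eqg: "u p * (g \<bullet> p) + u a * (g \<bullet> a) + u b * (g \<bullet> b) + u w * (g \<bullet> w) = 0" for g
    using arg_cong[OF eq, of "\<lambda>x. g \<bullet> x"] by (simp add: inner_add_right)
  \<comment> \<open>A functional exposing an edge leaves only the coefficients of the opposite edge
    and so relates them; in \<open>1\<close> and \<open>2\<close> this makes their signs
    opposite.\<close>
  have 1: "u b * (f \<bullet> b) = - (u w * (f \<bullet> w))" using eqg[of f] edge_a by simp
  have 2: "u a * (h \<bullet> a) = - (u w * (h \<bullet> w))" using eqg[of h] edge_b by simp
  have 3: "u p * (n \<bullet> p) = - (u a * (n \<bullet> a) + u b * (n \<bullet> b))" using eqg[of n] vert_w by simp
  have "u w \<noteq> 0"
  proof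
    assume "u w = 0"
    then have "u a = 0" "u b = 0" using 1 2 edge_a edge_b by auto
    then show False using \<open>u w = 0\<close> u(1) eq p0 by auto
  qed
  then consider "0 < u w" | "u w < 0" by linarith
  then show ?thesis
  proof cases
    case 1
    then have "u b < 0" "u a < 0"
      using \<open>u b * (f \<bullet> b) = _\<close> 2 edge_a edge_b
      by (smt (verit, best) mult_nonneg_nonpos mult_pos_neg)+
    moreover have "0 < u p" using 3 calculation vert_w
      by (smt (verit, best) mult_neg_neg mult_nonpos_nonpos)
    moreover have "u p *\<^sub>R p + u w *\<^sub>R w = (- u a) *\<^sub>R a + (- u b) *\<^sub>R b"
      using eq by (simp add: algebra_simps eq_neg_iff_add_eq_0)
    ultimately show ?thesis using that[of "u p" "u w" "- u a" "- u b"] 1 by auto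
  next
    case 2
    then have "0 < u b" "0 < u a"
      using 1 \<open>u a * (h \<bullet> a) = _\<close> edge_a edge_b
      by (smt (verit, best) mult_nonpos_nonpos mult_neg_neg)+
    moreover have "u p < 0" using 3 calculation vert_w
      by (smt (verit, best) mult_nonneg_nonpos mult_pos_neg)
    moreover have "u a *\<^sub>R a + u b *\<^sub>R b - ((- u p) *\<^sub>R p + (- u w) *\<^sub>R w) = 0"
      using eq by (simp add: algebra_simps)
    then have "(- u p) *\<^sub>R p + (- u w) *\<^sub>R w = u a *\<^sub>R a + u b *\<^sub>R b" by simp
    ultimately show ?thesis using that[of "- u p" "- u w" "u a" "u b"] 2 by auto
  qed
qed

section \<open>Combinatorics of CCTs\<close>

lemma coord_sum_add: "coord_sum (v + w) = coord_sum v + coord_sum w"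
  by (simp add: coord_sum_def)

lemma coord_sum_diff: "coord_sum (v - w) = coord_sum v - coord_sum w"
  by (simp add: coord_sum_def)

lemma coord_sum_axis [simp]: "coord_sum (axis i c) = c"
  using exhaust_3[of i] by (auto simp: coord_sum_def axis_def)

lemma coord_sum_eq_sum: "coord_sum v = (\<Sum>i\<in>UNIV. v $ i)"
  by (simp add: coord_sum_def sum_3)

text \<open>A complete invariant of the class modulo \<open>Lambda\<close>. The two residues are
  those on which the rotations of orders 4 and 6 depend.\<close>

definition vkey :: "int^3 \<Rightarrow> int \<times> int \<times> int" where
  "vkey v = (coord_sum v, v$3 mod 4, (v$1 - v$2) mod 6)"

lemma Lambda_iff: "x \<in> Lambda \<longleftrightarrow> coord_sum x = 0 \<and> 4 dvd x$3 \<and> 6 dvd (x$1 - x$2)"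
proof
  assume "x \<in> Lambda"
  then obtain m n where "x = m *s vector [3, -3, 0] + n *s vector [-2, -2, 4]" unfolding Lambda_def by blast
  then have x: "x$1 = 3 * m - 2 * n" "x$2 = - 3 * m - 2 * n" "x$3 = 4 * n" by auto
  then have "x$1 - x$2 = 6 * m" by simp
  then show "coord_sum x = 0 \<and> 4 dvd x$3 \<and> 6 dvd (x$1 - x$2)"
    using x by (auto simp: coord_sum_def dvd_def)
next
  assume *: "coord_sum x = 0 \<and> 4 dvd x$3 \<and> 6 dvd (x$1 - x$2)"
  then obtain n m where "x$3 = 4 * n" "x$1 - x$2 = 6 * m" by (auto simp: dvd_def)
  then have "x = m *s vector [3, -3, 0] + n *s vector [-2, -2, 4]"
    using * by (auto simp: vec_eq_iff forall_3 coord_sum_def)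
  then show "x \<in> Lambda" unfolding Lambda_def by blast
qed

lemma vclass_eq: "vclass v = {w. vkey w = vkey v}"
proof -
  have "w \<in> vclass v \<longleftrightarrow> w - v \<in> Lambda" for w
    unfolding vclass_def by (auto simp: image_iff intro: bexI[of _ "w - v"])
  moreover have "w - v \<in> Lambda \<longleftrightarrow> vkey w = vkey v" for w
    unfolding Lambda_iff vkey_def by (auto simp: coord_sum_diff mod_eq_dvd_iff algebra_simps)
  ultimately show ?thesis by auto
qed

lemma vclass_eq_iff: "vclass v = vclass w \<longleftrightarrow> vkey v = vkey w"
  unfolding vclass_eq by auto

lemma vclass_sum: "vclass v = vclass w \<Longrightarrow> coord_sum v = coord_sum w"
  by (simp add: vclass_eq_iff vkey_def)

lemma vclass_axis_neq: "i \<noteq> j \<Longrightarrow> vclass (u + axis i 1) \<noteq> vclass (u + axis j 1)"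
proof
  assume ij: "i \<noteq> j" and "vclass (u + axis i 1) = vclass (u + axis j 1)"
  then have "axis i 1 - axis j 1 \<in> Lambda"
    unfolding vclass_eq_iff vkey_def Lambda_iff
    by (auto simp: coord_sum_add coord_sum_diff mod_eq_dvd_iff algebra_simps)
  then show False using ij exhaust_3[of i] exhaust_3[of j] by (auto simp: Lambda_iff axis_def)
qed

lemma cube_face_empty [simp]: "cube_face u {} = {u}"
  by (auto simp: cube_face_def vec_eq_iff)

lemma cube_face_insert:
  assumes "i \<notin> J"
  shows "cube_face u (insert i J) = cube_face u J \<union> cube_face (u + axis i 1) J"
proof (intro set_eqI iffI)
  fix w assume w: "w \<in> cube_face u (insert i J)"
  then consider "w $ i = u $ i" | "w $ i = u $ i + 1" by (auto simp: cube_face_def)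
  then show "w \<in> cube_face u J \<union> cube_face (u + axis i 1) J"
  proof cases
    case 1
    then have "w \<in> cube_face u J" using w by (auto simp: cube_face_def)
    then show ?thesis ..
  next
    case 2
    then have "w \<in> cube_face (u + axis i 1) J" using w by (auto simp: cube_face_def axis_def)
    then show ?thesis ..
  qed
next
  fix w assume "w \<in> cube_face u J \<union> cube_face (u + axis i 1) J"
  then show "w \<in> cube_face u (insert i J)"
  proof
    assume "w \<in> cube_face u J"
    then show ?thesis by (auto simp: cube_face_def)
  next
    assume w: "w \<in> cube_face (u + axis i 1) J"
    have "w $ m = u $ m \<or> (m \<in> insert i J \<and> w $ m = u $ m + 1)" for m
    proof (cases "m = i")
      case True
      have "w $ i = (u + axis i 1) $ i" using w assms unfolding cube_face_def by blast
      then show ?thesis using True by simp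
    next
      case False
      have "w $ m = (u + axis i 1) $ m \<or> (m \<in> J \<and> w $ m = (u + axis i 1) $ m + 1)"
        using w unfolding cube_face_def by blast
      then show ?thesis using False by (simp add: axis_def)
    qed
    then show ?thesis by (simp add: cube_face_def)
  qed
qed

lemma cube_face_sum:
  assumes "w \<in> cube_face u J"
  shows "coord_sum u \<le> coord_sum w" "coord_sum w \<le> coord_sum u + int (card J)"
proof -
  have w: "u $ i \<le> w $ i" "w $ i \<le> u $ i + (if i \<in> J then 1 else 0)" for i
  proof -
    have "w $ i = u $ i \<or> (i \<in> J \<and> w $ i = u $ i + 1)" using assms unfolding cube_face_def by blast
    then show "u $ i \<le> w $ i" "w $ i \<le> u $ i + (if i \<in> J then 1 else 0)" by auto
  qed
  show "coord_sum u \<le> coord_sum w" unfolding coord_sum_eq_sum by (intro sum_mono w)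
  have "coord_sum w \<le> (\<Sum>i\<in>UNIV. u $ i + (if i \<in> J then 1 else 0))"
    unfolding coord_sum_eq_sum by (intro sum_mono w)
  also have "\<dots> = coord_sum u + int (card J)" by (simp add: coord_sum_eq_sum sum.distrib sum.If_cases)
  finally show "coord_sum w \<le> coord_sum u + int (card J)" .
qed

lemma cube_face_self: "u \<in> cube_face u J"
  by (simp add: cube_face_def)

lemma in_torus_strip:
  assumes "0 \<le> coord_sum u" "coord_sum u + int (card J) \<le> int k"
  shows "vclass ` cube_face u J \<in> torus_strip k"
proof -
  have "cube_face u J \<in> cube_strip k"
    using assms cube_face_sum[of _ u J] by (force simp: cube_strip_def cube_tiling_def)
  then show ?thesis unfolding torus_strip_def by blast
qed

lemma torus_strip_cases:
  assumes "F \<in> torus_strip k"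
  obtains "F = {}" | u J where "F = vclass ` cube_face u J" "\<forall>v\<in>cube_face u J. 0 \<le> coord_sum v \<and> coord_sum v \<le> int k"
  using assms unfolding torus_strip_def cube_strip_def cube_tiling_def by auto

lemma empty_in_torus_strip: "{} \<in> torus_strip k"
  unfolding torus_strip_def cube_strip_def cube_tiling_def by (auto simp: image_iff)

lemma torus_strip_range:
  assumes "F \<in> torus_strip k" "vclass v \<in> F"
  shows "0 \<le> coord_sum v" "coord_sum v \<le> int k"
proof -
  have "0 \<le> coord_sum v \<and> coord_sum v \<le> int k"
    using assms(1)
  proof (cases rule: torus_strip_cases)
    case (2 u J)
    then obtain w where "w \<in> cube_face u J" "vclass v = vclass w" using assms(2) by blast
    then show ?thesis using 2(2) vclass_sum[of v w] by simp
  qed (use assms(2) in simp)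
  then show "0 \<le> coord_sum v" "coord_sum v \<le> int k" by auto
qed

lemma torus_strip_vclass: "F \<in> torus_strip k \<Longrightarrow> c \<in> F \<Longrightarrow> \<exists>v. c = vclass v"
  by (cases rule: torus_strip_cases[of F k]) auto

lemma torus_strip_singleton: "0 \<le> coord_sum v \<Longrightarrow> coord_sum v \<le> int k \<Longrightarrow> {vclass v} \<in> torus_strip k"
  using in_torus_strip[of v "{}" k] by simp

text \<open>If there is room above the face, all missing directions are added to it; otherwise its
  base is first lowered along missing directions.\<close>

lemma torus_strip_subset_cube:
  assumes F: "F \<in> torus_strip k" and k: "3 \<le> k"
  obtains u where "0 \<le> coord_sum u" "coord_sum u + 3 \<le> int k" "F \<subseteq> vclass ` cube_face u UNIV"
  using F
proof (cases rule: torus_strip_cases)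
  case 1
  then show ?thesis using that[of 0] k by (simp add: coord_sum_def)
next
  case (2 u J)
  define top where "top = (\<chi> i. u $ i + (if i \<in> J then 1 else 0))"
  have "top \<in> cube_face u J" by (auto simp: top_def cube_face_def)
  moreover have "coord_sum top = coord_sum u + int (card J)"
    by (simp add: top_def coord_sum_eq_sum sum.distrib sum.If_cases)
  ultimately have J: "0 \<le> coord_sum u" "coord_sum u + int (card J) \<le> int k"
    using 2(2) cube_face_self[of u J] by auto
  show ?thesis
  proof (cases "coord_sum u + 3 \<le> int k")
    case True
    have "cube_face u J \<subseteq> cube_face u UNIV" by (auto simp: cube_face_def)
    then show ?thesis using that[of u] True J 2(1) by blast
  next
    case False
    \<comment> \<open>\<open>r\<close> is the overhang of the full cube above layer
      \<open>k\<close>. Lowering the base along \<open>r\<close> directions outside \<open>J\<close>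
      puts it into layer \<open>k - 3\<close> and keeps the face inside the cube.\<close>
    define r where "r = nat (coord_sum u + 3 - int k)"
    have "card (- J) = 3 - card J" using card_Diff_subset[of J UNIV] by (simp add: Compl_eq_Diff_UNIV)
    then have "r \<le> card (- J)" using J False by (simp add: r_def)
    then obtain I where I: "I \<subseteq> - J" "card I = r" by (rule obtain_subset_with_card_n)
    define u' where "u' = (\<chi> i. u $ i - (if i \<in> I then 1 else 0))"
    have "coord_sum u' = coord_sum u - int r"
      by (simp add: u'_def coord_sum_eq_sum sum_subtractf sum.If_cases I)
    then have "coord_sum u' = int k - 3" using False by (simp add: r_def)
    moreover have "cube_face u J \<subseteq> cube_face u' UNIV"
      using I(1) by (auto simp: cube_face_def u'_def)
    ultimately show ?thesis using that[of u'] k 2(1) by fastforce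
  qed
qed

section \<open>Cells and vertices of a CCT in terms of their labels\<close>

definition vpt :: "((int^3) set set \<Rightarrow> (real^5) set) \<Rightarrow> int^3 \<Rightarrow> real^5" where
  "vpt \<phi> v = the_elem (\<phi> {vclass v})"

locale cct =
  fixes k :: nat and T :: "(real^5) set set" and \<phi> :: "(int^3) set set \<Rightarrow> (real^5) set"
  assumes is_cct: "is_cct k T \<phi>"
begin

lemma complex: "polytopal_complex T"
  using is_cct unfolding is_cct_def by simp

lemma polytope: "P \<in> T \<Longrightarrow> spherical_polytope P"
  using complex unfolding polytopal_complex_def by simp

lemma face_closed: "P \<in> T \<Longrightarrow> sph_face F P \<Longrightarrow> F \<in> T"
  using complex unfolding polytopal_complex_def by blast

lemma phi_in: "F \<in> torus_strip k \<Longrightarrow> \<phi> F \<in> T"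
  using is_cct unfolding is_cct_def by (auto dest: bij_betwE)

lemma phi_surj:
  assumes "P \<in> T"
  obtains F where "F \<in> torus_strip k" "P = \<phi> F"
  using is_cct assms unfolding is_cct_def by (metis bij_betw_imp_surj_on imageE)

lemma phi_subset: "F \<in> torus_strip k \<Longrightarrow> G \<in> torus_strip k \<Longrightarrow> \<phi> F \<subseteq> \<phi> G \<longleftrightarrow> F \<subseteq> G"
  using is_cct unfolding is_cct_def by blast

lemma phi_eq: "F \<in> torus_strip k \<Longrightarrow> G \<in> torus_strip k \<Longrightarrow> \<phi> F = \<phi> G \<longleftrightarrow> F = G"
  using phi_subset by (metis order_antisym order_refl)

text \<open>A polytope lies in an open hemisphere, so the empty set is one of its faces and belongs
  to \<open>T\<close>; an order isomorphism sends the least label to the least face.\<close>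

lemma phi_empty: "\<phi> {} = {}"
proof -
  have P: "\<phi> {} \<in> T" by (intro phi_in empty_in_torus_strip)
  obtain a where a: "\<And>x. x \<in> \<phi> {} \<Longrightarrow> 0 < a \<bullet> x" using spherical_polytope_pos[OF polytope[OF P]] by blast
  have "sph_face {} (\<phi> {})" unfolding sph_face_def using a by (intro exI[of _ "- a"]) fastforce
  then have "{} \<in> T" by (rule face_closed[OF P])
  then obtain F where "F \<in> torus_strip k" "{} = \<phi> F" by (rule phi_surj)
  then show ?thesis using phi_subset[OF empty_in_torus_strip, of F] by auto
qed

text \<open>The labelling is only known to respect inclusion. The cell is nonempty and has a vertex,
  whose label is nonempty and contained in \<open>{vclass v}\<close>; hence the cell is that point,
  and \<open>the_elem\<close> in \<open>vpt\<close> is meaningful.\<close>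

lemma phi_vertex:
  assumes "0 \<le> coord_sum v" "coord_sum v \<le> int k"
  shows "\<phi> {vclass v} = {vpt \<phi> v}"
proof -
  have s: "{vclass v} \<in> torus_strip k" using assms by (rule torus_strip_singleton)
  have "\<phi> {vclass v} \<noteq> {}" using phi_eq[OF s empty_in_torus_strip] phi_empty by auto
  then obtain p where p: "sph_face {p} (\<phi> {vclass v})"
    using spherical_polytope_vertex_exists[OF polytope[OF phi_in[OF s]]] by (auto simp: sph_vertices_def)
  then have "{p} \<in> T" by (rule face_closed[OF phi_in[OF s]])
  then obtain F where F: "F \<in> torus_strip k" "{p} = \<phi> F" by (rule phi_surj)
  have "{p} \<subseteq> \<phi> {vclass v}" using p unfolding sph_face_def by blast
  then have "F \<subseteq> {vclass v}" using phi_subset F s by auto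
  then have "F = {vclass v}" using F phi_empty by (metis insert_not_empty subset_singletonD)
  then show ?thesis using F by (metis vpt_def the_elem_eq)
qed

lemma vpt_in_iff:
  assumes "F \<in> torus_strip k" "0 \<le> coord_sum v" "coord_sum v \<le> int k"
  shows "vpt \<phi> v \<in> \<phi> F \<longleftrightarrow> vclass v \<in> F"
  using phi_subset[OF torus_strip_singleton[OF assms(2,3)] assms(1)] phi_vertex[OF assms(2,3)] by simp

lemma vpt_eq_iff:
  assumes "0 \<le> coord_sum v" "coord_sum v \<le> int k" "0 \<le> coord_sum w" "coord_sum w \<le> int k"
  shows "vpt \<phi> v = vpt \<phi> w \<longleftrightarrow> vclass v = vclass w"
  using vpt_in_iff[OF torus_strip_singleton[OF assms(3,4)] assms(1,2)] phi_vertex[OF assms(3,4)] by simp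

lemma phi_face:
  assumes "F \<in> torus_strip k" "G \<in> torus_strip k" "F \<subseteq> G"
  shows "sph_face (\<phi> F) (\<phi> G)"
proof -
  have "sph_face (\<phi> F \<inter> \<phi> G) (\<phi> G)"
    using complex phi_in assms unfolding polytopal_complex_def by blast
  then show ?thesis using phi_subset assms by (simp add: Int_absorb2)
qed

lemma vertices_phi:
  assumes "F \<in> torus_strip k"
  shows "sph_vertices (\<phi> F) = {vpt \<phi> v |v. vclass v \<in> F}"
proof (intro set_eqI iffI)
  fix p assume "p \<in> sph_vertices (\<phi> F)"
  then have p: "sph_face {p} (\<phi> F)" by (simp add: sph_vertices_def)
  then have "{p} \<in> T" by (rule face_closed[OF phi_in[OF assms]])
  then obtain G where G: "G \<in> torus_strip k" "{p} = \<phi> G" by (rule phi_surj)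
  have "\<phi> G \<subseteq> \<phi> F" using p G unfolding sph_face_def by blast
  then have "G \<subseteq> F" using phi_subset G assms by blast
  moreover have "G \<noteq> {}" using G phi_empty by auto
  then obtain v where v: "vclass v \<in> G" using torus_strip_vclass[OF G(1)] by blast
  have "vpt \<phi> v \<in> \<phi> G" using v vpt_in_iff[OF G(1)] torus_strip_range[OF G(1) v] by simp
  then show "p \<in> {vpt \<phi> v |v. vclass v \<in> F}" using calculation v G by auto
next
  fix p assume "p \<in> {vpt \<phi> v |v. vclass v \<in> F}"
  then obtain v where v: "p = vpt \<phi> v" "vclass v \<in> F" by blast
  have r: "0 \<le> coord_sum v" "coord_sum v \<le> int k" using torus_strip_range[OF assms v(2)] .
  have "sph_face (\<phi> {vclass v}) (\<phi> F)"
    using v by (intro phi_face torus_strip_singleton assms r) simp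
  then show "p \<in> sph_vertices (\<phi> F)" using phi_vertex[OF r] v by (simp add: sph_vertices_def)
qed

lemma complex_vertices_eq:
  "complex_vertices T = {vpt \<phi> v |v. 0 \<le> coord_sum v \<and> coord_sum v \<le> int k}"
proof (intro set_eqI iffI)
  fix p assume "p \<in> complex_vertices T"
  then obtain F where F: "F \<in> torus_strip k" "p \<in> sph_vertices (\<phi> F)"
    unfolding complex_vertices_def by (metis UN_E phi_surj)
  then show "p \<in> {vpt \<phi> v |v. 0 \<le> coord_sum v \<and> coord_sum v \<le> int k}"
    using vertices_phi[OF F(1)] torus_strip_range[OF F(1)] by auto
next
  fix p assume "p \<in> {vpt \<phi> v |v. 0 \<le> coord_sum v \<and> coord_sum v \<le> int k}"
  then obtain v where v: "p = vpt \<phi> v" "0 \<le> coord_sum v" "coord_sum v \<le> int k" by blast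
  have s: "{vclass v} \<in> torus_strip k" using torus_strip_singleton v by blast
  have "p \<in> sph_vertices (\<phi> {vclass v})" using vertices_phi[OF s] v by auto
  then show "p \<in> complex_vertices T" using phi_in[OF s] unfolding complex_vertices_def by blast
qed

lemma face_functional:
  assumes "F \<in> torus_strip k" "G \<in> torus_strip k" "F \<subseteq> G"
  shows "\<exists>f. \<forall>v. vclass v \<in> G \<longrightarrow> f \<bullet> vpt \<phi> v \<le> 0 \<and> (f \<bullet> vpt \<phi> v = 0 \<longleftrightarrow> vclass v \<in> F)"
proof -
  obtain f where f: "\<forall>x\<in>\<phi> G. f \<bullet> x \<le> 0" "\<phi> F = {x \<in> \<phi> G. f \<bullet> x = 0}"
    using phi_face[OF assms] unfolding sph_face_def by blast
  have "f \<bullet> vpt \<phi> v \<le> 0 \<and> (f \<bullet> vpt \<phi> v = 0 \<longleftrightarrow> vclass v \<in> F)" if "vclass v \<in> G" for v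
  proof -
    have r: "0 \<le> coord_sum v" "coord_sum v \<le> int k" using torus_strip_range[OF assms(2) that] .
    show ?thesis using vpt_in_iff[OF assms(1) r] vpt_in_iff[OF assms(2) r] f that by auto
  qed
  then show ?thesis by blast
qed

text \<open>Converse of \<open>face_functional\<close>: what a supporting functional cuts out of a
  cell is labelled by a face of the strip. This rules out the diagonal of a square.\<close>

lemma exposed_subset:
  assumes G: "G \<in> torus_strip k" and f: "\<And>v. vclass v \<in> G \<Longrightarrow> f \<bullet> vpt \<phi> v \<le> 0"
  shows "{vclass v |v. vclass v \<in> G \<and> f \<bullet> vpt \<phi> v = 0} \<in> torus_strip k"
proof -
  have "f \<bullet> v \<le> 0" if "v \<in> sph_vertices (\<phi> G)" for v using that vertices_phi[OF G] f by auto
  then have "\<forall>x\<in>\<phi> G. f \<bullet> x \<le> 0"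
    using spherical_polytope_le[OF polytope[OF phi_in[OF G]]] by blast
  then have "sph_face {x \<in> \<phi> G. f \<bullet> x = 0} (\<phi> G)" unfolding sph_face_def by blast
  then have "{x \<in> \<phi> G. f \<bullet> x = 0} \<in> T" by (rule face_closed[OF phi_in[OF G]])
  then obtain F where F: "F \<in> torus_strip k" "{x \<in> \<phi> G. f \<bullet> x = 0} = \<phi> F" by (rule phi_surj)
  have FG: "F \<subseteq> G" using F G phi_subset by blast
  have "vclass v \<in> F \<longleftrightarrow> f \<bullet> vpt \<phi> v = 0" if "vclass v \<in> G" for v
  proof -
    have r: "0 \<le> coord_sum v" "coord_sum v \<le> int k" using torus_strip_range[OF G that] .
    show ?thesis using vpt_in_iff[OF F(1) r] vpt_in_iff[OF G r] F(2) that by blast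
  qed
  then have "F = {vclass v |v. vclass v \<in> G \<and> f \<bullet> vpt \<phi> v = 0}"
    using FG torus_strip_vclass[OF F(1)] by blast
  then show ?thesis using F(1) by simp
qed

text \<open>\<open>quadrilateral_relation\<close> applies with the two edges at \<open>u\<close> and
  the opposite vertex as exposed faces. The diagonal is not exposed because no face of the strip
  consists of two vertices whose coordinate sums differ by 2.\<close>

lemma square_relation:
  assumes ij: "i \<noteq> j" and u: "0 \<le> coord_sum u" "coord_sum u + 2 \<le> int k"
  obtains x y s t where "0 < x" "0 < y" "0 < s" "0 < t"
    "x *\<^sub>R vpt \<phi> u + y *\<^sub>R vpt \<phi> (u + axis i 1 + axis j 1)
       = s *\<^sub>R vpt \<phi> (u + axis i 1) + t *\<^sub>R vpt \<phi> (u + axis j 1)"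
proof -
  define a b w where "a = u + axis i 1" and "b = u + axis j 1" and "w = u + axis i 1 + axis j 1"
  have sums: "coord_sum a = coord_sum u + 1" "coord_sum b = coord_sum u + 1"
    "coord_sum w = coord_sum u + 2" by (simp_all add: a_def b_def w_def coord_sum_add)
  have rng: "0 \<le> coord_sum v" "coord_sum v \<le> int k" if "v \<in> {u, a, b, w}" for v
    using that sums u by auto
  define G where "G = {vclass u, vclass a, vclass b, vclass w}"
  have G: "G \<in> torus_strip k"
  proof -
    have "cube_face u {i, j} = {u, a, b, w}"
      using ij by (auto simp: cube_face_insert a_def b_def w_def algebra_simps)
    then show ?thesis using in_torus_strip[of u "{i, j}" k] ij u by (simp add: G_def)
  qed
  have Ga: "{vclass u, vclass a} \<in> torus_strip k" and Gb: "{vclass u, vclass b} \<in> torus_strip k"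
  proof -
    have "cube_face u {i} = {u, a}" "cube_face u {j} = {u, b}" by (auto simp: cube_face_insert a_def b_def)
    then show "{vclass u, vclass a} \<in> torus_strip k" "{vclass u, vclass b} \<in> torus_strip k"
      using in_torus_strip[of u "{i}" k] in_torus_strip[of u "{j}" k] u by simp_all
  qed
  have Gw: "{vclass w} \<in> torus_strip k" using rng[of w] by (intro torus_strip_singleton) auto
  have ab: "vclass a \<noteq> vclass b" unfolding a_def b_def by (rule vclass_axis_neq[OF ij])
  have ne: "vclass x \<noteq> vclass y" if "coord_sum x \<noteq> coord_sum y" for x y
    using that vclass_sum by blast
  have d: "distinct [vclass u, vclass a, vclass b, vclass w]"
    using ab ne[of u a] ne[of u b] ne[of u w] ne[of a w] ne[of b w] sums by simp
  have sub: "{vclass u, vclass a} \<subseteq> G" "{vclass u, vclass b} \<subseteq> G" "{vclass w} \<subseteq> G"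
    by (auto simp: G_def)
  obtain f h n where
    f: "\<forall>v. vclass v \<in> G \<longrightarrow> f \<bullet> vpt \<phi> v \<le> 0 \<and> (f \<bullet> vpt \<phi> v = 0 \<longleftrightarrow> vclass v \<in> {vclass u, vclass a})" and
    h: "\<forall>v. vclass v \<in> G \<longrightarrow> h \<bullet> vpt \<phi> v \<le> 0 \<and> (h \<bullet> vpt \<phi> v = 0 \<longleftrightarrow> vclass v \<in> {vclass u, vclass b})" and
    n: "\<forall>v. vclass v \<in> G \<longrightarrow> n \<bullet> vpt \<phi> v \<le> 0 \<and> (n \<bullet> vpt \<phi> v = 0 \<longleftrightarrow> vclass v \<in> {vclass w})"
    using face_functional[OF Ga G sub(1)] face_functional[OF Gb G sub(2)] face_functional[OF Gw G sub(3)]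
    by metis
  have inG: "vclass u \<in> G" "vclass a \<in> G" "vclass b \<in> G" "vclass w \<in> G" by (auto simp: G_def)
  have diag: False if g: "g \<bullet> vpt \<phi> u = 0" "g \<bullet> vpt \<phi> w = 0" "g \<bullet> vpt \<phi> a < 0" "g \<bullet> vpt \<phi> b < 0" for g
  proof -
    have gv: "g \<bullet> vpt \<phi> v \<le> 0 \<and> (g \<bullet> vpt \<phi> v = 0 \<longleftrightarrow> vclass v \<in> {vclass u, vclass w})"
      if v: "vclass v \<in> G" for v
    proof -
      have r: "0 \<le> coord_sum v" "coord_sum v \<le> int k" using torus_strip_range[OF G v] .
      obtain v' where v': "v' \<in> {u, a, b, w}" "vclass v = vclass v'" using v by (auto simp: G_def)
      then have "vpt \<phi> v = vpt \<phi> v'" using vpt_eq_iff[OF r rng[OF v'(1)]] by simp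
      moreover have "g \<bullet> vpt \<phi> v' \<le> 0 \<and> (g \<bullet> vpt \<phi> v' = 0 \<longleftrightarrow> vclass v' \<in> {vclass u, vclass w})"
        using v'(1)
      proof (elim insertE emptyE)
        assume "v' = a"
        then show ?thesis using g(3) d by simp metis
      next
        assume "v' = b"
        then show ?thesis using g(4) d by simp metis
      qed (use g in simp_all)
      ultimately show ?thesis using v'(2) by simp
    qed
    then have "{vclass v |v. vclass v \<in> G \<and> g \<bullet> vpt \<phi> v = 0} \<in> torus_strip k"
      by (intro exposed_subset G) simp
    moreover have "{vclass v |v. vclass v \<in> G \<and> g \<bullet> vpt \<phi> v = 0} = {vclass u, vclass w}"
      using gv inG by blast
    ultimately have "{vclass u, vclass w} \<in> torus_strip k" by simp
    then show False
    proof (cases rule: torus_strip_cases)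
      case (2 q J)
      have s: "coord_sum v \<in> {coord_sum u, coord_sum u + 2}" if "v \<in> cube_face q J" for v
      proof -
        have "vclass v \<in> {vclass u, vclass w}" using 2(1) that by blast
        then have "coord_sum v = coord_sum u \<or> coord_sum v = coord_sum w" using vclass_sum by blast
        then show ?thesis using sums(3) by simp
      qed
      show False
      proof (cases "J = {}")
        case True
        then show False using 2(1) d by auto
      next
        case False
        \<comment> \<open>A direction of the face would produce two vertices with consecutive
          coordinate sums.\<close>
        then obtain m where "m \<in> J" by blast
        then have "q + axis m 1 \<in> cube_face q J" by (auto simp: cube_face_def axis_def)
        then show False using s[of "q + axis m 1"] s[of q] cube_face_self[of q J] by (auto simp: coord_sum_add)
      qed
    qed simp
  qed
  obtain c where "\<And>x. x \<in> \<phi> G \<Longrightarrow> 0 < c \<bullet> x" using spherical_polytope_pos[OF polytope[OF phi_in[OF G]]] by blast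
  then have u0: "vpt \<phi> u \<noteq> 0" using vpt_in_iff[OF G, of u] rng[of u] inG by fastforce
  have dv: "distinct [vpt \<phi> u, vpt \<phi> a, vpt \<phi> b, vpt \<phi> w]" using d vpt_eq_iff rng by simp
  obtain x y s t where "0 < x" "0 < y" "0 < s" "0 < t"
    "x *\<^sub>R vpt \<phi> u + y *\<^sub>R vpt \<phi> w = s *\<^sub>R vpt \<phi> a + t *\<^sub>R vpt \<phi> b"
  proof (rule quadrilateral_relation[OF dv u0, of f h n])
    have nq: "vclass b \<notin> {vclass u, vclass a}" "vclass w \<notin> {vclass u, vclass a}"
      "vclass a \<notin> {vclass u, vclass b}" "vclass w \<notin> {vclass u, vclass b}"
      "vclass u \<notin> {vclass w}" "vclass a \<notin> {vclass w}" "vclass b \<notin> {vclass w}"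
      using d by (simp_all; metis)+
    show "f \<bullet> vpt \<phi> u = 0" "f \<bullet> vpt \<phi> a = 0" using f inG(1,2) by blast+
    show "h \<bullet> vpt \<phi> u = 0" "h \<bullet> vpt \<phi> b = 0" using h inG(1,3) by blast+
    show "n \<bullet> vpt \<phi> w = 0" using n inG(4) by blast
    show "f \<bullet> vpt \<phi> b < 0" "f \<bullet> vpt \<phi> w < 0" using f inG(3,4) nq(1,2) order_less_le by metis+
    show "h \<bullet> vpt \<phi> a < 0" "h \<bullet> vpt \<phi> w < 0" using h inG(2,4) nq(3,4) order_less_le by metis+
    show "n \<bullet> vpt \<phi> u < 0" "n \<bullet> vpt \<phi> a < 0" "n \<bullet> vpt \<phi> b < 0"
      using n inG(1-3) nq(5-7) order_less_le by metis+
  qed (use diag in blast)+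
  then show ?thesis using that unfolding a_def b_def w_def by blast
qed

lemma facet_is_cube:
  assumes "\<sigma> \<in> complex_facets T" "3 \<le> k"
  obtains u where "0 \<le> coord_sum u" "coord_sum u + 3 \<le> int k" "\<sigma> = \<phi> (vclass ` cube_face u UNIV)"
    "vclass ` cube_face u UNIV \<in> torus_strip k"
proof -
  obtain F where F: "F \<in> torus_strip k" "\<sigma> = \<phi> F"
    using assms(1) phi_surj[of \<sigma>] unfolding complex_facets_def by blast
  obtain u where u: "0 \<le> coord_sum u" "coord_sum u + 3 \<le> int k" "F \<subseteq> vclass ` cube_face u UNIV"
    using torus_strip_subset_cube[OF F(1) assms(2)] .
  have G: "vclass ` cube_face u UNIV \<in> torus_strip k" using u by (intro in_torus_strip) auto
  have "\<sigma> \<subseteq> \<phi> (vclass ` cube_face u UNIV)" using phi_subset[OF F(1) G] u(3) F(2) by simp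
  then have "\<sigma> = \<phi> (vclass ` cube_face u UNIV)"
    using assms(1) phi_in[OF G] unfolding complex_facets_def by blast
  then show ?thesis using that u G by blast
qed

text \<open>\<open>unique\<close> serves purity: it makes the orthogonal complement of the span of a
  facet a line, so that every facet has linear dimension 4.\<close>

lemma convex_position_criterion:
  assumes k: "3 \<le> k"
    and n0: "\<And>u. 0 \<le> coord_sum u \<Longrightarrow> coord_sum u + 3 \<le> int k \<Longrightarrow> n u \<noteq> 0"
    and le: "\<And>u v. 0 \<le> coord_sum u \<Longrightarrow> coord_sum u + 3 \<le> int k \<Longrightarrow>
      0 \<le> coord_sum v \<Longrightarrow> coord_sum v \<le> int k \<Longrightarrow> n u \<bullet> vpt \<phi> v \<le> 0"
    and zero: "\<And>u v. 0 \<le> coord_sum u \<Longrightarrow> coord_sum u + 3 \<le> int k \<Longrightarrow>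
      0 \<le> coord_sum v \<Longrightarrow> coord_sum v \<le> int k \<Longrightarrow>
      n u \<bullet> vpt \<phi> v = 0 \<longleftrightarrow> vclass v \<in> vclass ` cube_face u UNIV"
    and unique: "\<And>u g. 0 \<le> coord_sum u \<Longrightarrow> coord_sum u + 3 \<le> int k \<Longrightarrow>
      (\<And>v. v \<in> cube_face u UNIV \<Longrightarrow> g \<bullet> vpt \<phi> v = 0) \<Longrightarrow> \<exists>c. g = c *\<^sub>R n u"
  shows "in_convex_position T"
  unfolding in_convex_position_def
proof (intro conjI ballI)
  show "polytopal_complex T" by (rule complex)
  have dim4: "dim \<sigma> = 4" if facet: "\<sigma> \<in> complex_facets T" for \<sigma>
  proof -
    obtain u where u: "0 \<le> coord_sum u" "coord_sum u + 3 \<le> int k" "\<sigma> = \<phi> (vclass ` cube_face u UNIV)"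
      "vclass ` cube_face u UNIV \<in> torus_strip k"
      using facet_is_cube[OF facet k] .
    note G = u(4)
    have \<sigma>T: "\<sigma> \<in> T" using phi_in[OF G] u by simp
    have "{y \<in> UNIV. \<forall>x\<in>span \<sigma>. orthogonal x y} = span {n u}"
    proof (intro set_eqI iffI)
      fix g assume "g \<in> {y \<in> UNIV. \<forall>x\<in>span \<sigma>. orthogonal x y}"
      then have g: "g \<bullet> x = 0" if "x \<in> \<sigma>" for x
        using that span_base[of x \<sigma>] by (auto simp: orthogonal_def inner_commute)
      have "g \<bullet> vpt \<phi> v = 0" if "v \<in> cube_face u UNIV" for v
      proof (rule g)
        have v: "vclass v \<in> vclass ` cube_face u UNIV" using that by blast
        show "vpt \<phi> v \<in> \<sigma>" using vpt_in_iff[OF G torus_strip_range[OF G v]] v u(3) by simp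
      qed
      then have "\<exists>c. g = c *\<^sub>R n u" by (rule unique[OF u(1,2)])
      then show "g \<in> span {n u}" by (auto simp: span_singleton)
    next
      fix g assume "g \<in> span {n u}"
      then obtain c where c: "g = c *\<^sub>R n u" by (auto simp: span_singleton)
      have v0: "n u \<bullet> v = 0" if v: "v \<in> sph_vertices \<sigma>" for v
      proof -
        obtain w where w: "v = vpt \<phi> w" "vclass w \<in> vclass ` cube_face u UNIV"
          using v vertices_phi[OF G] u(3) by auto
        then show ?thesis using zero[OF u(1,2) torus_strip_range[OF G w(2)]] by simp
      qed
      have "n u \<bullet> x = 0" if "x \<in> \<sigma>" for x
        using spherical_polytope_le[OF polytope[OF \<sigma>T], of "n u" x]
          spherical_polytope_le[OF polytope[OF \<sigma>T], of "- n u" x] v0 that by force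
      then have "\<sigma> \<subseteq> {x. n u \<bullet> x = 0}" by blast
      then have "span \<sigma> \<subseteq> {x. n u \<bullet> x = 0}" by (intro span_minimal subspace_hyperplane)
      then show "g \<in> {y \<in> UNIV. \<forall>x\<in>span \<sigma>. orthogonal x y}"
        by (auto simp: c orthogonal_def inner_commute)
    qed
    then have "dim (span {n u}) + dim (span \<sigma>) = dim (UNIV :: (real^5) set)"
      using dim_subspace_orthogonal_to_vectors[of "span \<sigma>" UNIV] by simp
    moreover have "dim (span {n u}) = 1" using n0[OF u(1,2)] by (simp add: dim_insert)
    ultimately show ?thesis by simp
  qed
  then show "pure_complex T" unfolding pure_complex_def by simp
  fix \<sigma> assume "\<sigma> \<in> complex_facets T"
  then obtain u where u: "0 \<le> coord_sum u" "coord_sum u + 3 \<le> int k" "\<sigma> = \<phi> (vclass ` cube_face u UNIV)"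
    "vclass ` cube_face u UNIV \<in> torus_strip k"
    by (rule facet_is_cube[OF _ k]) blast
  have "n u \<bullet> x \<le> 0" if "x \<in> \<Union>T" for x
  proof -
    obtain P where P: "P \<in> T" "x \<in> P" using \<open>x \<in> \<Union>T\<close> by blast
    have "n u \<bullet> v \<le> 0" if "v \<in> sph_vertices P" for v
    proof -
      have "v \<in> complex_vertices T" using that P unfolding complex_vertices_def by blast
      then show ?thesis using complex_vertices_eq le[OF u(1,2)] by auto
    qed
    then show ?thesis using spherical_polytope_le[OF polytope[OF P(1)]] P(2) by blast
  qed
  moreover have "n u \<bullet> v = 0" if v: "v \<in> sph_vertices \<sigma>" for v
  proof -
    obtain w where w: "v = vpt \<phi> w" "vclass w \<in> vclass ` cube_face u UNIV"
      using v vertices_phi[OF u(4)] u(3) by auto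
    then show ?thesis using zero[OF u(1,2) torus_strip_range[OF u(4) w(2)]] by simp
  qed
  moreover have "n u \<bullet> v \<noteq> 0" if v: "v \<in> complex_vertices T - sph_vertices \<sigma>" for v
  proof -
    obtain w where w: "v = vpt \<phi> w" "0 \<le> coord_sum w" "coord_sum w \<le> int k"
      using v complex_vertices_eq by auto
    then have "vclass w \<notin> vclass ` cube_face u UNIV" using v vertices_phi[OF u(4)] u(3) by auto
    then show ?thesis using zero[OF u(1,2) w(2,3)] w(1) by simp
  qed
  ultimately show "\<exists>a. a \<noteq> 0 \<and> (\<forall>x\<in>\<Union>T. a \<bullet> x \<le> 0) \<and> (\<forall>v\<in>sph_vertices \<sigma>. a \<bullet> v = 0) \<and>
      (\<forall>v\<in>complex_vertices T - sph_vertices \<sigma>. a \<bullet> v \<noteq> 0)"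
    using n0[OF u(1,2)] by blast
qed

end

section \<open>Complex coordinates\<close>

lemma exhaust_5:
  fixes x :: 5
  shows "x = 1 \<or> x = 2 \<or> x = 3 \<or> x = 4 \<or> x = 5"
proof (induct x)
  case (of_int z)
  then have "0 \<le> z" and "z < 5" by simp_all
  then have "z = 0 \<or> z = 1 \<or> z = 2 \<or> z = 3 \<or> z = 4" by arith
  then show ?case by auto
qed

lemma forall_5: "(\<forall>i::5. P i) \<longleftrightarrow> P 1 \<and> P 2 \<and> P 3 \<and> P 4 \<and> P 5"
  by (metis exhaust_5)

lemma UNIV_5: "UNIV = {1, 2, 3, 4, 5::5}"
  using exhaust_5 by auto

lemma sum_5: "sum f (UNIV::5 set) = f 1 + f 2 + f 3 + f 4 + f 5"
  unfolding UNIV_5 by (simp add: ac_simps)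

definition zc :: "real^5 \<Rightarrow> complex" where "zc x = Complex (x$1) (x$2)"

definition yc :: "real^5 \<Rightarrow> complex" where "yc x = Complex (x$3) (x$4)"

definition cvec :: "complex \<Rightarrow> complex \<Rightarrow> real \<Rightarrow> real^5" where
  "cvec z y d = (\<chi> i. if i = 1 then Re z else if i = 2 then Im z
     else if i = 3 then Re y else if i = 4 then Im y else d)"

lemma cvec_simps [simp]: "zc (cvec z y d) = z" "yc (cvec z y d) = y" "cvec z y d $ 5 = d"
  by (simp_all add: cvec_def zc_def yc_def)

lemma coords_eq_iff: "x = x' \<longleftrightarrow> zc x = zc x' \<and> yc x = yc x' \<and> x$5 = x'$5"
  by (auto simp: vec_eq_iff forall_5 zc_def yc_def)

lemma coords_linear [simp]:
  "zc (x + x') = zc x + zc x'" "yc (x + x') = yc x + yc x'"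
  "zc (r *\<^sub>R x) = of_real r * zc x" "yc (r *\<^sub>R x) = of_real r * yc x"
  by (simp_all add: zc_def yc_def complex_eq_iff)

lemma inner_cvec: "g \<bullet> cvec z y d = Re (cnj (zc g) * z) + Re (cnj (yc g) * y) + g$5 * d"
  by (simp add: inner_vec_def sum_5 cvec_def zc_def yc_def)

lemma r12_coords: "zc (r12 x) = \<i> * zc x" "yc (r12 x) = yc x" "r12 x $ 5 = x $ 5"
  by (simp_all add: r12_def plane_rot_def zc_def yc_def complex_eq_iff)

lemma r34_coords: "zc (r34 x) = zc x" "yc (r34 x) = cis (pi/3) * yc x" "r34 x $ 5 = x $ 5"
  by (simp_all add: r34_def plane_rot_def zc_def yc_def complex_eq_iff)

lemma refl4_coords: "zc (refl4 x) = zc x" "yc (refl4 x) = cnj (yc x)" "refl4 x $ 5 = x $ 5"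
  by (simp_all add: refl4_def zc_def yc_def complex_eq_iff)

lemma swap12_vclass: "swap12 ` vclass v = vclass (swap12 v)"
proof -
  have inv: "swap12 (swap12 w) = w" for w by (simp add: swap12_def vec_eq_iff forall_3)
  have neg: "x mod 6 = y mod 6 \<longleftrightarrow> (- x) mod 6 = (- y) mod 6" for x y :: int
    by (metis mod_minus_cong minus_minus)
  have key: "vkey (swap12 w) = vkey v \<longleftrightarrow> vkey w = vkey (swap12 v)" for w
    using neg[of "w$2 - w$1" "v$1 - v$2"] by (simp add: vkey_def swap12_def coord_sum_def add.commute)
  have "w \<in> swap12 ` vclass v \<longleftrightarrow> swap12 w \<in> vclass v" for w using inv by (metis image_eqI imageE)
  then show ?thesis using key unfolding vclass_eq by blast
qed

lemma translate_vclass: "(\<lambda>v. v + t) ` vclass v = vclass (v + t)"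
  unfolding vclass_def by (simp add: image_image algebra_simps)

lemma (in cct) induces_vpt:
  assumes "induces k T \<phi> f g" "g ` vclass v = vclass (g v)"
    and v: "0 \<le> coord_sum v" "coord_sum v \<le> int k" "coord_sum (g v) = coord_sum v"
  shows "vpt \<phi> (g v) = f (vpt \<phi> v)"
proof -
  have "f ` \<phi> {vclass v} = \<phi> {vclass (g v)}"
    using assms(1,2) torus_strip_singleton[OF v(1,2)] unfolding induces_def by force
  then show ?thesis using phi_vertex v by simp
qed

text \<open>The reflection conjugates the screw motion into the one along \<open>(-1,0,1)\<close>.\<close>

lemma (in cct) screw_motions:
  assumes sw: "induces k T \<phi> refl4 swap12"
    and tr: "induces k T \<phi> (r34 \<circ> r12) (\<lambda>v. v + vector [0, -1, 1])"
    and v: "0 \<le> coord_sum v" "coord_sum v \<le> int k"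
  shows "vpt \<phi> (v + vector [0, -1, 1]) = r34 (r12 (vpt \<phi> v))"
    and "vpt \<phi> (v + vector [-1, 0, 1]) = refl4 (r34 (r12 (refl4 (vpt \<phi> v))))"
    and "vpt \<phi> (swap12 v) = refl4 (vpt \<phi> v)"
proof -
  have s: "coord_sum (swap12 w) = coord_sum w" "coord_sum (w + vector [0, -1, 1]) = coord_sum w" for w
    by (simp_all add: coord_sum_def swap12_def)
  have a: "vpt \<phi> (w + vector [0, -1, 1]) = r34 (r12 (vpt \<phi> w))" if "coord_sum w = coord_sum v" for w
    using induces_vpt[OF tr translate_vclass, of w] v s that by simp
  have b: "vpt \<phi> (swap12 w) = refl4 (vpt \<phi> w)" if "coord_sum w = coord_sum v" for w
    using induces_vpt[OF sw swap12_vclass, of w] v s that by simp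
  have "v + vector [-1, 0, 1] = swap12 (swap12 v + vector [0, -1, 1])"
    by (simp add: swap12_def vec_eq_iff forall_3)
  then show "vpt \<phi> (v + vector [-1, 0, 1]) = refl4 (r34 (r12 (refl4 (vpt \<phi> v))))"
    using a b s by simp
qed (use induces_vpt[OF tr translate_vclass, of v] induces_vpt[OF sw swap12_vclass, of v] v in
    \<open>simp_all add: coord_sum_def swap12_def\<close>)

lemma invariant_multiples:
  fixes f :: "int^3 \<Rightarrow> 'a"
  assumes b: "\<And>v. coord_sum v = l \<Longrightarrow> f (v + t) = f v" and t: "coord_sum t = 0" and w: "coord_sum w = l"
  shows "f (w + x *s t) = f w"
proof -
  have s: "coord_sum (w + x *s t) = l" for x
  proof -
    have "coord_sum (w + x *s t) = coord_sum w + x * coord_sum t" by (simp add: coord_sum_def algebra_simps)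
    then show ?thesis using t w by simp
  qed
  have step: "f (w + (i + 1) *s t) = f (w + i *s t)" for i
  proof -
    have "w + (i + 1) *s t = w + i *s t + t" by (simp add: vec_eq_iff algebra_simps)
    then show ?thesis using b[OF s[of i]] by metis
  qed
  show ?thesis
  proof (induction x rule: int_induct[of _ 0])
    case (step1 i)
    then show ?case using step[of i] by simp
  next
    case (step2 i)
    then show ?case using step[of "i - 1"] by simp
  qed simp
qed

text \<open>\<open>(0,-1,1)\<close> and \<open>(-1,0,1)\<close> generate all vectors of coordinate
  sum 0, so a layer is a single orbit with representative \<open>(0,0,l)\<close>.\<close>

lemma invariant_on_layer:
  fixes f :: "int^3 \<Rightarrow> 'a"
  assumes b: "\<And>v. coord_sum v = l \<Longrightarrow> f (v + vector [0, -1, 1]) = f v"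
    and c: "\<And>v. coord_sum v = l \<Longrightarrow> f (v + vector [-1, 0, 1]) = f v"
    and v: "coord_sum v = l"
  shows "f v = f (vector [0, 0, l])"
proof -
  define p w where "p = (vector [0, 0, l] :: int^3)" and "w = p + (- v$1) *s vector [-1, 0, 1]"
  have p: "coord_sum p = l" and w: "coord_sum w = l" by (simp_all add: p_def w_def coord_sum_def)
  have "v = w + (- v$2) *s vector [0, -1, 1]"
    using v by (auto simp: p_def w_def vec_eq_iff forall_3 coord_sum_def)
  moreover have "f (w + (- v$2) *s vector [0, -1, 1]) = f w"
    by (rule invariant_multiples[where l = l and f = f, OF b _ w]) (simp_all add: coord_sum_def)
  moreover have "f w = f p"
    unfolding w_def by (rule invariant_multiples[where l = l and f = f, OF c _ p]) (simp_all add: coord_sum_def)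
  ultimately show ?thesis by (simp add: p_def)
qed

text \<open>The two phases are the rotations accumulated by the screw motions on the way to
  \<open>v\<close>: along \<open>(0,-1,1)\<close> both \<open>v$3\<close> and
  \<open>v$1 - v$2\<close> grow by one, matching a quarter turn and a sixth of a turn.\<close>

definition zphase :: "int^3 \<Rightarrow> complex" where "zphase v = cis (pi/2 * real_of_int (v$3))"

definition yphase :: "int^3 \<Rightarrow> complex" where "yphase v = cis (pi/3 * real_of_int (v$1 - v$2))"

lemma phase_nonzero [simp]: "zphase v \<noteq> 0" "yphase v \<noteq> 0"
  by (simp_all add: zphase_def yphase_def)

lemma phase_axis:
  "zphase (u + axis 3 1) = \<i> * zphase u" "zphase (u + axis 1 1) = zphase u" "zphase (u + axis 2 1) = zphase u"
  "yphase (u + axis 3 1) = yphase u" "yphase (u + axis 1 1) = cis (pi/3) * yphase u"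
  "yphase (u + axis 2 1) = cnj (cis (pi/3)) * yphase u"
  by (simp_all add: zphase_def yphase_def axis_def cis_mult cis_cnj algebra_simps flip: cis_pi_half)

text \<open>Dividing by the phases leaves data invariant under both screw motions, hence constant on
  layers. The second part is real because \<open>swap12\<close> fixes the representative
  \<open>(0,0,l)\<close>.\<close>

lemma (in cct) layer_coords:
  assumes sw: "induces k T \<phi> refl4 swap12"
    and tr: "induces k T \<phi> (r34 \<circ> r12) (\<lambda>v. v + vector [0, -1, 1])"
  obtains \<zeta> c \<delta> where
    "\<And>v. 0 \<le> coord_sum v \<Longrightarrow> coord_sum v \<le> int k \<Longrightarrow> vpt \<phi> v =
      cvec (zphase v * \<zeta> (nat (coord_sum v))) (yphase v * of_real (c (nat (coord_sum v)))) (\<delta> (nat (coord_sum v)))"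
proof -
  define F where "F v = (zc (vpt \<phi> v) / zphase v, yc (vpt \<phi> v) / yphase v, vpt \<phi> v $ 5)" for v
  define org where "org l = (vector [0, 0, int l] :: int^3)" for l
  have os: "coord_sum (org l) = int l" for l by (simp add: org_def coord_sum_def)
  have Fo: "F v = F (org (nat (coord_sum v)))" if v: "0 \<le> coord_sum v" "coord_sum v \<le> int k" for v
  proof -
    have "F v = F (vector [0, 0, coord_sum v])"
    proof (rule invariant_on_layer[of "coord_sum v"])
      fix w assume w: "coord_sum w = coord_sum v"
      have z: "zphase (w + vector [0, -1, 1]) = \<i> * zphase w" "zphase (w + vector [-1, 0, 1]) = \<i> * zphase w"
        by (simp_all add: zphase_def cis_mult algebra_simps flip: cis_pi_half)
      have y: "yphase (w + vector [0, -1, 1]) = cis (pi/3) * yphase w"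
        "yphase (w + vector [-1, 0, 1]) = cnj (cis (pi/3)) * yphase w"
        by (simp_all add: yphase_def cis_mult cis_cnj algebra_simps)
      note m = screw_motions[OF sw tr, of w]
      show "F (w + vector [0, -1, 1]) = F w"
        using m(1) w v by (simp add: F_def z y r34_coords r12_coords)
      show "F (w + vector [-1, 0, 1]) = F w"
        using m(2) w v by (simp add: F_def z y r34_coords r12_coords refl4_coords)
    qed simp
    then show ?thesis using v by (simp add: org_def)
  qed
  have real: "yc (vpt \<phi> (org l)) = of_real (Re (yc (vpt \<phi> (org l))))" if "l \<le> k" for l
  proof -
    have "swap12 (org l) = org l" by (simp add: org_def swap12_def vec_eq_iff forall_3)
    then have "refl4 (vpt \<phi> (org l)) = vpt \<phi> (org l)" using screw_motions(3)[OF sw tr, of "org l"] os that by simp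
    then have "cnj (yc (vpt \<phi> (org l))) = yc (vpt \<phi> (org l))" using refl4_coords(2) by metis
    then show ?thesis by (simp add: complex_eq_iff)
  qed
  have yo: "yphase (org l) = 1" for l by (simp add: yphase_def org_def)
  show ?thesis
  proof (rule that)
    fix v assume v: "0 \<le> coord_sum v" "coord_sum v \<le> int k"
    define l where "l = nat (coord_sum v)"
    have l: "l \<le> k" using v by (simp add: l_def)
    have "F v = F (org l)" using Fo[OF v] by (simp add: l_def)
    then have "zc (vpt \<phi> v) = zphase v * (zc (vpt \<phi> (org l)) / zphase (org l))"
      "yc (vpt \<phi> v) = yphase v * yc (vpt \<phi> (org l))" "vpt \<phi> v $ 5 = vpt \<phi> (org l) $ 5"
      by (auto simp: F_def yo field_simps)
    then have "vpt \<phi> v = cvec (zphase v * (zc (vpt \<phi> (org l)) / zphase (org l)))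
        (yphase v * of_real (Re (yc (vpt \<phi> (org l))))) (vpt \<phi> (org l) $ 5)"
      using real[OF l] by (simp add: coords_eq_iff)
    then show "vpt \<phi> v = cvec (zphase v * (\<lambda>l. zc (vpt \<phi> (org l)) / zphase (org l)) (nat (coord_sum v)))
        (yphase v * of_real ((\<lambda>l. Re (yc (vpt \<phi> (org l)))) (nat (coord_sum v)))) ((\<lambda>l. vpt \<phi> (org l) $ 5) (nat (coord_sum v)))"
      by (simp add: l_def)
  qed
qed

lemma transversal_nonzero:
  assumes k: "2 \<le> k" and T: "cct k T \<phi>"
    and tv: "transversal_cct k ((\<lambda>P. eq_proj ` P) ` T) (\<lambda>F. eq_proj ` \<phi> F)"
    and v: "0 \<le> coord_sum v" "coord_sum v \<le> int k"
  shows "zc (vpt \<phi> v) \<noteq> 0" "yc (vpt \<phi> v) \<noteq> 0"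
proof -
  interpret cct k T \<phi> by (rule T)
  \<comment> \<open>Transversality is stated for windows of three layers; the extreme layers 0 and
    \<open>k\<close> belong to the windows around 1 and \<open>k - 1\<close>.\<close>
  define i where "i = (if coord_sum v = 0 then 1 else if coord_sum v = int k then int k - 1 else coord_sum v)"
  have i: "i \<in> {1..int k - 1}" "coord_sum v \<in> {i - 1, i, i + 1}" using v k by (auto simp: i_def)
  define q where "q = eq_proj (vpt \<phi> v)"
  have pv: "\<phi> {vclass v} = {vpt \<phi> v}" by (rule phi_vertex[OF v])
  have "{q} \<in> (\<lambda>P. eq_proj ` P) ` T"
    using phi_in[OF torus_strip_singleton[OF v]] pv by (auto simp: q_def image_iff intro!: bexI[of _ "{vpt \<phi> v}"])
  moreover have "q \<in> layer (\<lambda>F. eq_proj ` \<phi> F) (coord_sum v)"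
    unfolding layer_def using pv by (auto simp: q_def)
  moreover have "sph_vertices {q} \<subseteq> {q}" unfolding sph_vertices_def sph_face_def by auto
  ultimately have "{q} \<in> layer_restr ((\<lambda>P. eq_proj ` P) ` T) (\<lambda>F. eq_proj ` \<phi> F) {i - 1, i, i + 1}"
    using i(2) unfolding layer_restr_def by blast
  then have "part12 q \<noteq> 0 \<and> part34 q \<noteq> 0"
    using tv i(1) unfolding transversal_cct_def transversal2_def by blast
  moreover have "part12 q = 0" if "zc (vpt \<phi> v) = 0"
    using that by (simp add: q_def eq_proj_def sgn_div_norm part12_def vec_eq_iff zc_def complex_eq_iff)
  moreover have "part34 q = 0" if "yc (vpt \<phi> v) = 0"
    using that by (simp add: q_def eq_proj_def sgn_div_norm part34_def vec_eq_iff yc_def complex_eq_iff)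
  ultimately show "zc (vpt \<phi> v) \<noteq> 0" "yc (vpt \<phi> v) \<noteq> 0" by auto
qed

section \<open>The spiral of a symmetric CCT\<close>

lemma cis_pi_third_independent:
  assumes "of_real a + of_real b * cis (pi/3) = 0"
  shows "a = 0" "b = 0"
  using assms by (auto simp: complex_eq_iff cos_60 sin_60)

lemma cnj_cis_pi_third: "cnj (cis (pi/3)) = 1 - cis (pi/3)"
  by (simp add: complex_eq_iff cos_60 sin_60)

lemma cis_pi_third_cnj [simp]: "cis (pi/3) * cnj (cis (pi/3)) = 1" "cnj (cis (pi/3)) * cis (pi/3) = 1"
  by (simp_all add: cis_cnj cis_mult)

lemma sign_cancel:
  fixes a b \<sigma> \<tau> :: real
  assumes "\<sigma> \<in> {1, -1}" "\<tau> \<in> {1, -1}" "0 < a" "0 < b" "a * \<sigma> = b * \<tau>"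
  shows "\<sigma> = \<tau>" "a = b"
  using assms by auto

text \<open>Once the vertices are scaled to a second part of modulus one, the coefficients of a
  square relation can be compared through it, since 1 and \<open>cis (pi/3)\<close> are independent
  over the reals.\<close>

lemma (in cct) normal_form:
  assumes k: "3 \<le> k" and sw: "induces k T \<phi> refl4 swap12"
    and tr: "induces k T \<phi> (r34 \<circ> r12) (\<lambda>v. v + vector [0, -1, 1])"
    and nz: "\<And>v. 0 \<le> coord_sum v \<Longrightarrow> coord_sum v \<le> int k \<Longrightarrow> zc (vpt \<phi> v) \<noteq> 0"
      "\<And>v. 0 \<le> coord_sum v \<Longrightarrow> coord_sum v \<le> int k \<Longrightarrow> yc (vpt \<phi> v) \<noteq> 0"
  obtains \<sigma> \<nu> \<zeta> d where "\<sigma> \<in> {1, -1}" "\<And>l. l \<le> k \<Longrightarrow> 0 < \<nu> l" "\<And>l. l \<le> k \<Longrightarrow> \<zeta> l \<noteq> 0"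
    "\<And>v. 0 \<le> coord_sum v \<Longrightarrow> coord_sum v \<le> int k \<Longrightarrow> vpt \<phi> v = \<nu> (nat (coord_sum v)) *\<^sub>R
      cvec (zphase v * \<zeta> (nat (coord_sum v))) (yphase v * of_real \<sigma>) (d (nat (coord_sum v)))"
    "\<And>l. l + 2 \<le> k \<Longrightarrow> \<exists>t>0. \<zeta> (l + 1) - \<i> * \<zeta> (l + 2) = of_real t * (\<zeta> l - \<i> * \<zeta> (l + 1)) \<and>
      d (l + 2) - d (l + 1) = t * (d (l + 1) - d l)"
    "\<And>l. l + 2 \<le> k \<Longrightarrow> \<exists>\<theta>. 0 < \<theta> \<and> \<theta> < 1 \<and>
      of_real (1 - \<theta>) * \<zeta> l + of_real \<theta> * \<zeta> (l + 2) = 2 * \<zeta> (l + 1) \<and>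
      (1 - \<theta>) * d l + \<theta> * d (l + 2) = 2 * d (l + 1)"
proof -
  obtain z c \<delta> where zc\<delta>: "\<And>v. 0 \<le> coord_sum v \<Longrightarrow> coord_sum v \<le> int k \<Longrightarrow> vpt \<phi> v =
      cvec (zphase v * z (nat (coord_sum v))) (yphase v * of_real (c (nat (coord_sum v)))) (\<delta> (nat (coord_sum v)))"
    using layer_coords[OF sw tr] by metis
  define org where "org l = (vector [0, 0, int l] :: int^3)" for l
  have os: "coord_sum (org l) = int l" for l by (simp add: org_def coord_sum_def)
  have z0: "z l \<noteq> 0" and c0: "c l \<noteq> 0" if "l \<le> k" for l
    using nz[of "org l"] zc\<delta>[of "org l"] os that by auto
  define \<nu> \<zeta> d s where "\<nu> l = \<bar>c l\<bar>" and "\<zeta> l = z l / of_real \<bar>c l\<bar>" and "d l = \<delta> l / \<bar>c l\<bar>"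
    and "s l = sgn (c l)" for l
  have \<nu>: "0 < \<nu> l" and \<zeta>0: "\<zeta> l \<noteq> 0" and s: "s l \<in> {1, -1}" if "l \<le> k" for l
    using z0[OF that] c0[OF that] by (auto simp: \<nu>_def \<zeta>_def s_def sgn_if)
  have form: "vpt \<phi> v = \<nu> l *\<^sub>R cvec (zphase v * \<zeta> l) (yphase v * of_real (s l)) (d l)"
    if "coord_sum v = int l" "l \<le> k" for v l
  proof -
    have "c l = \<bar>c l\<bar> * s l" by (simp add: s_def abs_mult_sgn)
    then have "of_real (c l) = of_real \<bar>c l\<bar> * (of_real (s l) :: complex)" by (metis of_real_mult)
    then show ?thesis using zc\<delta>[of v] that c0[of l]
      by (simp add: coords_eq_iff \<nu>_def \<zeta>_def d_def mult.left_commute)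
  qed
  \<comment> \<open>The square in directions 1 and 3: the second parts identify the coefficients in
    pairs and the signs of three layers. The remaining coordinates then say that consecutive steps
    are parallel.\<close>
  have A: "(s (l + 2) = s (l + 1) \<and> s (l + 1) = s l) \<and>
      (\<exists>t>0. \<zeta> (l + 1) - \<i> * \<zeta> (l + 2) = of_real t * (\<zeta> l - \<i> * \<zeta> (l + 1)) \<and>
      d (l + 2) - d (l + 1) = t * (d (l + 1) - d l))" if l: "l + 2 \<le> k" for l
  proof -
    define u where "u = org l"
    have us: "coord_sum u = int l" by (simp add: u_def os)
    have ne: "(1 :: 3) \<noteq> 3" and r: "0 \<le> coord_sum u" "coord_sum u + 2 \<le> int k" using us l by simp_all
    obtain x y a b where pos: "0 < x" "0 < y" "0 < a" "0 < b" and
      eq: "x *\<^sub>R vpt \<phi> u + y *\<^sub>R vpt \<phi> (u + axis 1 1 + axis 3 1)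
       = a *\<^sub>R vpt \<phi> (u + axis 1 1) + b *\<^sub>R vpt \<phi> (u + axis 3 1)"
      using square_relation[OF ne r] .
    have p: "vpt \<phi> u = \<nu> l *\<^sub>R cvec (zphase u * \<zeta> l) (yphase u * of_real (s l)) (d l)"
      "vpt \<phi> (u + axis 1 1) = \<nu> (l + 1) *\<^sub>R cvec (zphase u * \<zeta> (l + 1)) (cis (pi/3) * yphase u * of_real (s (l + 1))) (d (l + 1))"
      "vpt \<phi> (u + axis 3 1) = \<nu> (l + 1) *\<^sub>R cvec (\<i> * zphase u * \<zeta> (l + 1)) (yphase u * of_real (s (l + 1))) (d (l + 1))"
      "vpt \<phi> (u + axis 1 1 + axis 3 1) = \<nu> (l + 2) *\<^sub>R cvec (\<i> * zphase u * \<zeta> (l + 2)) (cis (pi/3) * yphase u * of_real (s (l + 2))) (d (l + 2))"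
      using form[of u l] form[of "u + axis 1 1" "l + 1"] form[of "u + axis 3 1" "l + 1"]
        form[of "u + axis 1 1 + axis 3 1" "l + 2"] l us by (simp_all add: coord_sum_add phase_axis)
    define X Y P Q where "X = x * \<nu> l" and "Y = y * \<nu> (l + 2)" and "P = a * \<nu> (l + 1)" and "Q = b * \<nu> (l + 1)"
    have XY: "0 < X" "0 < Y" "0 < P" "0 < Q" using pos \<nu> l by (auto simp: X_def Y_def P_def Q_def)
    note eq' = eq[unfolded p coords_eq_iff, simplified]
    have "yphase u * (of_real (X * s l - Q * s (l + 1)) + of_real (Y * s (l + 2) - P * s (l + 1)) * cis (pi/3)) = 0"
      using eq' by (simp add: X_def Y_def P_def Q_def algebra_simps)
    then have "of_real (X * s l - Q * s (l + 1)) + of_real (Y * s (l + 2) - P * s (l + 1)) * cis (pi/3) = 0"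
      by (simp only: mult_eq_0_iff phase_nonzero simp_thms)
    then have e: "X * s l = Q * s (l + 1)" "Y * s (l + 2) = P * s (l + 1)"
      using cis_pi_third_independent by (metis eq_iff_diff_eq_0)+
    have ss: "s l = s (l + 1)" "X = Q" "s (l + 2) = s (l + 1)" "Y = P"
      using sign_cancel[OF s s _ _ e(1)] sign_cancel[OF s s _ _ e(2)] XY l by auto
    have "zphase u * (of_real X * \<zeta> l + of_real Y * (\<i> * \<zeta> (l + 2)) - of_real P * \<zeta> (l + 1) - of_real Q * (\<i> * \<zeta> (l + 1))) = 0"
      using eq' by (simp add: X_def Y_def P_def Q_def algebra_simps)
    then have "of_real X * \<zeta> l + of_real Y * (\<i> * \<zeta> (l + 2)) - of_real P * \<zeta> (l + 1) - of_real Q * (\<i> * \<zeta> (l + 1)) = 0"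
      by (simp only: mult_eq_0_iff phase_nonzero simp_thms)
    then have z: "of_real Y * (\<zeta> (l + 1) - \<i> * \<zeta> (l + 2)) = of_real X * (\<zeta> l - \<i> * \<zeta> (l + 1))"
      unfolding ss(2)[symmetric] ss(4)[symmetric] by (simp add: algebra_simps)
    have "X * d l + Y * d (l + 2) = P * d (l + 1) + Q * d (l + 1)"
      using eq' by (simp add: X_def Y_def P_def Q_def algebra_simps)
    then have dd: "Y * (d (l + 2) - d (l + 1)) = X * (d (l + 1) - d l)"
      unfolding ss(2)[symmetric] ss(4)[symmetric] by (simp add: algebra_simps)
    have "\<zeta> (l + 1) - \<i> * \<zeta> (l + 2) = of_real (X / Y) * (\<zeta> l - \<i> * \<zeta> (l + 1))"
      using z XY by (simp add: field_simps)
    moreover have "d (l + 2) - d (l + 1) = X / Y * (d (l + 1) - d l)" using dd XY by (simp add: field_simps)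
    moreover have "0 < X / Y" using XY by simp
    ultimately show ?thesis using ss(1,3) by metis
  qed
  have s_const: "s l = s 0" if "l \<le> k" for l
    using that
  proof (induction l)
    case (Suc l)
    show ?case
    proof (cases l)
      case 0
      then show ?thesis using A[of 0] k by simp
    next
      case (Suc m)
      then show ?thesis using A[of m] Suc.IH Suc.prems by simp
    qed
  qed simp
  \<comment> \<open>The square in directions 1 and 2: the second parts force
    \<open>P = Q = X + Y\<close>, and \<open>\<theta>\<close> is the share of the top corner in
    \<open>X + Y\<close>.\<close>
  have B: "\<exists>\<theta>. 0 < \<theta> \<and> \<theta> < 1 \<and> of_real (1 - \<theta>) * \<zeta> l + of_real \<theta> * \<zeta> (l + 2) = 2 * \<zeta> (l + 1) \<and>
      (1 - \<theta>) * d l + \<theta> * d (l + 2) = 2 * d (l + 1)" if l: "l + 2 \<le> k" for l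
  proof -
    define u where "u = org l"
    have us: "coord_sum u = int l" by (simp add: u_def os)
    have ne: "(1 :: 3) \<noteq> 2" and r: "0 \<le> coord_sum u" "coord_sum u + 2 \<le> int k" using us l by simp_all
    obtain x y a b where pos: "0 < x" "0 < y" "0 < a" "0 < b" and
      eq: "x *\<^sub>R vpt \<phi> u + y *\<^sub>R vpt \<phi> (u + axis 1 1 + axis 2 1)
       = a *\<^sub>R vpt \<phi> (u + axis 1 1) + b *\<^sub>R vpt \<phi> (u + axis 2 1)"
      using square_relation[OF ne r] .
    have ss: "s l = s 0" "s (l + 1) = s 0" "s (l + 2) = s 0" using l by (intro s_const, simp)+
    have s0: "s 0 \<noteq> 0" using s[of 0] by auto
    have p: "vpt \<phi> u = \<nu> l *\<^sub>R cvec (zphase u * \<zeta> l) (yphase u * of_real (s 0)) (d l)"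
      "vpt \<phi> (u + axis 1 1) = \<nu> (l + 1) *\<^sub>R cvec (zphase u * \<zeta> (l + 1)) (cis (pi/3) * yphase u * of_real (s 0)) (d (l + 1))"
      "vpt \<phi> (u + axis 2 1) = \<nu> (l + 1) *\<^sub>R cvec (zphase u * \<zeta> (l + 1)) (cnj (cis (pi/3)) * yphase u * of_real (s 0)) (d (l + 1))"
      "vpt \<phi> (u + axis 1 1 + axis 2 1) = \<nu> (l + 2) *\<^sub>R cvec (zphase u * \<zeta> (l + 2)) (yphase u * of_real (s 0)) (d (l + 2))"
      using form[of u l, unfolded ss] form[of "u + axis 1 1" "l + 1", unfolded ss]
        form[of "u + axis 2 1" "l + 1", unfolded ss] form[of "u + axis 1 1 + axis 2 1" "l + 2", unfolded ss] l us
      by (simp_all add: coord_sum_add phase_axis mult.assoc[symmetric])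
    define X Y P Q where "X = x * \<nu> l" and "Y = y * \<nu> (l + 2)" and "P = a * \<nu> (l + 1)" and "Q = b * \<nu> (l + 1)"
    have XY: "0 < X" "0 < Y" "0 < P" "0 < Q" using pos \<nu> l by (auto simp: X_def Y_def P_def Q_def)
    note eq' = eq[unfolded p coords_eq_iff cnj_cis_pi_third, simplified]
    have "(yphase u * of_real (s 0)) * (of_real (X + Y - Q) + of_real (Q - P) * cis (pi/3)) = 0"
      using eq' by (simp add: X_def Y_def P_def Q_def algebra_simps)
    then have "of_real (X + Y - Q) + of_real (Q - P) * cis (pi/3) = 0"
      using s0 by (simp only: mult_eq_0_iff phase_nonzero of_real_eq_0_iff simp_thms)
    then have e: "X + Y = Q" "P = Q" using cis_pi_third_independent by (metis eq_iff_diff_eq_0)+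
    have "zphase u * (of_real X * \<zeta> l + of_real Y * \<zeta> (l + 2) - of_real P * \<zeta> (l + 1) - of_real Q * \<zeta> (l + 1)) = 0"
      using eq' by (simp add: X_def Y_def P_def Q_def algebra_simps)
    then have "of_real X * \<zeta> l + of_real Y * \<zeta> (l + 2) - of_real P * \<zeta> (l + 1) - of_real Q * \<zeta> (l + 1) = 0"
      by (simp only: mult_eq_0_iff phase_nonzero simp_thms)
    then have z: "of_real X * \<zeta> l + of_real Y * \<zeta> (l + 2) = of_real Q * (2 * \<zeta> (l + 1))"
      unfolding e by (simp add: algebra_simps)
    have "X * d l + Y * d (l + 2) = P * d (l + 1) + Q * d (l + 1)"
      using eq' by (simp add: X_def Y_def P_def Q_def algebra_simps)
    then have dd: "X * d l + Y * d (l + 2) = Q * (2 * d (l + 1))" using e(2) by simp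
    define \<theta> where "\<theta> = Y / Q"
    have t: "X = Q * (1 - \<theta>)" "Y = Q * \<theta>" using e XY by (auto simp: \<theta>_def field_simps)
    have "0 < \<theta>" "\<theta> < 1" using e XY by (auto simp: \<theta>_def)
    moreover have "of_real Q * (of_real (1 - \<theta>) * \<zeta> l + of_real \<theta> * \<zeta> (l + 2)) = of_real Q * (2 * \<zeta> (l + 1))"
      unfolding z[symmetric] by (simp add: t algebra_simps)
    then have "of_real (1 - \<theta>) * \<zeta> l + of_real \<theta> * \<zeta> (l + 2) = 2 * \<zeta> (l + 1)"
      using XY by (simp only: mult_cancel_left of_real_eq_0_iff) simp
    moreover have "Q * ((1 - \<theta>) * d l + \<theta> * d (l + 2)) = Q * (2 * d (l + 1))"
      unfolding dd[symmetric] by (simp add: t algebra_simps)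
    then have "(1 - \<theta>) * d l + \<theta> * d (l + 2) = 2 * d (l + 1)" using XY by simp
    ultimately show ?thesis by blast
  qed
  show ?thesis
  proof (rule that[of "s 0" \<nu> \<zeta> d])
    fix v assume "0 \<le> coord_sum v" "coord_sum v \<le> int k"
    then show "vpt \<phi> v = \<nu> (nat (coord_sum v)) *\<^sub>R
      cvec (zphase v * \<zeta> (nat (coord_sum v))) (yphase v * of_real (s 0)) (d (nat (coord_sum v)))"
      using form[of v "nat (coord_sum v)"] s_const[of "nat (coord_sum v)"] by simp
  qed (use s \<nu> \<zeta>0 A B in auto)
qed

lemma spiral_form:
  fixes \<zeta> :: "nat \<Rightarrow> complex" and d :: "nat \<Rightarrow> real"
  assumes k: "2 \<le> k" and nz: "\<And>l. l \<le> k \<Longrightarrow> \<zeta> l \<noteq> 0"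
    and turn: "\<And>l. l + 2 \<le> k \<Longrightarrow> \<exists>t>0. \<zeta> (l + 1) - \<i> * \<zeta> (l + 2) = of_real t * (\<zeta> l - \<i> * \<zeta> (l + 1)) \<and>
      d (l + 2) - d (l + 1) = t * (d (l + 1) - d l)"
    and rec: "\<And>l. l + 2 \<le> k \<Longrightarrow> \<exists>\<theta>. 0 < \<theta> \<and> \<theta> < 1 \<and>
      of_real (1 - \<theta>) * \<zeta> l + of_real \<theta> * \<zeta> (l + 2) = 2 * \<zeta> (l + 1) \<and>
      (1 - \<theta>) * d l + \<theta> * d (l + 2) = 2 * d (l + 1)"
  obtains e A C where "e \<noteq> 0" "\<And>l. l \<le> k \<Longrightarrow> \<zeta> l = e * Complex (A (l + 1)) (- A l)"
    "\<And>l. l + 1 \<le> k \<Longrightarrow> 0 < A (l + 2) + A l" "\<And>l. l + 1 \<le> k \<Longrightarrow> d (l + 1) - d l = C * (A (l + 2) + A l)"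
    "\<And>l. l + 2 \<le> k \<Longrightarrow> \<exists>\<theta>. 0 < \<theta> \<and> \<theta> < 1 \<and> \<theta> * A (l + 2) + (1 - \<theta>) * A l = 2 * A (l + 1) \<and>
      \<theta> * A (l + 3) + (1 - \<theta>) * A (l + 1) = 2 * A (l + 2) \<and> (1 - \<theta>) * d l + \<theta> * d (l + 2) = 2 * d (l + 1)"
proof -
  define U where "U l = \<zeta> l - \<i> * \<zeta> (l + 1)" for l
  \<comment> \<open>If the first step vanished, so would the second. Then \<open>\<zeta> 0\<close>
    and \<open>\<zeta> 2\<close> would be opposite quarter turns of \<open>\<zeta> 1\<close>, and
    the recurrence would equate an imaginary number with 2.\<close>
  have U0: "U 0 \<noteq> 0"
  proof
    assume U: "U 0 = 0"
    then have "U 1 = 0" using turn[of 0] k by (auto simp: U_def numeral_2_eq_2)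
    then have "\<zeta> 1 = \<i> * \<zeta> 2" by (simp add: U_def numeral_2_eq_2)
    then have z2: "\<zeta> 2 = - (\<i> * \<zeta> 1)" by simp
    have z: "\<zeta> 0 = \<i> * \<zeta> 1" using U by (simp add: U_def)
    obtain \<theta> where "of_real (1 - \<theta>) * \<zeta> 0 + of_real \<theta> * \<zeta> 2 = 2 * \<zeta> 1"
      using rec[of 0] k by (auto simp: numeral_2_eq_2)
    then have "(of_real (1 - 2 * \<theta>) * \<i> - 2) * \<zeta> 1 = 0" unfolding z z2 by (simp add: algebra_simps)
    then have "of_real (1 - 2 * \<theta>) * \<i> = (2 :: complex)" using nz[of 1] k by auto
    then show False by (simp add: complex_eq_iff)
  qed
  have mult: "\<exists>t>0. U l = of_real t * U 0 \<and> d (l + 1) - d l = t * (d 1 - d 0)" if "l + 1 \<le> k" for l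
    using that
  proof (induction l)
    case 0
    then show ?case by (intro exI[of _ 1]) simp
  next
    case (Suc l)
    then obtain t where t: "0 < t" "U l = of_real t * U 0" "d (l + 1) - d l = t * (d 1 - d 0)" by auto
    obtain r where r: "0 < r" "U (l + 1) = of_real r * U l" "d (l + 2) - d (l + 1) = r * (d (l + 1) - d l)"
      using turn[of l] Suc.prems by (auto simp: U_def numeral_2_eq_2)
    show ?case using t r by (intro exI[of _ "r * t"]) (simp add: numeral_2_eq_2)
  qed
  \<comment> \<open>In this unit every step is a negative multiple of \<open>\<i>\<close>. Hence
    each imaginary part is minus the preceding real part, and one real sequence encodes both; only
    \<open>A 0\<close> has to be taken from an imaginary part.\<close>
  define e where "e = \<i> * U 0"
  define \<xi> where "\<xi> l = \<zeta> l / e" for l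
  define A where "A l = (if l = 0 then - Im (\<xi> 0) else Re (\<xi> (l - 1)))" for l
  have e0: "e \<noteq> 0" using U0 by (simp add: e_def)
  have step: "Im (\<xi> (l + 1)) = - Re (\<xi> l) \<and> 0 < Re (\<xi> (l + 1)) - Im (\<xi> l) \<and>
      d (l + 1) - d l = (d 1 - d 0) * (Re (\<xi> (l + 1)) - Im (\<xi> l))" if l: "l + 1 \<le> k" for l
  proof -
    obtain t where t: "0 < t" "U l = of_real t * U 0" "d (l + 1) - d l = t * (d 1 - d 0)"
      using mult[OF l] by blast
    have "\<xi> l - \<i> * \<xi> (l + 1) = U l / e" by (simp add: \<xi>_def U_def diff_divide_distrib)
    also have "\<dots> = - (\<i> * of_real t)" using U0 by (simp add: t e_def field_simps)
    finally have "Re (\<xi> l) + Im (\<xi> (l + 1)) = 0" "Im (\<xi> l) - Re (\<xi> (l + 1)) = - t"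
      by (auto simp: complex_eq_iff)
    then have "Im (\<xi> (l + 1)) = - Re (\<xi> l)" "Re (\<xi> (l + 1)) - Im (\<xi> l) = t" by auto
    then show ?thesis using t by simp
  qed
  have ImA: "Im (\<xi> l) = - A l" if "l \<le> k" for l
    using step[of "l - 1"] that by (cases l) (auto simp: A_def)
  have ReA: "Re (\<xi> l) = A (l + 1)" for l by (simp add: A_def)
  have \<zeta>: "\<zeta> l = e * Complex (A (l + 1)) (- A l)" if "l \<le> k" for l
  proof -
    have "\<xi> l = Complex (A (l + 1)) (- A l)" using ImA[OF that] ReA by (simp add: complex_eq_iff)
    then show ?thesis using e0 by (simp add: \<xi>_def field_simps)
  qed
  have "\<exists>\<theta>. 0 < \<theta> \<and> \<theta> < 1 \<and> \<theta> * A (l + 2) + (1 - \<theta>) * A l = 2 * A (l + 1) \<and>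
      \<theta> * A (l + 3) + (1 - \<theta>) * A (l + 1) = 2 * A (l + 2) \<and> (1 - \<theta>) * d l + \<theta> * d (l + 2) = 2 * d (l + 1)"
    if l: "l + 2 \<le> k" for l
  proof -
    obtain \<theta> where th: "0 < \<theta>" "\<theta> < 1" "(1 - \<theta>) * d l + \<theta> * d (l + 2) = 2 * d (l + 1)"
      and z: "of_real (1 - \<theta>) * \<zeta> l + of_real \<theta> * \<zeta> (l + 2) = 2 * \<zeta> (l + 1)" using rec[OF l] by blast
    have "of_real (1 - \<theta>) * \<xi> l + of_real \<theta> * \<xi> (l + 2) = (of_real (1 - \<theta>) * \<zeta> l + of_real \<theta> * \<zeta> (l + 2)) / e"
      by (simp add: \<xi>_def add_divide_distrib)
    also have "\<dots> = 2 * \<xi> (l + 1)" unfolding z by (simp add: \<xi>_def)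
    finally have x: "of_real (1 - \<theta>) * \<xi> l + of_real \<theta> * \<xi> (l + 2) = 2 * \<xi> (l + 1)" .
    have "(1 - \<theta>) * Re (\<xi> l) + \<theta> * Re (\<xi> (l + 2)) = 2 * Re (\<xi> (l + 1))"
      "(1 - \<theta>) * Im (\<xi> l) + \<theta> * Im (\<xi> (l + 2)) = 2 * Im (\<xi> (l + 1))"
      using arg_cong[OF x, of Re] arg_cong[OF x, of Im] by auto
    then have "\<theta> * A (l + 2) + (1 - \<theta>) * A l = 2 * A (l + 1)" "\<theta> * A (l + 3) + (1 - \<theta>) * A (l + 1) = 2 * A (l + 2)"
      using ImA[of l] ImA[of "l + 1"] ImA[of "l + 2"] l by (auto simp: ReA eval_nat_numeral)
    then show ?thesis using th by blast
  qed
  moreover have "0 < A (l + 2) + A l" "d (l + 1) - d l = (d 1 - d 0) * (A (l + 2) + A l)" if "l + 1 \<le> k" for l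
    using step[OF that] ImA[of l] ReA[of "l + 1"] that by auto
  ultimately show ?thesis using that[of e A "d 1 - d 0"] e0 \<zeta> by blast
qed

text \<open>The recurrence centred at \<open>A (l + 2)\<close> comes from two neighbouring squares,
  so their ratios agree unless \<open>A (l + 3) = A (l + 1)\<close>. In that case the heights
  decide, which takes \<open>C \<noteq> 0\<close>.\<close>

lemma constant_ratio:
  fixes A d :: "nat \<Rightarrow> real"
  assumes k: "2 \<le> k" and C: "C \<noteq> 0"
    and pos: "\<And>l. l + 1 \<le> k \<Longrightarrow> 0 < A (l + 2) + A l"
    and inc: "\<And>l. l + 1 \<le> k \<Longrightarrow> d (l + 1) - d l = C * (A (l + 2) + A l)"
    and rec: "\<And>l. l + 2 \<le> k \<Longrightarrow> \<exists>\<theta>. 0 < \<theta> \<and> \<theta> < 1 \<and> \<theta> * A (l + 2) + (1 - \<theta>) * A l = 2 * A (l + 1) \<and>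
      \<theta> * A (l + 3) + (1 - \<theta>) * A (l + 1) = 2 * A (l + 2) \<and> (1 - \<theta>) * d l + \<theta> * d (l + 2) = 2 * d (l + 1)"
  obtains \<theta> where "layer_seq \<theta> A (k + 1)" "\<And>l. l \<le> k \<Longrightarrow> d l = C * seq_height \<theta> A l"
proof -
  obtain th where th: "\<And>l. l + 2 \<le> k \<Longrightarrow> 0 < th l \<and> th l < 1 \<and> th l * A (l + 2) + (1 - th l) * A l = 2 * A (l + 1) \<and>
      th l * A (l + 3) + (1 - th l) * A (l + 1) = 2 * A (l + 2) \<and> (1 - th l) * d l + th l * d (l + 2) = 2 * d (l + 1)"
    using rec by metis
  have step: "th (l + 1) = th l" if l: "l + 3 \<le> k" for l
  proof -
    define t t' where "t = th l" and "t' = th (l + 1)"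
    define a0 a1 a2 a3 a4 where "a0 = A l" and "a1 = A (l + 1)" and "a2 = A (l + 2)" and "a3 = A (l + 3)" and "a4 = A (l + 4)"
    define d0 d1 d2 d3 where "d0 = d l" and "d1 = d (l + 1)" and "d2 = d (l + 2)" and "d3 = d (l + 3)"
    note defs = t_def t'_def a0_def a1_def a2_def a3_def a4_def d0_def d1_def d2_def d3_def
    have 1: "t * a2 + (1 - t) * a0 = 2 * a1" "t * a3 + (1 - t) * a1 = 2 * a2" "(1 - t) * d0 + t * d2 = 2 * d1"
      using th[of l] l by (simp_all add: defs)
    have 2: "t' * a3 + (1 - t') * a1 = 2 * a2" "t' * a4 + (1 - t') * a2 = 2 * a3" "(1 - t') * d1 + t' * d3 = 2 * d2"
      using th[of "l + 1"] l by (simp_all add: defs eval_nat_numeral)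
    have 3: "d1 - d0 = C * (a2 + a0)" "d2 - d1 = C * (a3 + a1)" "d3 - d2 = C * (a4 + a2)"
      using inc[of l] inc[of "l + 1"] inc[of "l + 2"] l by (simp_all add: defs eval_nat_numeral)
    have 4: "0 < a3 + a1" using pos[of "l + 1"] l by (simp add: defs eval_nat_numeral)
    have "(t' - t) * (a3 - a1) = 0" using 1(2) 2(1) by (simp add: algebra_simps)
    moreover have "t' = t" if "a3 = a1"
    proof -
      have a: "a1 = 2 * a2" "a3 = 2 * a2" using 1(2) that by (auto simp: algebra_simps)
      have "C * (6 * a2 * (t' - t)) = 0" using 1 2 3 unfolding a by algebra
      then show ?thesis using C 4 a by simp
    qed
    ultimately show ?thesis by (auto simp: t_def t'_def)
  qed
  have const: "th l = th 0" if "l + 2 \<le> k" for l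
    using that
  proof (induction l)
    case (Suc l)
    then show ?case using step[of l] by simp
  qed simp
  define \<theta> where "\<theta> = th 0"
  have t: "0 < \<theta>" "\<theta> < 1" using th[of 0] k by (auto simp: \<theta>_def)
  have recA: "\<theta> * A (i + 2) + (1 - \<theta>) * A i = 2 * A (i + 1)" if i: "i + 2 \<le> k + 1" for i
  proof (cases "i + 2 \<le> k")
    case True
    then show ?thesis using th[OF True] const[OF True] by (simp add: \<theta>_def)
  next
    case False
    then obtain j where j: "i = j + 1" "j + 2 \<le> k" using i k by (cases i) auto
    then show ?thesis using th[OF j(2)] const[OF j(2)] by (simp add: \<theta>_def eval_nat_numeral)
  qed
  have "layer_seq \<theta> A (k + 1)" by standard (use t recA pos in auto)
  moreover have "d l = C * seq_height \<theta> A l" if "l \<le> k" for l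
  proof -
    define h where "h l = d l - C * seq_height \<theta> A l" for l
    have h: "h (l + 1) = h l" if "l + 1 \<le> k" for l
    proof -
      have "seq_height \<theta> A (l + 1) - seq_height \<theta> A l = A (l + 2) + A l"
        using recA[of l] that by (simp add: seq_height_def algebra_simps)
      then have "C * seq_height \<theta> A (l + 1) - C * seq_height \<theta> A l = d (l + 1) - d l"
        using inc[OF that] by (metis right_diff_distrib)
      then show ?thesis by (simp add: h_def)
    qed
    have h0: "h l = h 0" if "l \<le> k" for l
      using that
    proof (induction l)
      case (Suc l)
      then show ?case using h[of l] by simp
    qed simp
    \<comment> \<open>The heights obey the recurrence as well, which determines their additive
      constant; index 1 is the centre of the first square.\<close>
    have "d 1 = C * seq_height \<theta> A 1"
    proof -
      have r: "\<theta> * A 2 + (1 - \<theta>) * A 0 = 2 * A 1" "\<theta> * A 3 + (1 - \<theta>) * A 1 = 2 * A 2" "(1 - \<theta>) * d 0 + \<theta> * d 2 = 2 * d 1"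
        using th[of 0] k by (simp_all add: \<theta>_def eval_nat_numeral)
      have i: "d 1 - d 0 = C * (A 2 + A 0)" "d 2 - d 1 = C * (A 3 + A 1)"
        using inc[of 0] inc[of 1] k by (simp_all add: eval_nat_numeral)
      have "d 1 = C * ((1 + 2 * \<theta>) * A 2 - (3 - 2 * \<theta>) * A 1)" using r i by algebra
      then show ?thesis by (simp add: seq_height_def numeral_2_eq_2)
    qed
    then have "h 1 = 0" by (simp add: h_def)
    then have "h l = 0" using h0[OF that] h0[of 1] k by simp
    then show ?thesis by (simp add: h_def)
  qed
  ultimately show ?thesis using that by blast
qed

section \<open>The functional that vanishes on a cube\<close>

lemma cube_functional_solve:
  fixes a0 a1 a2 a3 :: real
  assumes z: "g1 * a1 + g2 * a0 + h1 + \<gamma> * d0 = 0" "g1 * a1 - g2 * a2 + h1 + \<gamma> * d1 = 0"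
      "g1 * a3 + g2 * a2 + h1 + \<gamma> * d2 = 0"
    and inc: "d1 - d0 = C * (a2 + a0)" "d2 - d1 = C * (a3 + a1)" and pos: "0 < a2 + a0"
  shows "g2 = \<gamma> * C" "g1 * (a3 - a1) = - (\<gamma> * C * (a3 + 2 * a2 + a1))"
proof -
  have "(a2 + a0) * (g2 - \<gamma> * C) = 0" using z(1,2) inc(1) by algebra
  then show "g2 = \<gamma> * C" using pos by simp
  then show "g1 * (a3 - a1) = - (\<gamma> * C * (a3 + 2 * a2 + a1))" using z(2,3) inc(2) by algebra
qed

text \<open>With \<open>C = 0\<close> the recurrence kills the heights and the incidences kill
  \<open>g2\<close>. The inequalities \<open>h\<close> and \<open>t\<close>, which come from
  vertices off the facet, then make both terms of \<open>g1 * a1 + h1 = 0\<close> positive.\<close>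

lemma facet_nondegenerate:
  fixes a0 a1 a2 a3 :: real
  assumes z: "g1 * a1 + g2 * a0 + h1 + \<gamma> * d0 = 0" "g1 * a1 - g2 * a2 + h1 + \<gamma> * d1 = 0"
      "g1 * a3 + g2 * a2 + h1 + \<gamma> * d2 = 0"
    and inc: "d1 - d0 = C * (a2 + a0)" "d2 - d1 = C * (a3 + a1)" and pos: "0 < a2 + a0" "0 < a3 + a1"
    and rec: "\<theta> * a3 + (1 - \<theta>) * a1 = 2 * a2" and d: "(1 - \<theta>) * d0 + \<theta> * d2 = 2 * d1"
    and h: "0 < h1" and t: "0 < g1 * a1 + g2 * a0" "0 < g1 * a3 + g2 * a2"
  shows "C \<noteq> 0"
proof
  assume C: "C = 0"
  note s = cube_functional_solve[OF z inc pos(1)]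
  have g2: "g2 = 0" and g1: "g1 * (a3 - a1) = 0" using s C by auto
  have "0 < g1 * (a3 + a1)" using t g2 by (simp add: algebra_simps)
  then have g1p: "0 < g1" using pos(2) by (simp add: zero_less_mult_iff)
  then have "a3 = a1" using g1 by simp
  then have "0 < a1" using pos by simp
  moreover have "d1 = 0"
  proof -
    have "d0 = d1" "d2 = d1" using inc C by auto
    then show ?thesis using d by (simp add: algebra_simps)
  qed
  then have "g1 * a1 + h1 = 0" using z(2) g2 by simp
  ultimately show False using g1p h by (smt (verit) mult_pos_pos)
qed

text \<open>This system of incidences is where \<open>seq_mass\<close> and \<open>seq_disc\<close>
  originate. The fourth equation belongs to the neighbours in directions 1 and 2, where the real
  part of the phase is 1/2.\<close>

lemma (in layer_seq) cube_functional_unique: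
  assumes b: "b + 3 \<le> N" and D: "seq_gap A b \<noteq> 0"
    and z: "g1 * A (b + 1) + g2 * A b + h1 + \<gamma> * (C * seq_height \<theta> A b) = 0"
      "g1 * A (b + 1) - g2 * A (b + 2) + h1 + \<gamma> * (C * seq_height \<theta> A (b + 1)) = 0"
      "g1 * A (b + 3) + g2 * A (b + 2) + h1 + \<gamma> * (C * seq_height \<theta> A (b + 2)) = 0"
      "g1 * A (b + 2) + g2 * A (b + 1) + h1 / 2 + \<gamma> * (C * seq_height \<theta> A (b + 1)) = 0"
  shows "g2 = \<gamma> * C" "g1 = - (\<gamma> * C * seq_mass A b / seq_gap A b)"
    "h1 = \<gamma> * C * (4 * seq_disc \<theta> A b) / seq_gap A b"
proof -
  have inc: "C * seq_height \<theta> A (i + 1) - C * seq_height \<theta> A i = C * (A (i + 2) + A i)" if "i + 2 \<le> N" for i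
  proof -
    have "seq_height \<theta> A (i + 1) - seq_height \<theta> A i = A (i + 2) + A i"
      using rec[of i] that by (simp add: seq_height_def algebra_simps)
    then show ?thesis by (metis right_diff_distrib)
  qed
  have inc': "C * seq_height \<theta> A (b + 2) - C * seq_height \<theta> A (b + 1) = C * (A (b + 3) + A (b + 1))"
    using inc[of "b + 1"] b by (simp add: eval_nat_numeral)
  note s = cube_functional_solve[OF z(1-3) inc inc' step_pos]
  show g2: "g2 = \<gamma> * C" using s(1) b by simp
  have s2: "g1 * seq_gap A b = - (\<gamma> * C * seq_mass A b)" using s(2) b by (simp add: seq_gap_def seq_mass_def)
  then show "g1 = - (\<gamma> * C * seq_mass A b / seq_gap A b)" using D by (simp add: field_simps)
  define g D q where "g = A (b + 2)" and "D = seq_gap A b" and "q = \<gamma> * C"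
  note vg = via_gap[OF b, folded g_def D_def]
  have "h1 * D = -2 * (g1 * D * g + q * A (b + 1) * D + q * D * seq_height \<theta> A (b + 1))"
    using z(4) g2 by (simp add: g_def q_def) algebra
  also have "\<dots> = q * (4 * seq_disc \<theta> A b)"
  proof -
    have h: "seq_height \<theta> A (b + 1) = (1 + 2 * \<theta>) * g - (3 - 2 * \<theta>) * A (b + 1)" by (simp add: seq_height_def g_def)
    have m: "seq_disc \<theta> A b = 3 * g\<^sup>2 + 2 * (1 - 2 * \<theta>) * g * D - \<theta> * (1 - \<theta>) * D\<^sup>2"
      by (simp add: seq_disc_def g_def D_def)
    have s3: "g1 * D = - (q * (6 * g + (1 - 2 * \<theta>) * D))" using s2 vg(4) by (simp add: D_def q_def)
    show ?thesis unfolding s3 h m vg(2) by algebra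
  qed
  finally show "h1 = \<gamma> * C * (4 * seq_disc \<theta> A b) / seq_gap A b"
    using D by (simp add: D_def q_def field_simps)
qed

text \<open>If the determinant were nonnegative, \<open>0 < h1\<close> would make the common factor
  \<open>r\<close> positive. Adding the inequalities \<open>t\<close> in pairs would then make both
  \<open>D\<close> and \<open>- D\<close>, each times a positive step, larger than a positive
  number.\<close>

lemma (in layer_seq) disc_negative:
  assumes b: "b + 4 \<le> N" and C: "C \<noteq> 0"
    and z: "g1 * A (b + 1) + g2 * A b + h1 + \<gamma> * (C * seq_height \<theta> A b) = 0"
      "g1 * A (b + 1) - g2 * A (b + 2) + h1 + \<gamma> * (C * seq_height \<theta> A (b + 1)) = 0"
      "g1 * A (b + 3) + g2 * A (b + 2) + h1 + \<gamma> * (C * seq_height \<theta> A (b + 2)) = 0"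
      "g1 * A (b + 2) + g2 * A (b + 1) + h1 / 2 + \<gamma> * (C * seq_height \<theta> A (b + 1)) = 0"
    and h: "0 < h1"
    and t: "0 < g1 * A (b + 1) + g2 * A b" "0 < g1 * A (b + 3) + g2 * A (b + 2)"
      "0 < g1 * A (b + 1) - g2 * A (b + 2)" "0 < g1 * A (b + 3) - g2 * A (b + 4)"
  shows "seq_disc \<theta> A b < 0"
proof (rule ccontr)
  assume M: "\<not> seq_disc \<theta> A b < 0"
  have b3: "b + 3 \<le> N" using b by simp
  define g D S q where "g = A (b + 2)" and "D = seq_gap A b" and "S = seq_mass A b" and "q = \<gamma> * C"
  note vg = via_gap[OF b3, folded g_def D_def S_def]
  have L: "0 < g + A b" "0 < A (b + 3) + A (b + 1)" "0 < A (b + 4) + g"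
    using step_pos[of b] step_pos[of "b + 1"] step_pos[of "b + 2"] b by (simp_all add: g_def eval_nat_numeral)
  have SL: "S = A (b + 3) + A (b + 1) + 2 * g" by (simp add: S_def seq_mass_def g_def)
  have D0: "D \<noteq> 0"
  proof
    assume D: "D = 0"
    have g: "A (b + 1) = 2 * g" "A (b + 3) = 2 * g" using vg D by auto
    have inc: "C * seq_height \<theta> A (i + 1) - C * seq_height \<theta> A i = C * (A (i + 2) + A i)" if "i + 2 \<le> N" for i
    proof -
      have "seq_height \<theta> A (i + 1) - seq_height \<theta> A i = A (i + 2) + A i"
        using rec[of i] that by (simp add: seq_height_def algebra_simps)
      then show ?thesis by (metis right_diff_distrib)
    qed
    have inc': "C * seq_height \<theta> A (b + 2) - C * seq_height \<theta> A (b + 1) = C * (A (b + 3) + A (b + 1))"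
      using inc[of "b + 1"] b by (simp add: eval_nat_numeral)
    have b2: "b + 2 \<le> N" using b by simp
    note s = cube_functional_solve[OF z(1-3) inc[OF b2] inc' step_pos[OF b2]]
    have "\<gamma> * C * (6 * g) = 0" using s(2) g by (simp add: g_def)
    then have "\<gamma> = 0" "g2 = 0" using C L(2) g s(1) by auto
    then show False using z(1) t(1) h by simp
  qed
  note u = cube_functional_unique[OF b3 _ z, folded D_def S_def q_def, OF D0]
  define r where "r = q / D"
  have h1: "h1 = 4 * r * seq_disc \<theta> A b" using u(3) by (simp add: r_def)
  have r: "0 < r" using h M unfolding h1 by (simp add: zero_less_mult_iff)
  have g1: "g1 = - (r * S)" and g2: "g2 = r * D" using u D0 by (simp_all add: r_def)
  have "0 < r * (D * (g + A b) - S * (A (b + 3) + A (b + 1)))"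
    using t(1,2) unfolding g1 g2 by (simp add: g_def algebra_simps)
  then have 1: "S * (A (b + 3) + A (b + 1)) < D * (g + A b)" using r by (simp add: zero_less_mult_iff)
  have "0 < r * (- (D * (A (b + 4) + g)) - S * (A (b + 3) + A (b + 1)))"
    using t(3,4) unfolding g1 g2 by (simp add: g_def algebra_simps)
  then have 2: "S * (A (b + 3) + A (b + 1)) < - (D * (A (b + 4) + g))" using r by (simp add: zero_less_mult_iff)
  have g0: "g \<le> 0 \<Longrightarrow> False" if "D > 0"
  proof -
    assume g: "g \<le> 0"
    have "(1 - \<theta>) * (g + A b) = (5 - 2 * \<theta>) * g - 2 * \<theta> * D" using vg(3) by (simp add: algebra_simps)
    moreover have "0 < (1 - \<theta>) * (g + A b)" using L th by simp
    moreover have "(5 - 2 * \<theta>) * g \<le> 0" using g th by (simp add: mult_nonneg_nonpos)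
    moreover have "0 < 2 * \<theta> * D" using that th by simp
    ultimately show False by linarith
  qed
  have g0': "g \<le> 0 \<Longrightarrow> False" if "D < 0"
  proof -
    assume g: "g \<le> 0"
    have "\<theta> * A (b + 4) + (1 - \<theta>) * g = 2 * A (b + 3)"
      using rec[of "b + 2"] b by (simp add: g_def eval_nat_numeral)
    then have "\<theta> * (A (b + 4) + g) = (3 + 2 * \<theta>) * g + 2 * (1 - \<theta>) * D" using vg(1) by (simp add: algebra_simps)
    moreover have "0 < \<theta> * (A (b + 4) + g)" using L th by simp
    moreover have "(3 + 2 * \<theta>) * g \<le> 0" using g th by (simp add: mult_nonneg_nonpos)
    moreover have "2 * (1 - \<theta>) * D < 0" using that th by (simp add: mult_pos_neg)
    ultimately show False by linarith
  qed
  have "0 < S" using g0 g0' D0 L(2) SL by (cases "D > 0") force+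
  then have 3: "0 < S * (A (b + 3) + A (b + 1))" using L(2) by simp
  have 4: "0 < D * (g + A b)" "0 < - (D * (A (b + 4) + g))" using 1 2 3 by linarith+
  then show False using L by (simp add: zero_less_mult_iff mult_less_0_iff)
qed

text \<open>\<open>Z\<close>, \<open>Y\<close>, \<open>h\<close> are the coordinates of the unknown
  vertex with the phases divided out; the squares in directions 1 and 3, 2 and 3, 1 and 2 express
  them through known layers. The first two have conjugate second parts but equal forms for
  \<open>Z\<close>, which forces \<open>x = t\<close>; the third then brings in the same
  \<open>\<theta>\<close>.\<close>

lemma next_layer:
  fixes a b c C \<theta> d0 d1 h :: real and Z Y :: complex
  assumes th: "0 < \<theta>" "\<theta> < 1" and rec: "\<theta> * c + (1 - \<theta>) * a = 2 * b" and nd: "c \<noteq> a" and L: "0 < c + a"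
    and inc: "d1 - d0 = C * (c + a)"
    and pos: "0 < s" "0 < t" "0 < x" "0 < s'" "0 < t'" "0 < x'" "0 < p" "0 < q" "0 < r"
    and Z13: "Z = of_real s * Complex (- b) (- c) + of_real t * Complex c (- b) - of_real x * Complex (- a) (- b)"
    and Y13: "Y = of_real s + of_real t * cnj (cis (pi/3)) - of_real x * cnj (cis (pi/3))"
    and h13: "h = s * d1 + t * d1 - x * d0"
    and Z23: "Z = of_real s' * Complex (- b) (- c) + of_real t' * Complex c (- b) - of_real x' * Complex (- a) (- b)"
    and Y23: "Y = of_real s' + of_real t' * cis (pi/3) - of_real x' * cis (pi/3)"
    and Z12: "Z = of_real p * Complex c (- b) + of_real q * Complex c (- b) - of_real r * Complex b (- a)"
    and Y12: "Y = of_real p * cis (pi/3) + of_real q * cnj (cis (pi/3)) - of_real r"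
  defines "e \<equiv> (2 * c - (1 - \<theta>) * b) / \<theta>"
  shows "0 < s" "Y = of_real s" "Z = of_real s * Complex e (- c)" "h = s * (d1 + C * (e + b))" "0 < e + b"
proof -
  have im: "sin (pi/3) \<noteq> 0" by (simp add: sin_60)
  \<comment> \<open>This difference multiplies \<open>X\<close> below; if it vanished, the
    recurrence would give \<open>c = a\<close>.\<close>
  have c2b: "c \<noteq> 2 * b"
  proof
    assume "c = 2 * b"
    then have "(1 - \<theta>) * (a - c) = 0" using rec by (simp add: algebra_simps)
    then show False using th nd by simp
  qed
  define X where "X = t - x"
  have "Im Y = - (X * sin (pi/3))" unfolding Y13 by (simp add: X_def algebra_simps)
  moreover have "Im Y = (t' - x') * sin (pi/3)" unfolding Y23 by (simp add: algebra_simps)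
  ultimately have "(t' - x' + X) * sin (pi/3) = 0" by (simp add: algebra_simps)
  then have 1: "t' - x' = - X" using im by simp
  have 2: "s' = s + X"
  proof -
    have "Re Y = s + X / 2" unfolding Y13 by (simp add: X_def cos_60 field_simps)
    moreover have "Re Y = s' + (t' - x') / 2" unfolding Y23 by (simp add: cos_60 field_simps)
    ultimately show ?thesis using 1 by simp
  qed
  have "X = 0"
  proof -
    have "Im Z = - s * c - X * b" unfolding Z13 by (simp add: X_def algebra_simps)
    moreover have "Im Z = - s' * c - (t' - x') * b" unfolding Z23 by (simp add: algebra_simps)
    ultimately have "X * (c - 2 * b) = 0" using 1 2 by algebra
    then show ?thesis using c2b by simp
  qed
  then have tx: "x = t" by (simp add: X_def)
  show Y: "Y = of_real s" using Y13 tx by simp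
  show "0 < s" by fact
  have ReZ: "Re Z = - s * b + t * (c + a)" "Im Z = - s * c" unfolding Z13 tx by (simp_all add: algebra_simps)
  have "p = q"
  proof -
    have "p * sin (pi/3) = q * sin (pi/3)" using arg_cong[OF Y12[unfolded Y], of Im] by simp
    then show ?thesis using im by simp
  qed
  moreover have "s = p / 2 + q / 2 - r" using arg_cong[OF Y12[unfolded Y], of Re] by (simp add: cos_60)
  ultimately have r: "q = p" "r = p - s" by auto
  have sp: "s < p" using r pos by simp
  have Z12': "Re Z = 2 * p * c - r * b" "Im Z = - 2 * p * b + r * a" unfolding Z12 r by (simp_all add: algebra_simps)
  \<comment> \<open>The weight \<open>s / p\<close> solves the equation that \<open>\<theta>\<close>
    satisfies, and \<open>c \<noteq> a\<close> makes the solution unique.\<close>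
  have s: "s = \<theta> * p"
  proof -
    have "s * c + (p - s) * a = 2 * p * b" using Z12'(2) ReZ(2) r by (simp add: algebra_simps)
    then have "s * c + (p - s) * a = p * (\<theta> * c + (1 - \<theta>) * a)" using rec by simp
    then have "(s - \<theta> * p) * (c - a) = 0" by (simp add: algebra_simps)
    then show ?thesis using nd by simp
  qed
  have "s * e = p * (2 * c - (1 - \<theta>) * b)" using s th by (simp add: e_def)
  then have Ze: "Re Z = s * e" using Z12'(1) r(2) s by (simp add: algebra_simps)
  show "Z = of_real s * Complex e (- c)" using Ze ReZ(2) by (simp add: complex_eq_iff)
  have te: "t * (c + a) = s * (e + b)" using Ze ReZ(1) by (simp add: algebra_simps)
  moreover have "0 < t * (c + a)" using pos L by simp
  ultimately show "0 < e + b" using pos by (simp add: zero_less_mult_iff)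
  have "h = s * d1 + t * (d1 - d0)" using h13 tx by (simp add: algebra_simps)
  also have "\<dots> = s * d1 + C * (t * (c + a))" using inc by simp
  finally show "h = s * (d1 + C * (e + b))" unfolding te by (simp add: algebra_simps)
qed

section \<open>Phases and cube membership by residues\<close>

lemma phase_add: "zphase (u + x) = zphase u * zphase x" "yphase (u + x) = yphase u * yphase x"
  by (simp_all add: zphase_def yphase_def cis_mult algebra_simps)

lemma cis_mod:
  assumes "m \<noteq> 0"
  shows "cis (2 * pi / of_int m * of_int n) = cis (2 * pi / of_int m * of_int (n mod m))"
proof -
  have "real_of_int n = of_int m * of_int (n div m) + of_int (n mod m)"
    by (metis mult_div_mod_eq of_int_add of_int_mult)
  then have "2 * pi / of_int m * real_of_int n = 2 * pi * of_int (n div m) + 2 * pi / of_int m * of_int (n mod m)"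
    using assms by (simp add: field_simps)
  then show ?thesis by (simp add: cis_mult[symmetric] cis_multiple_2pi)
qed

lemma zphase_mod:
  "x$3 mod 4 = 0 \<Longrightarrow> zphase x = 1" "x$3 mod 4 = 1 \<Longrightarrow> zphase x = \<i>"
  "x$3 mod 4 = 2 \<Longrightarrow> zphase x = -1" "x$3 mod 4 = 3 \<Longrightarrow> zphase x = - \<i>"
proof -
  have z: "zphase x = cis (pi/2 * of_int (x$3 mod 4))" using cis_mod[of 4 "x$3"] by (simp add: zphase_def)
  show "x$3 mod 4 = 0 \<Longrightarrow> zphase x = 1" "x$3 mod 4 = 1 \<Longrightarrow> zphase x = \<i>" "x$3 mod 4 = 2 \<Longrightarrow> zphase x = -1"
    unfolding z by simp_all
  assume "x$3 mod 4 = 3"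
  then have "zphase x = cis (pi/2) * cis pi" unfolding z cis_mult by (simp add: field_simps)
  then show "zphase x = - \<i>" by simp
qed

lemma Re_yphase_mod:
  assumes "m = (x$1 - x$2) mod 6"
  shows "Re (yphase x) = (if m = 0 then 1 else if m = 1 \<or> m = 5 then 1/2 else if m = 3 then -1 else -1/2)"
proof -
  have y: "Re (yphase x) = cos (pi/3 * of_int m)" 
    using arg_cong[OF cis_mod[of 6 "x$1 - x$2"], of Re] assms by (simp add: yphase_def)
  have "m \<in> {0, 1, 2, 3, 4, 5}" using assms by auto
  moreover have "cos (pi/3 * 2) = - 1/2" using cos_120 by (simp add: mult.commute)
  moreover have "cos (pi/3 * 4) = - 1/2" "cos (pi/3 * 5) = 1/2"
  proof -
    have "pi/3 * 4 = pi/3 + pi" "pi/3 * 5 = 2 * pi - pi/3" by simp_all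
    then show "cos (pi/3 * 4) = - 1/2" "cos (pi/3 * 5) = 1/2"
      by (metis cos_periodic_pi cos_60 minus_divide_left, metis cos_2pi_minus cos_60)
  qed
  ultimately show ?thesis unfolding y by (auto simp: cos_60)
qed

text \<open>Membership modulo \<open>Lambda\<close> becomes a finite list of keys; residue 5 is the
  -1 caused by direction 2.\<close>

lemma cube_class_iff:
  "vclass (u + x) \<in> vclass ` cube_face u UNIV \<longleftrightarrow> vkey x \<in>
    {(0,0,0), (1,0,1), (1,0,5), (1,1,0), (2,0,0), (2,1,1), (2,1,5), (3,1,0)}" (is "?l \<longleftrightarrow> ?r")
proof -
  have key: "vkey (u + x) = vkey (u + w) \<longleftrightarrow> vkey x = vkey w" for w
    by (auto simp: vkey_def coord_sum_add mod_eq_dvd_iff algebra_simps)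
  have w: "w \<in> cube_face u UNIV \<longleftrightarrow> (\<exists>a\<in>{0,1}. \<exists>b\<in>{0,1}. \<exists>c\<in>{0,1}. w = u + vector [a, b, c])" for w
    by (auto simp: cube_face_def vec_eq_iff forall_3)
  have "?l \<longleftrightarrow> (\<exists>a\<in>{0,1}. \<exists>b\<in>{0,1}. \<exists>c\<in>{0,1}. vclass (u + x) = vclass (u + vector [a, b, c]))"
    unfolding image_iff Bex_def[of "cube_face u UNIV"] w by blast
  also have "\<dots> \<longleftrightarrow> (\<exists>a\<in>{0,1}. \<exists>b\<in>{0,1}. \<exists>c\<in>{0,1}. vkey x = vkey (vector [a, b, c]))"
    unfolding vclass_eq_iff key ..
  also have "\<dots> \<longleftrightarrow> ?r" by (auto simp: vkey_def coord_sum_def)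
  finally show ?thesis .
qed

section \<open>Supporting hyperplanes\<close>

lemma functional_value:
  "g \<bullet> (\<nu> *\<^sub>R cvec (zphase (u + x) * (e * \<xi>)) (yphase (u + x) * of_real \<sigma>) d) =
    \<nu> * (Re (cnj (zc g) * e * zphase u * (zphase x * \<xi>)) + Re (of_real \<sigma> * cnj (yc g) * yphase u * yphase x) + g$5 * d)"
proof -
  have "cnj (zc g) * (zphase (u + x) * (e * \<xi>)) = cnj (zc g) * e * zphase u * (zphase x * \<xi>)"
    "cnj (yc g) * (yphase (u + x) * of_real \<sigma>) = of_real \<sigma> * cnj (yc g) * yphase u * yphase x"
    by (simp_all add: phase_add mult_ac)
  then show ?thesis by (simp only: inner_scaleR_right inner_cvec)
qed

text \<open>Only signs of functionals matter, so the positive factor is left existential.\<close>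

locale layered_points =
  fixes p :: "int^3 \<Rightarrow> real^5" and k :: nat and e :: complex and A d :: "nat \<Rightarrow> real" and \<sigma> :: real
  assumes form: "\<And>v l. coord_sum v = int l \<Longrightarrow> l \<le> k \<Longrightarrow>
    \<exists>\<nu>>0. p v = \<nu> *\<^sub>R cvec (zphase v * (e * Complex (A (l + 1)) (- A l))) (yphase v * of_real \<sigma>) (d l)"
begin

text \<open>Coefficients of \<open>g\<close> as seen from \<open>u\<close>: absorbing the phases of
  \<open>u\<close> reduces every cube to one based at the origin, apart from its layer.\<close>

definition zval :: "real^5 \<Rightarrow> int^3 \<Rightarrow> complex" where "zval g u = cnj (zc g) * e * zphase u"

definition yval :: "real^5 \<Rightarrow> int^3 \<Rightarrow> complex" where "yval g u = of_real \<sigma> * cnj (yc g) * yphase u"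

definition fval :: "real^5 \<Rightarrow> int^3 \<Rightarrow> int^3 \<Rightarrow> nat \<Rightarrow> real" where
  "fval g u x l = Re (zval g u * (zphase x * Complex (A (l + 1)) (- A l))) + Re (yval g u * yphase x) + g$5 * d l"

lemma inner_sign:
  assumes "coord_sum (u + x) = int l" "l \<le> k"
  shows "\<exists>\<nu>>0. g \<bullet> p (u + x) = \<nu> * fval g u x l"
proof -
  obtain \<nu> where \<nu>: "0 < \<nu>"
    "p (u + x) = \<nu> *\<^sub>R cvec (zphase (u + x) * (e * Complex (A (l + 1)) (- A l))) (yphase (u + x) * of_real \<sigma>) (d l)"
    using form[OF assms] by blast
  have "g \<bullet> p (u + x) = \<nu> * fval g u x l"
    unfolding \<nu>(2) functional_value fval_def zval_def yval_def ..
  then show ?thesis using \<nu>(1) by blast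
qed

lemma inner_iff:
  assumes "coord_sum (u + x) = int l" "l \<le> k"
  shows "g \<bullet> p (u + x) = 0 \<longleftrightarrow> fval g u x l = 0" "g \<bullet> p (u + x) \<le> 0 \<longleftrightarrow> fval g u x l \<le> 0"
    "g \<bullet> p (u + x) < 0 \<longleftrightarrow> fval g u x l < 0"
  using inner_sign[OF assms, of g] by (auto simp: mult_le_0_iff mult_less_0_iff)

lemma zphase_vector: "zphase (vector [a, b, 0]) = 1" "zphase (vector [a, b, 1]) = \<i>"
  "zphase (vector [a, b, 2]) = -1" "zphase (vector [a, b, 3]) = - \<i>"
  using zphase_mod[of "vector [a, b, 0]"] zphase_mod[of "vector [a, b, 1]"]
    zphase_mod[of "vector [a, b, 2]"] zphase_mod[of "vector [a, b, 3]"] by auto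

lemma yphase_vector: "yphase (vector [a, a, c]) = 1" "yphase (vector [1, 0, c]) = cis (pi/3)"
  "yphase (vector [0, 1, c]) = cnj (cis (pi/3))" "yphase (vector [1, -1, c]) = cis (2 * pi/3)"
  by (simp_all add: yphase_def cis_cnj mult.commute)

lemma fval_vector:
  defines "G g u \<equiv> Re (zval g u)" and "J g u \<equiv> Im (zval g u)" and "H g u \<equiv> Re (yval g u)"
  shows "fval g u (vector [a, a, 0]) l = G g u * A (l + 1) + J g u * A l + H g u + g$5 * d l"
    "fval g u (vector [a, a, 1]) l = G g u * A l - J g u * A (l + 1) + H g u + g$5 * d l"
    "fval g u (vector [a, a, 2]) l = - (G g u * A (l + 1) + J g u * A l) + H g u + g$5 * d l"
    "fval g u (vector [a, a, 3]) l = - (G g u * A l - J g u * A (l + 1)) + H g u + g$5 * d l"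
    "fval g u (vector [1, 0, 0]) l = G g u * A (l + 1) + J g u * A l + H g u / 2 - Im (yval g u) * (sqrt 3 / 2) + g$5 * d l"
    "fval g u (vector [0, 1, 0]) l = G g u * A (l + 1) + J g u * A l + H g u / 2 + Im (yval g u) * (sqrt 3 / 2) + g$5 * d l"
    "fval g u (vector [1, -1, 0]) l = G g u * A (l + 1) + J g u * A l - H g u / 2 - Im (yval g u) * (sqrt 3 / 2) + g$5 * d l"
  using cos_120 sin_120
  by (simp_all add: fval_def zphase_vector yphase_vector G_def J_def H_def cos_60 sin_60 algebra_simps)

lemma cube_equations:
  assumes u: "coord_sum u = int b" "b + 3 \<le> k"
    and g: "\<And>v. v \<in> cube_face u UNIV \<Longrightarrow> g \<bullet> p v = 0"
  defines "G \<equiv> Re (zval g u)" and "J \<equiv> Im (zval g u)" and "H \<equiv> Re (yval g u)"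
  shows "G * A (b + 1) + J * A b + H + g$5 * d b = 0"
    "G * A (b + 1) - J * A (b + 2) + H + g$5 * d (b + 1) = 0"
    "G * A (b + 3) + J * A (b + 2) + H + g$5 * d (b + 2) = 0"
    "G * A (b + 2) + J * A (b + 1) + H / 2 + g$5 * d (b + 1) = 0"
    "G * A (b + 3) - J * A (b + 4) + H + g$5 * d (b + 3) = 0"
    "Im (yval g u) = 0"
proof -
  have f0: "fval g u x l = 0" if x: "\<forall>i. x $ i = 0 \<or> x $ i = 1" "coord_sum x = int l - int b" "l \<le> b + 3" for x l
  proof -
    have "u + x \<in> cube_face u UNIV" using x(1) by (auto simp: cube_face_def)
    then have "g \<bullet> p (u + x) = 0" by (rule g)
    then show ?thesis using inner_iff(1)[of u x l g] x u by (simp add: coord_sum_add)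
  qed
  note fv = fval_vector[of g u, folded G_def J_def H_def]
  show "G * A (b + 1) + J * A b + H + g$5 * d b = 0"
    using f0[of "vector [0, 0, 0]" b] fv(1)[of 0] by (simp add: forall_3 coord_sum_def)
  show "G * A (b + 1) - J * A (b + 2) + H + g$5 * d (b + 1) = 0"
    using f0[of "vector [0, 0, 1]" "b + 1"] fv(2)[of 0 "b + 1"] by (simp add: forall_3 coord_sum_def)
  show "G * A (b + 3) + J * A (b + 2) + H + g$5 * d (b + 2) = 0"
    using f0[of "vector [1, 1, 0]" "b + 2"] fv(1)[of 1 "b + 2"] by (simp add: forall_3 coord_sum_def eval_nat_numeral)
  show "G * A (b + 3) - J * A (b + 4) + H + g$5 * d (b + 3) = 0"
    using f0[of "vector [1, 1, 1]" "b + 3"] fv(2)[of 1 "b + 3"] by (simp add: forall_3 coord_sum_def eval_nat_numeral)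
  have 1: "G * A (b + 2) + J * A (b + 1) + H / 2 - Im (yval g u) * (sqrt 3 / 2) + g$5 * d (b + 1) = 0"
    using f0[of "vector [1, 0, 0]" "b + 1"] fv(5)[of "b + 1"] by (simp add: forall_3 coord_sum_def)
  have 2: "G * A (b + 2) + J * A (b + 1) + H / 2 + Im (yval g u) * (sqrt 3 / 2) + g$5 * d (b + 1) = 0"
    using f0[of "vector [0, 1, 0]" "b + 1"] fv(6)[of "b + 1"] by (simp add: forall_3 coord_sum_def)
  \<comment> \<open>The vertices in directions 1 and 2 differ only in the sign of this term.\<close>
  have "Im (yval g u) * (sqrt 3 / 2) = 0" using 1 2 by linarith
  then show "Im (yval g u) = 0" by simp
  then show "G * A (b + 2) + J * A (b + 1) + H / 2 + g$5 * d (b + 1) = 0" using 1 by simp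
qed

text \<open>For the first four claims the test vertex shares layer and \<open>yphase\<close> with a
  cube vertex but has the opposite \<open>zphase\<close>, so the difference isolates the part of
  \<open>zval\<close>. For \<open>H\<close> the test vertex turns \<open>yphase\<close> by a third
  of a circle instead.\<close>

lemma cube_inequalities:
  assumes u: "coord_sum u = int b" "b + 3 \<le> k"
    and g: "\<And>v. v \<in> cube_face u UNIV \<Longrightarrow> g \<bullet> p v = 0"
    and neg: "\<And>v. 0 \<le> coord_sum v \<Longrightarrow> coord_sum v \<le> int k \<Longrightarrow> vclass v \<notin> vclass ` cube_face u UNIV \<Longrightarrow> g \<bullet> p v < 0"
  defines "G \<equiv> Re (zval g u)" and "J \<equiv> Im (zval g u)" and "H \<equiv> Re (yval g u)"
  shows "0 < G * A (b + 1) + J * A b" "0 < G * A (b + 3) + J * A (b + 2)"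
    "0 < G * A (b + 1) - J * A (b + 2)" "0 < G * A (b + 3) - J * A (b + 4)" "0 < H"
proof -
  have f0: "fval g u x l < 0" if x: "vkey x \<notin> {(0,0,0), (1,0,1), (1,0,5), (1,1,0), (2,0,0), (2,1,1), (2,1,5), (3,1,0)}"
      "coord_sum x = int l - int b" "l \<le> b + 3" for x l
  proof -
    have "g \<bullet> p (u + x) < 0" using x u by (intro neg) (simp_all add: cube_class_iff coord_sum_add)
    then show ?thesis using inner_iff(3)[of u x l g] x u by (simp add: coord_sum_add)
  qed
  note fv = fval_vector[of g u, folded G_def J_def H_def]
  note eq = cube_equations[OF u g, folded G_def J_def H_def]
  have "fval g u (vector [-1, -1, 2]) b < 0" by (rule f0) (simp_all add: vkey_def coord_sum_def)
  then show "0 < G * A (b + 1) + J * A b" using eq(1) fv(3)[of "-1" b] by simp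
  have "fval g u (vector [0, 0, 2]) (b + 2) < 0" by (rule f0) (simp_all add: vkey_def coord_sum_def)
  then show "0 < G * A (b + 3) + J * A (b + 2)" using eq(3) fv(3)[of 0 "b + 2"] by (simp add: eval_nat_numeral)
  have "fval g u (vector [-1, -1, 3]) (b + 1) < 0" by (rule f0) (simp_all add: vkey_def coord_sum_def)
  then show "0 < G * A (b + 1) - J * A (b + 2)" using eq(2) fv(4)[of "-1" "b + 1"] by simp
  have "fval g u (vector [0, 0, 3]) (b + 3) < 0" by (rule f0) (simp_all add: vkey_def coord_sum_def)
  then show "0 < G * A (b + 3) - J * A (b + 4)" using eq(5) fv(4)[of 0 "b + 3"] by (simp add: eval_nat_numeral)
  have "fval g u (vector [1, -1, 0]) b < 0" by (rule f0) (simp_all add: vkey_def coord_sum_def)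
  then show "0 < H" using eq(1,6) fv(7)[of b] by simp
qed

end

text \<open>All cube vertices have residue 0 or 1, where \<open>value_0\<close> and
  \<open>value_1\<close> locate the zeros; for residues 2 and 3 \<open>value_23\<close> is
  strict.\<close>

lemma (in layer_seq) cube_sign:
  assumes b: "b + 4 \<le> N" and l: "l + 1 \<le> N" and M: "seq_disc \<theta> A b < 0" and x: "coord_sum x = int l - int b"
  defines "X \<equiv> Re (Complex (- seq_mass A b) (seq_gap A b) * (zphase x * Complex (A (l + 1)) (- A l)))
      + 4 * seq_disc \<theta> A b * Re (yphase x) + seq_gap A b * seq_height \<theta> A l"
  shows "0 \<le> X"
    and "X = 0 \<longleftrightarrow> vkey x \<in> {(0,0,0), (1,0,1), (1,0,5), (1,1,0), (2,0,0), (2,1,1), (2,1,5), (3,1,0)}" (is "_ \<longleftrightarrow> ?in")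
proof -
  define m c where "m = (x$1 - x$2) mod 6" and "c = Re (yphase x)"
  have c: "c = (if m = 0 then 1 else if m = 1 \<or> m = 5 then 1/2 else if m = 3 then -1 else -1/2)"
    unfolding c_def by (rule Re_yphase_mod) (simp add: m_def)
  have m: "m \<in> {0, 1, 2, 3, 4, 5}" by (auto simp: m_def)
  have c1: "c \<le> 1" "odd m \<Longrightarrow> c \<le> 1/2" "c = 1 \<longleftrightarrow> m = 0" "c = 1/2 \<longleftrightarrow> m = 1 \<or> m = 5"
    using m unfolding c by auto
  \<comment> \<open>The parity of the coordinate sum ties the parities of \<open>x$3\<close> and
    \<open>m\<close>; this limits \<open>c\<close> to 1/2 in half of the cases.\<close>
  have par: "even (l + b) \<longleftrightarrow> (even (x$3 mod 4) \<longleftrightarrow> even m)"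
  proof -
    have "even (l + b) \<longleftrightarrow> even (int l - int b)" by simp
    also have "\<dots> \<longleftrightarrow> even (x$1 + x$2 + x$3)" using x by (simp add: coord_sum_def)
    also have "\<dots> \<longleftrightarrow> (even (x$3 mod 4) \<longleftrightarrow> even m)" unfolding m_def by presburger
    finally show ?thesis .
  qed
  have key: "?in \<longleftrightarrow> (coord_sum x, x$3 mod 4, m) \<in> {(0,0,0), (1,0,1), (1,0,5), (1,1,0), (2,0,0), (2,1,1), (2,1,5), (3,1,0)}"
    by (simp add: vkey_def m_def)
  have lb: "coord_sum x = 0 \<longleftrightarrow> l = b" "coord_sum x = 1 \<longleftrightarrow> l = b + 1" "coord_sum x = 2 \<longleftrightarrow> l = b + 2"
    "coord_sum x = 3 \<longleftrightarrow> l = b + 3" using x by auto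
  have r: "x$3 mod 4 = 0 \<or> x$3 mod 4 = 1 \<or> x$3 mod 4 = 2 \<or> x$3 mod 4 = 3" by auto
  have "0 \<le> X \<and> (X = 0 \<longleftrightarrow> ?in)"
    using r
  proof (elim disjE)
    assume r: "x$3 mod 4 = 0"
    have X: "X = seq_gap A b * seq_height \<theta> A l + 4 * seq_disc \<theta> A b * c
      - seq_mass A b * A (l + 1) + seq_gap A b * A l"
      unfolding X_def zphase_mod(1)[OF r] c_def by (simp add: algebra_simps)
    have c': "c \<le> (if even (l + b) then 1 else 1/2)" using c1 par r by auto
    have b3: "b + 3 \<le> N" using b by simp
    show ?thesis using value_0[OF b3 l M c', folded X] unfolding key using lb c1 r by auto
  next
    assume r: "x$3 mod 4 = 1"
    have X: "X = seq_gap A b * seq_height \<theta> A l + 4 * seq_disc \<theta> A b * c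
      - seq_mass A b * A l - seq_gap A b * A (l + 1)"
      unfolding X_def zphase_mod(2)[OF r] c_def by (simp add: algebra_simps)
    have c': "c \<le> (if even (l + b) then 1/2 else 1)" using c1 par r by auto
    show ?thesis using value_1[OF b l M c', folded X] unfolding key using lb c1 r by auto
  next
    assume r: "x$3 mod 4 = 2"
    have X: "X = seq_gap A b * seq_height \<theta> A l + 4 * seq_disc \<theta> A b * c
      + seq_mass A b * A (l + 1) - seq_gap A b * A l"
      unfolding X_def zphase_mod(3)[OF r] c_def by (simp add: algebra_simps)
    have c': "c \<le> (if even (l + b) then 1 else 1/2)" using c1 par r by auto
    show ?thesis using value_23(1)[OF b l M c', folded X] unfolding key using r by auto
  next
    assume r: "x$3 mod 4 = 3"
    have X: "X = seq_gap A b * seq_height \<theta> A l + 4 * seq_disc \<theta> A b * c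
      + seq_mass A b * A l + seq_gap A b * A (l + 1)"
      unfolding X_def zphase_mod(4)[OF r] c_def by (simp add: algebra_simps)
    have c': "c \<le> (if even (l + b) then 1/2 else 1)" using c1 par r by auto
    show ?thesis using value_23(2)[OF b l M c', folded X] unfolding key using r by auto
  qed
  then show "0 \<le> X" "X = 0 \<longleftrightarrow> ?in" by auto
qed

lemma (in cct) convex_of_layered_points:
  assumes k: "3 \<le> k" and A: "layer_seq \<theta> A (k + 1)" and C: "C \<noteq> 0" and e: "e \<noteq> 0" and \<sigma>: "\<sigma> \<in> {1, -1}"
    and M: "b0 + 3 \<le> k" "seq_disc \<theta> A b0 < 0"
    and form: "\<And>v l. coord_sum v = int l \<Longrightarrow> l \<le> k \<Longrightarrow> \<exists>\<nu>>0. vpt \<phi> v =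
      \<nu> *\<^sub>R cvec (zphase v * (e * Complex (A (l + 1)) (- A l))) (yphase v * of_real \<sigma>) (C * seq_height \<theta> A l)"
  shows "in_convex_position T"
proof -
  interpret layer_seq \<theta> A "k + 1" by (rule A)
  interpret layered_points "vpt \<phi>" k e A "\<lambda>l. C * seq_height \<theta> A l" \<sigma> by standard (rule form)
  have Ms: "seq_disc \<theta> A b < 0" if "b + 3 \<le> k" for b
    using disc_sign[of b0 b] M that by simp
  have \<sigma>2: "of_real \<sigma> * of_real \<sigma> = (1 :: complex)" using \<sigma> by auto
  have y1: "cnj (yphase u) * yphase u = 1" for u by (simp add: yphase_def cis_cnj cis_mult)
  \<comment> \<open>The conjugate and the divisor undo the factors in \<open>zval\<close>, and
    \<open>\<sigma>\<close> and \<open>yphase u\<close> those in \<open>yval\<close>. The minus sign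
    turns the nonnegative values of \<open>cube_sign\<close> into the convention of
    \<open>in_convex_position\<close>.\<close>
  define n where "n u = (let b = nat (coord_sum u) in
    - cvec (cnj (Complex (- seq_mass A b) (seq_gap A b) / (e * zphase u)))
        (of_real (\<sigma> * (4 * seq_disc \<theta> A b)) * yphase u) (seq_gap A b / C))" for u
  have minus: "zc (- x) = - zc x" "yc (- x) = - yc x" for x by (simp_all add: zc_def yc_def complex_eq_iff)
  have nv: "zval (n u) u = - Complex (- seq_mass A b) (seq_gap A b)" "yval (n u) u = - of_real (4 * seq_disc \<theta> A b)"
    "n u $ 5 = - (seq_gap A b / C)" if "coord_sum u = int b" for u b
  proof -
    show "zval (n u) u = - Complex (- seq_mass A b) (seq_gap A b)"
      using that e by (simp add: zval_def n_def minus Let_def)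
    have "yval (n u) u = - (of_real \<sigma> * of_real \<sigma>) * of_real (4 * seq_disc \<theta> A b) * (cnj (yphase u) * yphase u)"
      using that by (simp add: yval_def n_def minus Let_def)
    then show "yval (n u) u = - of_real (4 * seq_disc \<theta> A b)" unfolding \<sigma>2 y1 by simp
    show "n u $ 5 = - (seq_gap A b / C)" using that by (simp add: n_def Let_def)
  qed
  have fn: "fval (n u) u x l = - (Re (Complex (- seq_mass A b) (seq_gap A b) * (zphase x * Complex (A (l + 1)) (- A l)))
      + 4 * seq_disc \<theta> A b * Re (yphase x) + seq_gap A b * seq_height \<theta> A l)" if "coord_sum u = int b" for u x l b
    unfolding fval_def nv[OF that] using C by simp
  show ?thesis
  proof (rule convex_position_criterion[OF k, of n])
    fix u assume u: "0 \<le> coord_sum u" "coord_sum u + 3 \<le> int k"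
    define b where "b = nat (coord_sum u)"
    have b: "coord_sum u = int b" "b + 3 \<le> k" using u by (auto simp: b_def)
    have D: "seq_gap A b \<noteq> 0" using gap_nonzero[OF Ms[OF b(2)]] .
    then show "n u \<noteq> 0" using nv(3)[OF b(1)] C by auto
    show "n u \<bullet> vpt \<phi> v \<le> 0" "n u \<bullet> vpt \<phi> v = 0 \<longleftrightarrow> vclass v \<in> vclass ` cube_face u UNIV"
      if v: "0 \<le> coord_sum v" "coord_sum v \<le> int k" for v
    proof -
      define x l where "x = v - u" and "l = nat (coord_sum v)"
      have ux: "u + x = v" by (simp add: x_def)
      have l: "coord_sum (u + x) = int l" "l \<le> k" "coord_sum x = int l - int b"
        using v b by (auto simp: l_def x_def coord_sum_diff)
      define X where "X = Re (Complex (- seq_mass A b) (seq_gap A b) * (zphase x * Complex (A (l + 1)) (- A l)))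
        + 4 * seq_disc \<theta> A b * Re (yphase x) + seq_gap A b * seq_height \<theta> A l"
      have "b + 4 \<le> k + 1" "l + 1 \<le> k + 1" using b l by auto
      note cs = cube_sign[OF this Ms[OF b(2)] l(3), folded X_def]
      note ii = inner_iff[OF l(1,2), of "n u", unfolded fn[OF b(1)] X_def[symmetric], unfolded ux]
      show "n u \<bullet> vpt \<phi> v \<le> 0" using ii(2) cs(1) by simp
      show "n u \<bullet> vpt \<phi> v = 0 \<longleftrightarrow> vclass v \<in> vclass ` cube_face u UNIV"
        unfolding ii(1) neg_equal_0_iff_equal cs(2) cube_class_iff[of u x, unfolded ux] ..
    qed
    fix g assume g: "\<And>v. v \<in> cube_face u UNIV \<Longrightarrow> g \<bullet> vpt \<phi> v = 0"
    note eq = cube_equations[OF b g]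
    have b3: "b + 3 \<le> k + 1" using b by simp
    note un = cube_functional_unique[OF b3 D eq(1-4)]
    define c where "c = - (g$5 * C / seq_gap A b)"
    have "zval g u = of_real c * zval (n u) u"
      unfolding nv(1)[OF b(1)] using un(1,2) D by (simp add: complex_eq_iff c_def)
    then have "cnj (zc g) = of_real c * cnj (zc (n u))" using e by (simp add: zval_def mult.assoc[symmetric])
    then have z: "zc g = of_real c * zc (n u)" by (metis complex_cnj_cnj complex_cnj_complex_of_real complex_cnj_mult)
    have "yval g u = of_real c * yval (n u) u"
      unfolding nv(2)[OF b(1)] using un(3) eq(6) D by (simp add: complex_eq_iff c_def)
    then have "of_real \<sigma> * (cnj (yc g) * yphase u) = of_real \<sigma> * (of_real c * cnj (yc (n u)) * yphase u)"
      by (simp add: yval_def mult_ac)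
    then have "cnj (yc g) = of_real c * cnj (yc (n u))" using \<sigma> by auto
    then have y: "yc g = of_real c * yc (n u)" by (metis complex_cnj_cnj complex_cnj_complex_of_real complex_cnj_mult)
    have "g$5 = c * n u $ 5" unfolding nv(3)[OF b(1)] using D C by (simp add: c_def)
    then have "g = c *\<^sub>R n u" using z y by (simp add: coords_eq_iff)
    then show "\<exists>c. g = c *\<^sub>R n u" by blast
  qed
qed

section \<open>The layer added by an elementary extension\<close>

lemma solve_corner:
  assumes eq: "x *\<^sub>R (\<nu>0 *\<^sub>R cvec (q * \<alpha>0) (r * \<eta>0) d0) + y *\<^sub>R P
      = s *\<^sub>R (\<nu>1 *\<^sub>R cvec (q * \<alpha>1) (r * \<eta>1) d1) + t *\<^sub>R (\<nu>1 *\<^sub>R cvec (q * \<alpha>2) (r * \<eta>2) d1)"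
    and nz: "y \<noteq> 0" "q \<noteq> 0" "r \<noteq> 0"
  shows "zc P / q = of_real (s * \<nu>1 / y) * \<alpha>1 + of_real (t * \<nu>1 / y) * \<alpha>2 - of_real (x * \<nu>0 / y) * \<alpha>0"
    "yc P / r = of_real (s * \<nu>1 / y) * \<eta>1 + of_real (t * \<nu>1 / y) * \<eta>2 - of_real (x * \<nu>0 / y) * \<eta>0"
    "P$5 = s * \<nu>1 / y * d1 + t * \<nu>1 / y * d1 - x * \<nu>0 / y * d0"
proof -
  note e = eq[unfolded coords_eq_iff, simplified]
  have "zc P = (of_real (s * \<nu>1) * (q * \<alpha>1) + of_real (t * \<nu>1) * (q * \<alpha>2) - of_real (x * \<nu>0) * (q * \<alpha>0)) / of_real y"
    using e nz by (simp add: eq_divide_eq algebra_simps)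
  then show "zc P / q = of_real (s * \<nu>1 / y) * \<alpha>1 + of_real (t * \<nu>1 / y) * \<alpha>2 - of_real (x * \<nu>0 / y) * \<alpha>0"
    using nz(2) by (simp add: add_divide_distrib diff_divide_distrib mult.assoc)
  have "yc P = (of_real (s * \<nu>1) * (r * \<eta>1) + of_real (t * \<nu>1) * (r * \<eta>2) - of_real (x * \<nu>0) * (r * \<eta>0)) / of_real y"
    using e nz by (simp add: eq_divide_eq algebra_simps)
  then show "yc P / r = of_real (s * \<nu>1 / y) * \<eta>1 + of_real (t * \<nu>1 / y) * \<eta>2 - of_real (x * \<nu>0 / y) * \<eta>0"
    using nz(3) by (simp add: add_divide_distrib diff_divide_distrib mult.assoc)
  have "P$5 = (s * \<nu>1 * d1 + t * \<nu>1 * d1 - x * \<nu>0 * d0) / y"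
    using e nz by (simp add: eq_divide_eq algebra_simps)
  then show "P$5 = s * \<nu>1 / y * d1 + t * \<nu>1 / y * d1 - x * \<nu>0 / y * d0"
    by (simp add: add_divide_distrib diff_divide_distrib)
qed

lemma phase_minus_axis:
  "zphase (v - axis 3 1) = zphase v * - \<i>" "zphase (v - axis 1 1) = zphase v" "zphase (v - axis 2 1) = zphase v"
  "yphase (v - axis 3 1) = yphase v" "yphase (v - axis 1 1) = yphase v * cnj (cis (pi/3))"
  "yphase (v - axis 2 1) = yphase v * cis (pi/3)"
proof -
  have "zphase v = \<i> * zphase (v - axis 3 1)" using phase_axis(1)[of "v - axis 3 1"] by simp
  then show "zphase (v - axis 3 1) = zphase v * - \<i>" by (simp add: mult_ac)
  show "zphase (v - axis 1 1) = zphase v" "zphase (v - axis 2 1) = zphase v" "yphase (v - axis 3 1) = yphase v"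
    using phase_axis(2)[of "v - axis 1 1"] phase_axis(3)[of "v - axis 2 1"] phase_axis(4)[of "v - axis 3 1"] by simp_all
  have a: "yphase v = cis (pi/3) * yphase (v - axis 1 1)" and b: "yphase v = cnj (cis (pi/3)) * yphase (v - axis 2 1)"
    using phase_axis(5)[of "v - axis 1 1"] phase_axis(6)[of "v - axis 2 1"] by simp_all
  have "yphase v * cnj (cis (pi/3)) = cis (pi/3) * cnj (cis (pi/3)) * yphase (v - axis 1 1)"
    unfolding a by (simp only: mult_ac)
  then show "yphase (v - axis 1 1) = yphase v * cnj (cis (pi/3))" unfolding cis_pi_third_cnj by simp
  have "yphase v * cis (pi/3) = cis (pi/3) * cnj (cis (pi/3)) * yphase (v - axis 2 1)"
    unfolding b by (simp only: mult_ac)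
  then show "yphase (v - axis 2 1) = yphase v * cis (pi/3)" unfolding cis_pi_third_cnj by simp
qed

text \<open>The vertices below \<open>v\<close> lie in layers \<open>K\<close> and
  \<open>K - 1\<close>, where the form is known; solving the three squares with top corner
  \<open>v\<close> feeds \<open>next_layer\<close>.\<close>

lemma (in cct) top_layer_form:
  assumes k: "k = K + 1" "3 \<le> K" and A: "layer_seq \<theta> A (K + 1)" and e: "e \<noteq> 0" and \<sigma>: "\<sigma> \<in> {1, -1}"
    and M: "b + 3 \<le> K" "seq_disc \<theta> A b < 0" and \<nu>: "\<And>l. l \<le> K \<Longrightarrow> 0 < \<nu> l"
    and form: "\<And>v l. coord_sum v = int l \<Longrightarrow> l \<le> K \<Longrightarrow> vpt \<phi> v =
      \<nu> l *\<^sub>R cvec (zphase v * (e * Complex (A (l + 1)) (- A l))) (yphase v * of_real \<sigma>) (C * seq_height \<theta> A l)"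
    and v: "coord_sum v = int K + 1"
  defines "a \<equiv> (2 * A (K + 1) - (1 - \<theta>) * A K) / \<theta>"
  shows "\<exists>\<mu>>0. vpt \<phi> v = \<mu> *\<^sub>R cvec (zphase v * (e * Complex a (- A (K + 1)))) (yphase v * of_real \<sigma>)
      (C * (seq_height \<theta> A K + a + A K))"
    and "0 < a + A K"
proof -
  interpret layer_seq \<theta> A "K + 1" by (rule A)
  obtain L where L: "K = L + 1" using k by (cases K) auto
  define h0 h1 where "h0 = C * seq_height \<theta> A L" and "h1 = C * seq_height \<theta> A K"
  define q r where "q = zphase v * e" and "r = yphase v * of_real \<sigma>"
  have qr: "q \<noteq> 0" "r \<noteq> 0" using e \<sigma> by (auto simp: q_def r_def)
  have Kform: "vpt \<phi> w = \<nu> K *\<^sub>R cvec (zphase w * (e * Complex (A (K + 1)) (- A K))) (yphase w * of_real \<sigma>) h1"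
    if "coord_sum w = int K" for w using form[of w K] that by (simp add: h1_def)
  have Lform: "vpt \<phi> w = \<nu> L *\<^sub>R cvec (zphase w * (e * Complex (A K) (- A L))) (yphase w * of_real \<sigma>) h0"
    if "coord_sum w = int K - 1" for w using form[of w L] that L by (simp add: h0_def)
  have iC: "- \<i> * Complex x (- y) = Complex (- y) (- x)" for x y by (simp add: complex_eq_iff)
  define \<omega> where "\<omega> = cis (pi/3)"
  note pm = phase_minus_axis[of v, folded \<omega>_def]
  have sums: "coord_sum (v - axis i 1) = int K" "coord_sum (v - axis i 1 - axis j 1) = int K - 1" for i j
    using v by (simp_all add: coord_sum_diff)
  have eqz: "zphase v * - \<i> * (e * Complex x (- y)) = q * Complex (- y) (- x)" for x y
    unfolding iC[symmetric] by (simp add: q_def)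
  have eqz': "zphase v * (e * x) = q * x" for x by (simp add: q_def)
  have eqy: "yphase v * x * of_real \<sigma> = r * x" "yphase v * of_real \<sigma> = r * 1" for x by (simp_all add: r_def)
  have f3: "vpt \<phi> (v - axis 3 1) = \<nu> K *\<^sub>R cvec (q * Complex (- A K) (- A (K + 1))) (r * 1) h1"
    unfolding Kform[OF sums(1)] pm eqz eqy ..
  have f1: "vpt \<phi> (v - axis 1 1) = \<nu> K *\<^sub>R cvec (q * Complex (A (K + 1)) (- A K)) (r * cnj \<omega>) h1"
    unfolding Kform[OF sums(1)] pm eqz' eqy ..
  have f2: "vpt \<phi> (v - axis 2 1) = \<nu> K *\<^sub>R cvec (q * Complex (A (K + 1)) (- A K)) (r * \<omega>) h1"
    unfolding Kform[OF sums(1)] pm eqz' eqy ..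
  have g12: "vpt \<phi> (v - axis 1 1 - axis 2 1) = \<nu> L *\<^sub>R cvec (q * Complex (A K) (- A L)) (r * 1) h0"
  proof -
    have z: "zphase (v - axis 1 1 - axis 2 1) = zphase v" "yphase (v - axis 1 1 - axis 2 1) = yphase v"
      using phase_minus_axis(3,6)[of "v - axis 1 1"] pm(2,5) by (simp_all add: \<omega>_def mult.assoc)
    show ?thesis unfolding Lform[OF sums(2)] z eqz' eqy ..
  qed
  have g13: "vpt \<phi> (v - axis 1 1 - axis 3 1) = \<nu> L *\<^sub>R cvec (q * Complex (- A L) (- A K)) (r * cnj \<omega>) h0"
  proof -
    have z: "zphase (v - axis 1 1 - axis 3 1) = zphase v * - \<i>" "yphase (v - axis 1 1 - axis 3 1) = yphase v * cnj \<omega>"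
      using phase_minus_axis(1,4)[of "v - axis 1 1"] pm(2,5) by simp_all
    show ?thesis unfolding Lform[OF sums(2)] z eqz eqy ..
  qed
  have g23: "vpt \<phi> (v - axis 2 1 - axis 3 1) = \<nu> L *\<^sub>R cvec (q * Complex (- A L) (- A K)) (r * \<omega>) h0"
  proof -
    have z: "zphase (v - axis 2 1 - axis 3 1) = zphase v * - \<i>" "yphase (v - axis 2 1 - axis 3 1) = yphase v * \<omega>"
      using phase_minus_axis(1,4)[of "v - axis 2 1"] pm(3,6) by simp_all
    show ?thesis unfolding Lform[OF sums(2)] z eqz eqy ..
  qed
  have sq: "\<exists>x y s t. 0 < x \<and> 0 < y \<and> 0 < s \<and> 0 < t \<and> x *\<^sub>R vpt \<phi> (v - axis i 1 - axis j 1) + y *\<^sub>R vpt \<phi> v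
      = s *\<^sub>R vpt \<phi> (v - axis j 1) + t *\<^sub>R vpt \<phi> (v - axis i 1)" if ij: "i \<noteq> j" for i j
  proof -
    define u where "u = v - axis i 1 - axis j 1"
    have u: "0 \<le> coord_sum u" "coord_sum u + 2 \<le> int k" using v k by (simp_all add: u_def coord_sum_diff)
    have w: "u + axis i 1 + axis j 1 = v" "u + axis i 1 = v - axis j 1" "u + axis j 1 = v - axis i 1"
      by (simp_all add: u_def)
    obtain x y s t where "0 < x" "0 < y" "0 < s" "0 < t"
      "x *\<^sub>R vpt \<phi> u + y *\<^sub>R vpt \<phi> (u + axis i 1 + axis j 1) = s *\<^sub>R vpt \<phi> (u + axis i 1) + t *\<^sub>R vpt \<phi> (u + axis j 1)"
      using square_relation[OF ij u] .
    then have "0 < x \<and> 0 < y \<and> 0 < s \<and> 0 < t \<and> x *\<^sub>R vpt \<phi> (v - axis i 1 - axis j 1) + y *\<^sub>R vpt \<phi> v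
      = s *\<^sub>R vpt \<phi> (v - axis j 1) + t *\<^sub>R vpt \<phi> (v - axis i 1)" unfolding w unfolding u_def by simp
    then show ?thesis by (intro exI)
  qed
  have ne: "(1 :: 3) \<noteq> 3" "(2 :: 3) \<noteq> 3" "(1 :: 3) \<noteq> 2" by simp_all
  obtain x1 y1 s1 t1 where p1: "0 < x1" "0 < y1" "0 < s1" "0 < t1" and
    e1: "x1 *\<^sub>R vpt \<phi> (v - axis 1 1 - axis 3 1) + y1 *\<^sub>R vpt \<phi> v = s1 *\<^sub>R vpt \<phi> (v - axis 3 1) + t1 *\<^sub>R vpt \<phi> (v - axis 1 1)"
    using sq[OF ne(1)] by blast
  obtain x2 y2 s2 t2 where p2: "0 < x2" "0 < y2" "0 < s2" "0 < t2" and
    e2: "x2 *\<^sub>R vpt \<phi> (v - axis 2 1 - axis 3 1) + y2 *\<^sub>R vpt \<phi> v = s2 *\<^sub>R vpt \<phi> (v - axis 3 1) + t2 *\<^sub>R vpt \<phi> (v - axis 2 1)"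
    using sq[OF ne(2)] by blast
  obtain x3 y3 s3 t3 where p3: "0 < x3" "0 < y3" "0 < s3" "0 < t3" and
    e3: "x3 *\<^sub>R vpt \<phi> (v - axis 1 1 - axis 2 1) + y3 *\<^sub>R vpt \<phi> v = s3 *\<^sub>R vpt \<phi> (v - axis 2 1) + t3 *\<^sub>R vpt \<phi> (v - axis 1 1)"
    using sq[OF ne(3)] by blast
  note c1 = solve_corner[OF e1[unfolded g13 f3 f1] _ qr]
  note c2 = solve_corner[OF e2[unfolded g23 f3 f2] _ qr]
  note c3 = solve_corner[OF e3[unfolded g12 f2 f1] _ qr]
  have nuK: "0 < \<nu> K" "0 < \<nu> L" using \<nu> L by auto
  have rec': "\<theta> * A (K + 1) + (1 - \<theta>) * A L = 2 * A K" using rec[of L] L by simp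
  \<comment> \<open>The gap with index \<open>L - 1\<close> is \<open>A (K + 1) - A L\<close>; its
    nonvanishing is the nondegeneracy that \<open>next_layer\<close> asks for.\<close>
  have LK: "L - 1 + 3 = K + 1" "L - 1 + 1 = L" using L k by auto
  have nd: "A (K + 1) \<noteq> A L"
    using gap_nonzero[OF disc_sign[of b "L - 1"]] M L k unfolding seq_gap_def LK by simp
  have pos: "0 < A (K + 1) + A L" using step_pos[of L] L by simp
  have inc: "h1 - h0 = C * (A (K + 1) + A L)"
  proof -
    have "seq_height \<theta> A K - seq_height \<theta> A L = A (K + 1) + A L"
      using rec' by (simp add: seq_height_def L algebra_simps)
    then show ?thesis unfolding h0_def h1_def by (metis right_diff_distrib)
  qed
  have y: "y1 \<noteq> 0" "y2 \<noteq> 0" "y3 \<noteq> 0" using p1 p2 p3 by auto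
  have pp: "0 < s1 * \<nu> K / y1" "0 < t1 * \<nu> K / y1" "0 < x1 * \<nu> L / y1"
    "0 < s2 * \<nu> K / y2" "0 < t2 * \<nu> K / y2" "0 < x2 * \<nu> L / y2"
    "0 < s3 * \<nu> K / y3" "0 < t3 * \<nu> K / y3" "0 < x3 * \<nu> L / y3" using p1 p2 p3 nuK by auto
  note nl = next_layer[OF th rec' nd pos inc pp c1(1)[OF y(1)] _ c1(3)[OF y(1)] c2(1)[OF y(2)] _ c3(1)[OF y(3)],
      of "yc (vpt \<phi> v) / r", folded a_def]
  define \<mu> where "\<mu> = s1 * \<nu> K / y1"
  have Y: "yc (vpt \<phi> v) / r = of_real (s1 * \<nu> K / y1) + of_real (t1 * \<nu> K / y1) * cnj (cis (pi/3)) - of_real (x1 * \<nu> L / y1) * cnj (cis (pi/3))"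
    "yc (vpt \<phi> v) / r = of_real (s2 * \<nu> K / y2) + of_real (t2 * \<nu> K / y2) * cis (pi/3) - of_real (x2 * \<nu> L / y2) * cis (pi/3)"
    "yc (vpt \<phi> v) / r = of_real (s3 * \<nu> K / y3) * cis (pi/3) + of_real (t3 * \<nu> K / y3) * cnj (cis (pi/3)) - of_real (x3 * \<nu> L / y3)"
    using c1(2)[OF y(1)] c2(2)[OF y(2)] c3(2)[OF y(3)] unfolding \<omega>_def by (simp_all only: mult_1_right)
  note nl' = nl[OF Y, folded \<mu>_def]
  show "0 < a + A K" using nl'(5) .
  have "zc (vpt \<phi> v) = q * (of_real \<mu> * Complex a (- A (K + 1)))" using nl'(3) qr by (simp add: field_simps)
  moreover have "yc (vpt \<phi> v) = r * of_real \<mu>" using nl'(2) qr by (simp add: field_simps)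
  ultimately have "vpt \<phi> v = \<mu> *\<^sub>R cvec (zphase v * (e * Complex a (- A (K + 1)))) (yphase v * of_real \<sigma>)
      (C * (seq_height \<theta> A K + a + A K))"
    using nl'(4) by (simp add: coords_eq_iff q_def r_def h1_def algebra_simps)
  then show "\<exists>\<mu>>0. vpt \<phi> v = \<mu> *\<^sub>R cvec (zphase v * (e * Complex a (- A (K + 1)))) (yphase v * of_real \<sigma>)
      (C * (seq_height \<theta> A K + a + A K))" using nl'(1) by blast
qed

theorem theorem4p3:
  fixes k :: nat
    and T T' :: "(real^5) set set"
    and \<phi> \<phi>' :: "(int^3) set set \<Rightarrow> (real^5) set"
  assumes "k \<ge> 3"
    and "ideal_cct k T \<phi>"
    and "in_convex_position T"
    and "elementary_extension k T \<phi> T' \<phi>'"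
  shows "in_convex_position T'"
proof -
  have sym: "is_cct k T \<phi>" "induces k T \<phi> refl4 swap12"
    "induces k T \<phi> (r34 \<circ> r12) (\<lambda>v. v + vector [0, -1, 1])"
    using assms(2) unfolding ideal_cct_def symmetric_cct_def by auto
  have ext: "is_cct (k + 1) T' \<phi>'" "\<And>F. F \<in> torus_strip k \<Longrightarrow> \<phi>' F = \<phi> F"
    using assms(4) unfolding elementary_extension_def by auto
  have tv: "transversal_cct k ((\<lambda>P. eq_proj ` P) ` T) (\<lambda>F. eq_proj ` \<phi> F)"
    using assms(2) unfolding ideal_cct_def ideal_cct_S3_def by blast
  interpret t: cct k T \<phi> by standard (rule sym)
  interpret t': cct "k + 1" T' \<phi>' by standard (rule ext)
  have k2: "2 \<le> k" using assms(1) by simp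
  note nz = transversal_nonzero[OF k2 t.cct_axioms tv]
  obtain \<sigma> \<nu> \<zeta> d where \<sigma>: "\<sigma> \<in> {1, -1}" and \<nu>: "\<And>l. l \<le> k \<Longrightarrow> 0 < \<nu> l" and \<zeta>0: "\<And>l. l \<le> k \<Longrightarrow> \<zeta> l \<noteq> 0" and
    nform: "\<And>v. 0 \<le> coord_sum v \<Longrightarrow> coord_sum v \<le> int k \<Longrightarrow> vpt \<phi> v = \<nu> (nat (coord_sum v)) *\<^sub>R
      cvec (zphase v * \<zeta> (nat (coord_sum v))) (yphase v * of_real \<sigma>) (d (nat (coord_sum v)))" and
    turn: "\<And>l. l + 2 \<le> k \<Longrightarrow> \<exists>t>0. \<zeta> (l + 1) - \<i> * \<zeta> (l + 2) = of_real t * (\<zeta> l - \<i> * \<zeta> (l + 1)) \<and>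
      d (l + 2) - d (l + 1) = t * (d (l + 1) - d l)" and
    zrec: "\<And>l. l + 2 \<le> k \<Longrightarrow> \<exists>\<theta>. 0 < \<theta> \<and> \<theta> < 1 \<and>
      of_real (1 - \<theta>) * \<zeta> l + of_real \<theta> * \<zeta> (l + 2) = 2 * \<zeta> (l + 1) \<and>
      (1 - \<theta>) * d l + \<theta> * d (l + 2) = 2 * d (l + 1)"
    by (rule t.normal_form[OF assms(1) sym(2,3)]; (rule nz | rule that); assumption)
  obtain e A C where e: "e \<noteq> 0" and \<zeta>: "\<And>l. l \<le> k \<Longrightarrow> \<zeta> l = e * Complex (A (l + 1)) (- A l)" and
    pos: "\<And>l. l + 1 \<le> k \<Longrightarrow> 0 < A (l + 2) + A l" and
    inc: "\<And>l. l + 1 \<le> k \<Longrightarrow> d (l + 1) - d l = C * (A (l + 2) + A l)" and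
    rec: "\<And>l. l + 2 \<le> k \<Longrightarrow> \<exists>\<theta>. 0 < \<theta> \<and> \<theta> < 1 \<and> \<theta> * A (l + 2) + (1 - \<theta>) * A l = 2 * A (l + 1) \<and>
      \<theta> * A (l + 3) + (1 - \<theta>) * A (l + 1) = 2 * A (l + 2) \<and> (1 - \<theta>) * d l + \<theta> * d (l + 2) = 2 * d (l + 1)"
    by (rule spiral_form[OF k2, of \<zeta> d]; (rule \<zeta>0 | rule turn | rule zrec | rule that); assumption)
  have form: "vpt \<phi> v = \<nu> l *\<^sub>R cvec (zphase v * (e * Complex (A (l + 1)) (- A l))) (yphase v * of_real \<sigma>) (d l)"
    if "coord_sum v = int l" "l \<le> k" for v l
    using nform[of v] \<zeta>[of l] that by simp
  interpret lp: layered_points "vpt \<phi>" k e A d \<sigma>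
    by standard (use form \<nu> in blast)
  have "finite T" "T \<noteq> {}"
    using t.complex t.phi_in[OF empty_in_torus_strip] unfolding polytopal_complex_def by auto
  \<comment> \<open>Any facet will do: its hyperplane supplies the equations and strict inequalities
    from which \<open>C \<noteq> 0\<close> and the sign of the determinant are read off.\<close>
  then obtain P where P: "P \<in> complex_facets T"
    using finite_has_maximal[of T] unfolding complex_facets_def by blast
  obtain u where u: "0 \<le> coord_sum u" "coord_sum u + 3 \<le> int k" "P = \<phi> (vclass ` cube_face u UNIV)"
    "vclass ` cube_face u UNIV \<in> torus_strip k"
    using t.facet_is_cube[OF P assms(1)] .
  define b where "b = nat (coord_sum u)"
  have b: "coord_sum u = int b" "b + 3 \<le> k" using u by (auto simp: b_def)
  obtain g where g: "\<forall>x\<in>\<Union>T. g \<bullet> x \<le> 0" "\<forall>v\<in>sph_vertices P. g \<bullet> v = 0"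
    "\<forall>v\<in>complex_vertices T - sph_vertices P. g \<bullet> v \<noteq> 0"
    using assms(3) P unfolding in_convex_position_def by blast
  have vP: "sph_vertices P = {vpt \<phi> v |v. vclass v \<in> vclass ` cube_face u UNIV}"
    using t.vertices_phi[OF u(4)] u(3) by simp
  have g0: "g \<bullet> vpt \<phi> v = 0" if "v \<in> cube_face u UNIV" for v
    using g(2) that unfolding vP by blast
  have gneg: "g \<bullet> vpt \<phi> v < 0"
    if v: "0 \<le> coord_sum v" "coord_sum v \<le> int k" "vclass v \<notin> vclass ` cube_face u UNIV" for v
  proof -
    have "vpt \<phi> v \<notin> sph_vertices P"
    proof
      assume "vpt \<phi> v \<in> sph_vertices P"
      then obtain w where w: "vpt \<phi> v = vpt \<phi> w" "vclass w \<in> vclass ` cube_face u UNIV" unfolding vP by blast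
      then have "vclass v = vclass w" using t.vpt_eq_iff[OF v(1,2) torus_strip_range[OF u(4) w(2)]] by simp
      then show False using v(3) w(2) by simp
    qed
    moreover have "vpt \<phi> v \<in> complex_vertices T" using t.complex_vertices_eq v by blast
    ultimately have "g \<bullet> vpt \<phi> v \<noteq> 0" using g(3) by blast
    moreover have "vpt \<phi> v \<in> \<Union>T" using t.phi_in[OF torus_strip_singleton[OF v(1,2)]] t.phi_vertex[OF v(1,2)] by auto
    then have "g \<bullet> vpt \<phi> v \<le> 0" using g(1) by blast
    ultimately show ?thesis by simp
  qed
  note eq = lp.cube_equations[OF b g0]
  note ineq = lp.cube_inequalities[OF b g0 gneg]
  have C: "C \<noteq> 0"
  proof -
    obtain \<theta> where th: "\<theta> * A (b + 3) + (1 - \<theta>) * A (b + 1) = 2 * A (b + 2)" "(1 - \<theta>) * d b + \<theta> * d (b + 2) = 2 * d (b + 1)"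
      using rec[of b] b by auto
    have i: "d (b + 1) - d b = C * (A (b + 2) + A b)" "d (b + 2) - d (b + 1) = C * (A (b + 3) + A (b + 1))"
      "0 < A (b + 2) + A b" "0 < A (b + 3) + A (b + 1)"
      using inc[of b] inc[of "b + 1"] pos[of b] pos[of "b + 1"] b by (simp_all add: eval_nat_numeral)
    show ?thesis by (rule facet_nondegenerate[OF eq(1-3) i th ineq(5) ineq(1,2)])
  qed
  obtain \<theta> where seq: "layer_seq \<theta> A (k + 1)" and d: "\<And>l. l \<le> k \<Longrightarrow> d l = C * seq_height \<theta> A l"
    by (rule constant_ratio[OF k2 C, of A d]; (rule pos | rule inc | rule rec | rule that); assumption)
  interpret s: layer_seq \<theta> A "k + 1" by (rule seq)
  have M: "seq_disc \<theta> A b < 0"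
  proof -
    have dd: "d b = C * seq_height \<theta> A b" "d (b + 1) = C * seq_height \<theta> A (b + 1)" "d (b + 2) = C * seq_height \<theta> A (b + 2)"
      using d b by simp_all
    have "b + 4 \<le> k + 1" using b by simp
    then show ?thesis by (rule s.disc_negative[OF _ C eq(1-4)[unfolded dd] ineq(5) ineq(1-4)])
  qed
  have form': "vpt \<phi>' v = \<nu> l *\<^sub>R cvec (zphase v * (e * Complex (A (l + 1)) (- A l))) (yphase v * of_real \<sigma>) (C * seq_height \<theta> A l)"
    if v: "coord_sum v = int l" "l \<le> k" for v l
  proof -
    have "{vclass v} \<in> torus_strip k" using v by (intro torus_strip_singleton) auto
    then have "vpt \<phi>' v = vpt \<phi> v" using ext(2) by (simp add: vpt_def)
    then show ?thesis using form[OF v] d[OF v(2)] by simp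
  qed
  define a where "a = (2 * A (k + 1) - (1 - \<theta>) * A k) / \<theta>"
  have top: "\<exists>\<mu>>0. vpt \<phi>' v = \<mu> *\<^sub>R cvec (zphase v * (e * Complex a (- A (k + 1)))) (yphase v * of_real \<sigma>)
      (C * (seq_height \<theta> A k + a + A k))" "0 < a + A k" if "coord_sum v = int k + 1" for v
    using t'.top_layer_form[OF refl assms(1) seq e \<sigma> b(2) M \<nu> form' that, folded a_def] by blast+
  \<comment> \<open>Layer \<open>l\<close> uses the terms \<open>l\<close> and \<open>l + 1\<close>,
    so the new layer \<open>k + 1\<close> adds the single term with index
    \<open>k + 2\<close>.\<close>
  define B where "B = A(k + 2 := a)"
  have B: "B i = A i" if "i \<le> k + 1" for i using that by (simp add: B_def)
  have Bk: "B (k + 2) = a" by (simp add: B_def)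
  have seqB: "layer_seq \<theta> B (k + 1 + 1)"
  proof
    fix i assume i: "i + 2 \<le> k + 1 + 1"
    have "\<theta> * B (i + 2) + (1 - \<theta>) * B i = 2 * B (i + 1) \<and> 0 < B (i + 2) + B i"
    proof (cases "i = k")
      case True
      \<comment> \<open>Any label in the new layer is a witness; \<open>a\<close> does not depend on
        it.\<close>
      have "coord_sum (axis 1 (int k + 1)) = int k + 1" by simp
      then have "0 < a + A k" by (rule top(2))
      then show ?thesis using True B s.th Bk by (simp add: a_def)
    next
      case False
      then show ?thesis using s.rec[of i] s.step_pos[of i] B i by simp
    qed
    then show "\<theta> * B (i + 2) + (1 - \<theta>) * B i = 2 * B (i + 1)" "0 < B (i + 2) + B i" by auto
  qed (use s.th in auto)
  show ?thesis
  proof (rule t'.convex_of_layered_points[OF _ seqB C e \<sigma>])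
    show "b + 3 \<le> k + 1" "3 \<le> k + 1" using b by auto
    \<comment> \<open>Cube \<open>b\<close> belongs to \<open>T\<close> and involves only old terms,
      so the sign carries over.\<close>
    show "seq_disc \<theta> B b < 0" using M B b by (simp add: seq_disc_def seq_gap_def)
    fix v l assume v: "coord_sum v = int l" "l \<le> k + 1"
    show "\<exists>\<nu>>0. vpt \<phi>' v = \<nu> *\<^sub>R cvec (zphase v * (e * Complex (B (l + 1)) (- B l))) (yphase v * of_real \<sigma>) (C * seq_height \<theta> B l)"
    proof (cases "l \<le> k")
      case True
      then have "B l = A l" "B (l + 1) = A (l + 1)" using B by auto
      then show ?thesis using form'[OF v(1) True] \<nu>[OF True] by (auto simp: seq_height_def)
    next
      case False
      then have l: "l = k + 1" using v by simp
      have "\<theta> * a + (1 - \<theta>) * A k = 2 * A (k + 1)" using s.th by (simp add: a_def)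
      then have "seq_height \<theta> B l = seq_height \<theta> A k + a + A k"
        using B Bk by (simp add: l seq_height_def algebra_simps)
      then show ?thesis using top(1)[of v] v l B Bk by simp
    qed
  qed
qed

end
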